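(* Let $n\ge2$, let $\Omega\subset\mathbb{R}^n$ be a bounded domain with $C^3$ boundary and outward unit normal $\vec{\mathbf n}$, let $\alpha\in(0,1)$, and let $c,f\in C^{1,\alpha}(\overline\Omega\times\mathbb{R})$ satisfy, for some constant $C$, $|c|\le C$, $|D_xc|\le C$, $c_z\le 0$, $|f|\le C$, $|D_xf|\le C$, $f_z\ge 0$ at all $(x,z)\in\overline\Omega\times\mathbb{R}$. Let $\phi\in C^3(\overline\Omega)$, $T\in(0,\infty)$, and let $(\eta,q)$ satisfy either $\eta=1$ and $q>0$, or $\eta\in(0,1]$ and $q=1$. Let $u_0\in C^{2,\alpha}(\overline\Omega)$ satisfy $\frac{\partial u_0}{\partial\vec{\mathbf n}}=\phi(\sqrt{\eta^2+|Du_0|^2})^{1-q}$ on $\partial\Omega$. Suppose that a solution $u^\eta\in C^{2,\sigma}(\overline\Omega\times[0,T])\cap C^{3,\sigma}(\Omega\times(0,T])$, for some $\sigma\in(0,1)$, exists for the problem $$u_t=\sqrt{\eta^2+|Du|^2}\,\mathrm{div}\Big(\tfrac{Du}{\sqrt{\eta^2+|Du|^2}}\Big)+c(x,u)\sqrt{\eta^2+|Du|^2}-f(x,u)\ \text{ in }\Omega\times(0,T),$$ $$\tfrac{\partial u}{\partial\vec{\mathbf n}}=\phi(x)(\sqrt{\eta^2+|Du|^2})^{1-q}\ \text{ on }\partial\Omega\times[0,T),\qquad u(x,0)=u_0(x)\ \text{ on }\overline\Omega.$$ Then $$\|Du^\eta\|_{L^\infty(\overline\Omega\times[0,T])}\le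 R_T,$$ where $R_T>1$ is a constant depending only on $T,\Omega,c,f,\phi,q,u_0$ (in particular not on $\eta$).
   Context: $D$ denotes the gradient in $x$. *)

theory Defs
  imports "HOL-Analysis.Analysis" "HOL-Probability.Essential_Supremum"
begin

text \<open>
  Functions on a set \<open>S\<close> with \<open>Q \<subseteq> S \<subseteq> closure Q\<close>, \<open>Q\<close> open, are total functions of
  which only the values on \<open>S\<close> matter. Derivatives are taken in \<open>Q\<close>; at points of \<open>S - Q\<close> a derivative
  means the continuous extension from \<open>Q\<close> (the usual meaning of \<open>C\<^sup>k\<close> up to the boundary).
  Space-time functions, and functions of \<open>(x, z)\<close>, are functions on the product \<open>\<real>\<^sup>n \<times> \<real>\<close>.
\<close>

definition dir_deriv :: "'a::real_vector \<Rightarrow> ('a \<Rightarrow> real) \<Rightarrow> 'a \<Rightarrow> real" where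
  "dir_deriv b u x = deriv (\<lambda>s::real. u (x + s *\<^sub>R b)) 0"

definition iter_deriv :: "'a::real_vector list \<Rightarrow> ('a \<Rightarrow> real) \<Rightarrow> 'a \<Rightarrow> real" where
  "iter_deriv bs u = foldr dir_deriv bs u"

definition ext :: "'a::topological_space set \<Rightarrow> ('a \<Rightarrow> 'b::t2_space) \<Rightarrow> 'a \<Rightarrow> 'b" where
  "ext Q g x = Lim (at x within Q) g"

definition grad :: "((real ^ 'n) \<Rightarrow> real) \<Rightarrow> real ^ 'n \<Rightarrow> real ^ 'n" where
  "grad u x = (\<chi> i. dir_deriv (axis i 1) u x)"

definition grad_x :: "((real ^ 'n) \<times> real \<Rightarrow> real) \<Rightarrow> (real ^ 'n) \<times> real \<Rightarrow> real ^ 'n" where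
  "grad_x u p = (\<chi> i. dir_deriv (axis i 1, 0) u p)"

definition deriv_snd :: "((real ^ 'n) \<times> real \<Rightarrow> real) \<Rightarrow> (real ^ 'n) \<times> real \<Rightarrow> real" where
  "deriv_snd u p = dir_deriv (0, 1) u p"

definition divergence :: "((real ^ 'n) \<Rightarrow> real ^ 'n) \<Rightarrow> real ^ 'n \<Rightarrow> real" where
  "divergence F x = (\<Sum>i\<in>UNIV. dir_deriv (axis i 1) (\<lambda>y. F y $ i) x)"

text \<open>
  The order of a mixed partial derivative, given by a list of basis directions, is the sum of the
  weights of the directions: weight 1 for all directions in the isotropic classes, and
  weight 2 for the time direction in the parabolic ones.
\<close>

definition weighted_C :: "('a::euclidean_space \<Rightarrow> nat) \<Rightarrow> nat \<Rightarrow> 'a set \<Rightarrow> 'a set \<Rightarrow> ('a \<Rightarrow> real) \<Rightarrow> bool"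
  where
  "weighted_C w k Q S u \<longleftrightarrow>
     continuous_on S u \<and>
     (\<forall>b bs. set (b # bs) \<subseteq> Basis \<and> sum_list (map w (b # bs)) \<le> k \<longrightarrow>
        (\<forall>x\<in>Q. (\<lambda>s::real. iter_deriv bs u (x + s *\<^sub>R b)) differentiable (at 0))) \<and>
     (\<forall>bs. set bs \<subseteq> Basis \<and> sum_list (map w bs) \<le> k \<longrightarrow>
        (\<exists>g. continuous_on S g \<and> (\<forall>x\<in>Q. g x = iter_deriv bs u x)))"

definition C_class :: "nat \<Rightarrow> 'a::euclidean_space set \<Rightarrow> 'a set \<Rightarrow> ('a \<Rightarrow> real) \<Rightarrow> bool" where
  "C_class k Q S u \<longleftrightarrow> weighted_C (\<lambda>_. 1) k Q S u"

text \<open>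
  Hoelder conditions are required on compact subsets of \<open>S\<close>. For compact \<open>S\<close> (such as
  \<open>closure \<Omega>\<close> or \<open>closure \<Omega> \<times> {0..T}\<close>) this is the uniform Hoelder condition on \<open>S\<close>.
\<close>

definition C_holder :: "nat \<Rightarrow> real \<Rightarrow> 'a::euclidean_space set \<Rightarrow> 'a set \<Rightarrow> ('a \<Rightarrow> real) \<Rightarrow> bool" where
  "C_holder k \<alpha> Q S u \<longleftrightarrow>
     C_class k Q S u \<and>
     (\<forall>bs K. set bs \<subseteq> Basis \<and> length bs = k \<and> compact K \<and> K \<subseteq> S \<longrightarrow>
        (\<exists>L. \<forall>x\<in>K. \<forall>y\<in>K.
           \<bar>ext Q (iter_deriv bs u) x - ext Q (iter_deriv bs u) y\<bar> \<le> L * dist x y powr \<alpha>))"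

definition parabolic_weight :: "(real ^ 'n) \<times> real \<Rightarrow> nat" where
  "parabolic_weight b = (if snd b = 0 then 1 else 2)"

text \<open>
  The parabolic class with exponents \<open>k + \<sigma>\<close> in space and \<open>(k + \<sigma>) / 2\<close> in time: derivatives of
  parabolic order \<open>k\<close> are Hoelder continuous with exponent \<open>\<sigma>\<close> in \<open>x\<close> and \<open>\<sigma> / 2\<close> in \<open>t\<close>, those of
  parabolic order \<open>k - 1\<close> are Hoelder continuous with exponent \<open>(1 + \<sigma>) / 2\<close> in \<open>t\<close>.
\<close>

definition C_parabolic ::
  "nat \<Rightarrow> real \<Rightarrow> ((real ^ 'n) \<times> real) set \<Rightarrow> ((real ^ 'n) \<times> real) set \<Rightarrow> ((real ^ 'n) \<times> real \<Rightarrow> real) \<Rightarrow> bool"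
  where
  "C_parabolic k \<sigma> Q S u \<longleftrightarrow>
     weighted_C parabolic_weight k Q S u \<and>
     (\<forall>bs K. set bs \<subseteq> Basis \<and> sum_list (map parabolic_weight bs) = k \<and> compact K \<and> K \<subseteq> S \<longrightarrow>
        (\<exists>L. \<forall>(x, t)\<in>K. \<forall>(y, s)\<in>K.
           \<bar>ext Q (iter_deriv bs u) (x, t) - ext Q (iter_deriv bs u) (y, s)\<bar>
             \<le> L * (dist x y powr \<sigma> + \<bar>t - s\<bar> powr (\<sigma> / 2)))) \<and>
     (\<forall>bs K. set bs \<subseteq> Basis \<and> sum_list (map parabolic_weight bs) + 1 = k \<and> compact K \<and> K \<subseteq> S \<longrightarrow>
        (\<exists>L. \<forall>(x, t)\<in>K. \<forall>(y, s)\<in>K. x = y \<longrightarrow>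
           \<bar>ext Q (iter_deriv bs u) (x, t) - ext Q (iter_deriv bs u) (y, s)\<bar>
             \<le> L * \<bar>t - s\<bar> powr ((1 + \<sigma>) / 2)))"

text \<open>
  Near \<open>x\<close>, \<open>\<Omega>\<close> is the region above the graph of a \<open>C\<^sup>k\<close> function over the hyperplane orthogonal to
  the unit vector \<open>e\<close>; functions on that hyperplane are rendered as functions \<open>\<gamma>\<close> on the whole
  space that are invariant in the direction \<open>e\<close>.
\<close>

definition graph_chart ::
  "nat \<Rightarrow> (real ^ 'n) set \<Rightarrow> real ^ 'n \<Rightarrow> real \<Rightarrow> real ^ 'n \<Rightarrow> ((real ^ 'n) \<Rightarrow> real) \<Rightarrow> bool" where
  "graph_chart k \<Omega> x r e \<gamma> \<longleftrightarrow>
     r > 0 \<and> norm e = 1 \<and> C_class k UNIV UNIV \<gamma> \<and> (\<forall>y s. \<gamma> (y + s *\<^sub>R e) = \<gamma> y) \<and>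
     \<Omega> \<inter> ball x r = {y \<in> ball x r. \<gamma> y < y \<bullet> e}"

definition C_boundary :: "nat \<Rightarrow> (real ^ 'n) set \<Rightarrow> bool" where
  "C_boundary k \<Omega> \<longleftrightarrow> (\<forall>x\<in>frontier \<Omega>. \<exists>r e \<gamma>. graph_chart k \<Omega> x r e \<gamma>)"

text \<open>
  In a chart, \<open>\<Omega>\<close> is the set where \<open>\<gamma> y - y \<bullet> e < 0\<close>, so the gradient of this function points outward.
\<close>

definition outward_unit_normal :: "(real ^ 'n) set \<Rightarrow> real ^ 'n \<Rightarrow> real ^ 'n \<Rightarrow> bool" where
  "outward_unit_normal \<Omega> x \<nu> \<longleftrightarrow>
     (\<exists>r e \<gamma>. graph_chart 1 \<Omega> x r e \<gamma> \<and> \<nu> = sgn (grad \<gamma> x - e))"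

definition Linf_norm :: "'a::euclidean_space set \<Rightarrow> ('a \<Rightarrow> 'b::real_normed_vector) \<Rightarrow> ereal" where
  "Linf_norm S g = esssup (lebesgue_on S) (\<lambda>p. ereal (norm (g p)))"

definition slope :: "real \<Rightarrow> real ^ 'n \<Rightarrow> real" where
  "slope \<eta> p = sqrt (\<eta>\<^sup>2 + (norm p)\<^sup>2)"

definition boundary_compatible ::
  "(real ^ 'n) set \<Rightarrow> ((real ^ 'n) \<Rightarrow> real ^ 'n) \<Rightarrow> ((real ^ 'n) \<Rightarrow> real) \<Rightarrow> real \<Rightarrow> real \<Rightarrow> ((real ^ 'n) \<Rightarrow> real) \<Rightarrow> bool"
  where
  "boundary_compatible \<Omega> \<nu> \<phi> \<eta> q u0 \<longleftrightarrow>
     (\<forall>x\<in>frontier \<Omega>. ext \<Omega> (grad u0) x \<bullet> \<nu> x = \<phi> x * slope \<eta> (ext \<Omega> (grad u0) x) powr (1 - q))"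

definition solves_problem ::
  "(real ^ 'n) set \<Rightarrow> ((real ^ 'n) \<Rightarrow> real ^ 'n) \<Rightarrow> ((real ^ 'n) \<times> real \<Rightarrow> real) \<Rightarrow> ((real ^ 'n) \<times> real \<Rightarrow> real) \<Rightarrow>
   ((real ^ 'n) \<Rightarrow> real) \<Rightarrow> real \<Rightarrow> real \<Rightarrow> real \<Rightarrow> ((real ^ 'n) \<Rightarrow> real) \<Rightarrow> ((real ^ 'n) \<times> real \<Rightarrow> real) \<Rightarrow> bool"
  where
  "solves_problem \<Omega> \<nu> c f \<phi> T \<eta> q u0 u \<longleftrightarrow>
     (\<forall>x\<in>\<Omega>. \<forall>t\<in>{0<..<T}.
        deriv_snd u (x, t) =
          slope \<eta> (grad_x u (x, t)) *
            divergence (\<lambda>y. grad_x u (y, t) /\<^sub>R slope \<eta> (grad_x u (y, t))) x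
          + c (x, u (x, t)) * slope \<eta> (grad_x u (x, t))
          - f (x, u (x, t))) \<and>
     (\<forall>x\<in>frontier \<Omega>. \<forall>t\<in>{0..<T}.
        ext (\<Omega> \<times> {0<..<T}) (grad_x u) (x, t) \<bullet> \<nu> x =
          \<phi> x * slope \<eta> (ext (\<Omega> \<times> {0<..<T}) (grad_x u) (x, t)) powr (1 - q)) \<and>
     (\<forall>x\<in>closure \<Omega>. u (x, 0) = u0 x)"

end

theory Submission
  imports Defs
begin

text \<open>
  Write \<open>v = sqrt (\<eta>\<^sup>2 + |Du|\<^sup>2)\<close>. The proof is a Bernstein argument: a function of the gradient that is
  comparable with a power of \<open>v\<close> is shown to have no space-time maximum at which \<open>v\<close> is large, unless
  the maximum is attained at the initial time.

  The function is \<open>w = v\<^bsup>1+q\<^esup> / (1 + q) - \<phi> N \<bullet> Du\<close>, where \<open>N\<close> is a \<open>C\<^sup>2\<close> extension of the outward normal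
  \<open>\<nu>\<close> to the closure of \<open>\<Omega>\<close>. The choice is dictated by its gradient with respect to \<open>Du\<close>, which is
  \<open>V = v\<^bsup>q-1\<^esup> Du - \<phi> N\<close>. On the boundary \<open>Du \<bullet> \<nu> = \<phi> v\<^bsup>1-q\<^esup>\<close>, so \<open>V\<close> is \<open>v\<^bsup>q-1\<^esup>\<close> times the tangential part of
  \<open>Du\<close>. Hence the normal derivative of \<open>w\<close> involves the second derivatives of \<open>u\<close> only through
  \<open>V \<bullet> D\<^sup>2u \<nu>\<close>, a mixed tangential-normal one, and not through \<open>u\<^sub>\<nu>\<^sub>\<nu>\<close>, over which nothing is known. The
  mixed derivative is bounded by differentiating the boundary condition along the tangential part of
  \<open>Du\<close> and by using that the tangential derivative of \<open>w\<close> vanishes at a maximum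
  (\<open>boundary_inequality\<close>). Since \<open>q > 0\<close>, the term \<open>\<phi> N \<bullet> Du\<close> is of lower order and \<open>w\<close> is of size
  \<open>v\<^bsup>1+q\<^esup>\<close> (\<open>large_slope_bounds\<close>).

  In the interior the equation is differentiated in the direction \<open>V\<close>. In the resulting evolution
  equation for \<open>w\<close> the form \<open>v\<^bsup>q-1\<^esup> tr (A (D\<^sup>2u)\<^sup>2)\<close>, with \<open>A\<close> the coefficient matrix of the mean curvature
  operator, appears with a good sign. It absorbs the other terms with second derivatives, up to one in which
  the first order condition at a maximum replaces them by first derivatives; the conditions
  \<open>c\<^sub>z \<le> 0\<close> and \<open>f\<^sub>z \<ge> 0\<close> give the zeroth order terms a good sign; what remains is at most a multiple of \<open>w\<close> (\<open>interior_inequality\<close>).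

  The maximum is taken of \<open>w exp (\<lambda> \<zeta> - M t)\<close>, where \<open>\<zeta>\<close> vanishes on the boundary and has normal
  derivative at most \<open>- 1\<close> there. First \<open>\<lambda>\<close> is chosen so large that no maximum with large \<open>v\<close> lies on
  the boundary (\<open>weighted_max_not_boundary\<close>), then \<open>M\<close>, which depends on \<open>\<lambda>\<close>, so large that none lies in
  the interior (\<open>weighted_max_not_interior\<close>). So the maximum is controlled by the initial data and by the
  threshold for \<open>v\<close>, and the factor \<open>exp (M T)\<close> is the price for removing the weight. The constants see
  \<open>\<eta>\<close> only through \<open>0 < \<eta> \<le> 1\<close>, so the bound is uniform in \<open>\<eta>\<close>.

  The calculus behind this starts from directional derivatives in coordinate directions. It needs that
  continuous partial derivatives give Frechet derivatives (\<open>has_derivative_of_continuous_partials\<close>) and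
  commute (\<open>mixed_partials_commute\<close>), that derivatives with continuous extensions to the closure are
  derivatives within the closure (\<open>derivative_up_to_boundary\<close>), so that the boundary condition can be
  differentiated along curves in the boundary, and the functions \<open>N\<close> and \<open>\<zeta>\<close>, which are glued from
  boundary charts (\<open>boundary_functions\<close>).
\<close>

section \<open>From partial derivatives to Frechet derivatives\<close>

lemma DERIV_along_line:
  fixes g :: "'a::real_normed_vector \<Rightarrow> real"
  assumes "((\<lambda>r. g ((y + s *\<^sub>R b) + r *\<^sub>R b)) has_real_derivative d) (at 0)"
  shows "((\<lambda>r. g (y + r *\<^sub>R b)) has_real_derivative d) (at s)"
proof -
  have "((\<lambda>r. (\<lambda>r. g (y + r *\<^sub>R b)) (r + s)) has_real_derivative d) (at 0)"
    using assms by (simp add: scaleR_add_left add.assoc add.commute add.left_commute)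
  then show ?thesis
    using DERIV_shift[of "\<lambda>r. g (y + r *\<^sub>R b)" d 0 s] by simp
qed

text \<open>
  The displacement \<open>h\<close> is reached one coordinate at a time. The intermediate displacements
  \<open>h' + s b\<close> with \<open>|s| \<le> |h \<bullet> b|\<close> are not longer than \<open>h\<close>, so every leg stays in the ball and the mean value
  theorem applies to it.
\<close>

lemma increment_bound_coordinates:
  fixes g :: "'a::euclidean_space \<Rightarrow> real"
  assumes der: "\<And>b y. b \<in> Basis \<Longrightarrow> y \<in> ball x \<delta> \<Longrightarrow>
      ((\<lambda>s. g (y + s *\<^sub>R b)) has_real_derivative D b y) (at 0)"
    and osc: "\<And>b y. b \<in> Basis \<Longrightarrow> y \<in> ball x \<delta> \<Longrightarrow> \<bar>D b y - D b x\<bar> \<le> \<epsilon>"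
    and "B \<subseteq> Basis" "\<And>b. b \<in> Basis - B \<Longrightarrow> h \<bullet> b = 0" "norm h < \<delta>"
  shows "\<bar>g (x + h) - g x - (\<Sum>b\<in>B. (h \<bullet> b) * D b x)\<bar> \<le> \<epsilon> * (\<Sum>b\<in>B. \<bar>h \<bullet> b\<bar>)"
proof -
  have "finite B" using assms(3) finite_Basis finite_subset by blast
  then show ?thesis using assms(3-5)
  proof (induction B arbitrary: h rule: finite_induct)
    case empty
    then have "h = 0" by (metis Diff_empty euclidean_all_zero_iff)
    then show ?case by simp
  next
    case (insert b B)
    define h' where "h' = h - (h \<bullet> b) *\<^sub>R b"
    have b: "b \<in> Basis" using insert by auto
    have bb: "b \<bullet> b = 1" using b by (simp add: inner_same_Basis)
    have orth: "h' \<bullet> b = 0" by (simp add: h'_def inner_diff_left bb)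
    have comp: "h' \<bullet> b' = h \<bullet> b'" if "b' \<in> Basis" "b' \<noteq> b" for b'
      using that b by (simp add: h'_def inner_diff_left inner_not_same_Basis)
    have nh: "norm (h' + s *\<^sub>R b) < \<delta>" if "\<bar>s\<bar> \<le> \<bar>h \<bullet> b\<bar>" for s
    proof -
      have e: "(norm (h' + s *\<^sub>R b))\<^sup>2 = (norm h')\<^sup>2 + s\<^sup>2" for s
        using norm_add_Pythagorean[of h' "s *\<^sub>R b"] orth b by (simp add: orthogonal_def)
      have "h' + (h \<bullet> b) *\<^sub>R b = h" by (simp add: h'_def)
      moreover have "s\<^sup>2 \<le> (h \<bullet> b)\<^sup>2" using that by (simp add: abs_le_square_iff)
      ultimately have "(norm (h' + s *\<^sub>R b))\<^sup>2 \<le> (norm h)\<^sup>2"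
        using e[of s] e[of "h \<bullet> b"] by simp
      then have "norm (h' + s *\<^sub>R b) \<le> norm h" by (rule power2_le_imp_le) simp
      then show ?thesis using insert.prems by simp
    qed
    have IH: "\<bar>g (x + h') - g x - (\<Sum>b\<in>B. (h' \<bullet> b) * D b x)\<bar> \<le> \<epsilon> * (\<Sum>b\<in>B. \<bar>h' \<bullet> b\<bar>)"
    proof (rule insert.IH)
      show "B \<subseteq> Basis" using insert by auto
      show "h' \<bullet> b' = 0" if "b' \<in> Basis - B" for b'
        using that orth comp insert.prems by (cases "b' = b") auto
      show "norm h' < \<delta>" using nh[of 0] by simp
    qed
    have compB: "h' \<bullet> b' = h \<bullet> b'" if "b' \<in> B" for b'
      using that insert.hyps insert.prems(1) by (intro comp) auto
    have s: "(\<Sum>b\<in>B. (h' \<bullet> b) * D b x) = (\<Sum>b\<in>B. (h \<bullet> b) * D b x)"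
      "(\<Sum>b\<in>B. \<bar>h' \<bullet> b\<bar>) = (\<Sum>b\<in>B. \<bar>h \<bullet> b\<bar>)"
      using compB by (auto intro!: sum.cong)
    define S where "S = closed_segment 0 (h \<bullet> b)"
    have Sle: "\<bar>r\<bar> \<le> \<bar>h \<bullet> b\<bar>" if "r \<in> S" for r
      using that segment_bound1[of r 0 "h \<bullet> b"] by (simp add: S_def)
    have "norm (((\<lambda>r. g (x + h' + r *\<^sub>R b) - r * D b x) (h \<bullet> b)) - ((\<lambda>r. g (x + h' + r *\<^sub>R b) - r * D b x) 0))
          \<le> \<epsilon> * norm (h \<bullet> b - 0)"
    proof (rule field_differentiable_bound[where S=S and f'="\<lambda>r. D b (x + h' + r *\<^sub>R b) - D b x"])
      show "convex S" by (simp add: S_def)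
      fix r assume r: "r \<in> S"
      have i: "x + h' + r *\<^sub>R b \<in> ball x \<delta>"
        using nh[OF Sle[OF r]] by (metis add.assoc add_diff_cancel_left' dist_commute dist_norm mem_ball)
      have "((\<lambda>r. g (x + h' + r *\<^sub>R b)) has_real_derivative D b (x + h' + r *\<^sub>R b)) (at r)"
        by (rule DERIV_along_line, rule der[OF b i])
      then have "((\<lambda>r. g (x + h' + r *\<^sub>R b) - r * D b x) has_real_derivative D b (x + h' + r *\<^sub>R b) - D b x) (at r)"
        by (auto intro!: derivative_eq_intros)
      then show "((\<lambda>r. g (x + h' + r *\<^sub>R b) - r * D b x) has_field_derivative D b (x + h' + r *\<^sub>R b) - D b x) (at r within S)"
        by (rule has_field_derivative_at_within)
      show "norm (D b (x + h' + r *\<^sub>R b) - D b x) \<le> \<epsilon>"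
        using osc[OF b i] by simp
    qed (auto simp: S_def)
    then have "\<bar>g (x + h) - (h \<bullet> b) * D b x - g (x + h')\<bar> \<le> \<epsilon> * \<bar>h \<bullet> b\<bar>"
      by (simp add: h'_def)
    then show ?case using IH insert.hyps unfolding s by (simp add: algebra_simps)
  qed
qed

lemma has_derivative_of_continuous_partials:
  fixes g :: "'a::euclidean_space \<Rightarrow> real"
  assumes "open Q" "x \<in> Q"
    and der: "\<And>b y. b \<in> Basis \<Longrightarrow> y \<in> Q \<Longrightarrow>
      ((\<lambda>s. g (y + s *\<^sub>R b)) has_real_derivative D b y) (at 0)"
    and cont: "\<And>b. b \<in> Basis \<Longrightarrow> continuous_on Q (D b)"
  shows "(g has_derivative (\<lambda>h. \<Sum>b\<in>Basis. (h \<bullet> b) * D b x)) (at x)"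
  unfolding has_derivative_at_alt
proof (intro conjI allI impI)
  show "bounded_linear (\<lambda>h. \<Sum>b\<in>Basis. (h \<bullet> b) * D b x)"
    by (intro bounded_linear_sum bounded_linear_mult_const bounded_linear_inner_left)
next
  fix e :: real assume e: "e > 0"
  define \<epsilon> where "\<epsilon> = e / DIM('a)"
  have ep: "\<epsilon> > 0" using e by (simp add: \<epsilon>_def)
  obtain \<delta>0 where d0: "\<delta>0 > 0" "ball x \<delta>0 \<subseteq> Q" using assms(1,2) openE by blast
  have "\<forall>\<^sub>F y in at x. \<forall>b\<in>Basis. dist (D b y) (D b x) < \<epsilon>"
  proof (subst eventually_ball_finite_distrib[OF finite_Basis], intro ballI)
    fix b :: 'a assume "b \<in> Basis"
    then have "(D b \<longlongrightarrow> D b x) (at x)"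
      using cont assms(1,2) by (metis continuous_on_eq_continuous_at isCont_def)
    then show "\<forall>\<^sub>F y in at x. dist (D b y) (D b x) < \<epsilon>" using ep by (rule tendstoD)
  qed
  then obtain \<delta>1 where d1: "\<delta>1 > 0" "\<And>y. y \<noteq> x \<Longrightarrow> dist y x < \<delta>1 \<Longrightarrow> \<forall>b\<in>Basis. dist (D b y) (D b x) < \<epsilon>"
    unfolding eventually_at by blast
  define \<delta> where "\<delta> = min \<delta>0 \<delta>1"
  have "norm (g y - g x - (\<Sum>b\<in>Basis. ((y - x) \<bullet> b) * D b x)) \<le> e * norm (y - x)" if "norm (y - x) < \<delta>" for y
  proof -
    have "\<bar>g (x + (y - x)) - g x - (\<Sum>b\<in>Basis. ((y-x) \<bullet> b) * D b x)\<bar> \<le> \<epsilon> * (\<Sum>b\<in>Basis. \<bar>(y-x) \<bullet> b\<bar>)"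
    proof (rule increment_bound_coordinates[where \<delta>=\<delta>])
      fix b z :: 'a assume bz: "b \<in> Basis" "z \<in> ball x \<delta>"
      show "((\<lambda>s. g (z + s *\<^sub>R b)) has_real_derivative D b z) (at 0)"
        using der bz d0 by (auto simp: \<delta>_def)
      show "\<bar>D b z - D b x\<bar> \<le> \<epsilon>"
        using d1(2)[of z] bz ep by (cases "z = x") (auto simp: \<delta>_def dist_commute dist_real_def intro: less_imp_le)
    qed (use that in auto)
    also have "\<dots> \<le> \<epsilon> * (\<Sum>b\<in>(Basis::'a set). norm (y - x))"
      using ep by (intro mult_left_mono sum_mono) (auto simp: Basis_le_norm)
    also have "\<dots> = e * norm (y - x)" by (simp add: \<epsilon>_def)
    finally show ?thesis by simp
  qed
  then show "\<exists>d>0. \<forall>y. norm (y - x) < d \<longrightarrow> norm (g y - g x - (\<Sum>b\<in>Basis. ((y - x) \<bullet> b) * D b x)) \<le> e * norm (y - x)"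
    using d0 d1 by (intro exI[of _ \<delta>]) (auto simp: \<delta>_def)
qed

text \<open>
  The second difference of \<open>g\<close> over the parallelogram spanned by \<open>s a\<close> and \<open>s b\<close> equals \<open>s\<^sup>2\<close> times either
  mixed derivative at some point of a small ball, by applying the mean value theorem twice in either
  order. Only the two mixed derivatives occur; this matters for \<open>u\<close>, which has mixed derivatives
  in \<open>x\<close> and \<open>t\<close> but whose second time derivative may fail to exist.
\<close>

lemma mixed_partials_commute:
  fixes g :: "'a::real_normed_vector \<Rightarrow> real"
  assumes Q: "open Q" "x \<in> Q"
    and a: "\<And>y. y \<in> Q \<Longrightarrow> ((\<lambda>s. g (y + s *\<^sub>R a)) has_real_derivative ga y) (at 0)"
    and b: "\<And>y. y \<in> Q \<Longrightarrow> ((\<lambda>s. g (y + s *\<^sub>R b)) has_real_derivative gb y) (at 0)"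
    and ab: "\<And>y. y \<in> Q \<Longrightarrow> ((\<lambda>s. gb (y + s *\<^sub>R a)) has_real_derivative gab y) (at 0)"
    and ba: "\<And>y. y \<in> Q \<Longrightarrow> ((\<lambda>s. ga (y + s *\<^sub>R b)) has_real_derivative gba y) (at 0)"
    and cont: "continuous_on Q gab" "continuous_on Q gba"
  shows "gab x = gba x"
proof -
  have key: "\<exists>y\<in>ball x \<delta>. g (x + s *\<^sub>R a + s *\<^sub>R b) - g (x + s *\<^sub>R a) - g (x + s *\<^sub>R b) + g x = s * (s * gba y)"
    if d: "ball x \<delta> \<subseteq> Q" and s: "0 < s" "s * (norm a + norm b) < \<delta>"
    and a: "\<And>y. y \<in> Q \<Longrightarrow> ((\<lambda>s. g (y + s *\<^sub>R a)) has_real_derivative ga y) (at 0)"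
    and ba: "\<And>y. y \<in> Q \<Longrightarrow> ((\<lambda>s. ga (y + s *\<^sub>R b)) has_real_derivative gba y) (at 0)"
    for \<delta> s and a b :: 'a and ga gba :: "'a \<Rightarrow> real"
  proof -
    have mem: "x + p *\<^sub>R a + r *\<^sub>R b \<in> ball x \<delta>" if "0 \<le> p" "p \<le> s" "0 \<le> r" "r \<le> s" for p r
    proof -
      have "norm (p *\<^sub>R a + r *\<^sub>R b) \<le> p * norm a + r * norm b"
        using that norm_triangle_ineq[of "p *\<^sub>R a" "r *\<^sub>R b"] by simp
      also have "\<dots> \<le> s * norm a + s * norm b" using that by (intro add_mono mult_right_mono) auto
      finally have "norm (p *\<^sub>R a + r *\<^sub>R b) < \<delta>" using s by (simp add: algebra_simps)
      moreover have "dist x (x + p *\<^sub>R a + r *\<^sub>R b) = norm (p *\<^sub>R a + r *\<^sub>R b)"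
        by (metis add.assoc add_diff_cancel_left' dist_commute dist_norm)
      ultimately show ?thesis by simp
    qed
    define k where "k p = g (x + s *\<^sub>R b + p *\<^sub>R a) - g (x + p *\<^sub>R a)" for p
    have kd: "(k has_real_derivative (ga (x + s *\<^sub>R b + p *\<^sub>R a) - ga (x + p *\<^sub>R a))) (at p)"
      if "0 \<le> p" "p \<le> s" for p
      unfolding k_def
    proof (intro DERIV_diff; rule DERIV_along_line; rule a)
      show "x + s *\<^sub>R b + p *\<^sub>R a \<in> Q" "x + p *\<^sub>R a \<in> Q"
        using that mem[of p s] mem[of p 0] d s by (auto simp: add.commute add.left_commute)
    qed
    obtain p where p: "0 < p" "p < s" "k s - k 0 = (s - 0) * (ga (x + s *\<^sub>R b + p *\<^sub>R a) - ga (x + p *\<^sub>R a))"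
      using MVT2[OF s(1), of k "\<lambda>p. ga (x + s *\<^sub>R b + p *\<^sub>R a) - ga (x + p *\<^sub>R a)"] kd by auto
    define l where "l r = ga (x + p *\<^sub>R a + r *\<^sub>R b)" for r
    have ld: "(l has_real_derivative gba (x + p *\<^sub>R a + r *\<^sub>R b)) (at r)" if "0 \<le> r" "r \<le> s" for r
      unfolding l_def
      by (rule DERIV_along_line, rule ba) (use that mem[of p r] d p(1,2) in auto)
    obtain r where r: "0 < r" "r < s" "l s - l 0 = (s - 0) * gba (x + p *\<^sub>R a + r *\<^sub>R b)"
      using MVT2[OF s(1), of l "\<lambda>r. gba (x + p *\<^sub>R a + r *\<^sub>R b)"] ld by auto
    have "k s - k 0 = s * (s * gba (x + p *\<^sub>R a + r *\<^sub>R b))"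
      using p(3) r(3) by (simp add: l_def add.commute add.left_commute)
    then show ?thesis using mem[of p r] p r
      by (intro bexI[of _ "x + p *\<^sub>R a + r *\<^sub>R b"]) (auto simp: k_def algebra_simps)
  qed
  show ?thesis
  proof (rule ccontr)
    assume ne: "gab x \<noteq> gba x"
    define e where "e = \<bar>gab x - gba x\<bar> / 2"
    have e: "e > 0" using ne by (simp add: e_def)
    obtain \<delta>0 where d0: "\<delta>0 > 0" "ball x \<delta>0 \<subseteq> Q" using Q openE by blast
    have "isCont gab x" "isCont gba x" using cont Q by (auto simp: continuous_on_eq_continuous_at)
    then obtain \<delta>1 \<delta>2 where d1: "\<delta>1 > 0" "\<And>y. dist y x < \<delta>1 \<Longrightarrow> dist (gab y) (gab x) < e"
       and d2: "\<delta>2 > 0" "\<And>y. dist y x < \<delta>2 \<Longrightarrow> dist (gba y) (gba x) < e"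
      using e unfolding continuous_at_eps_delta by metis
    define \<delta> where "\<delta> = min \<delta>0 (min \<delta>1 \<delta>2)"
    have d: "\<delta> > 0" "ball x \<delta> \<subseteq> Q" using d0 d1 d2 by (auto simp: \<delta>_def)
    define s where "s = \<delta> / (2 * (norm a + norm b + 1))"
    have pos: "norm a + norm b + 1 > 0" by (simp add: add_nonneg_pos)
    have s: "s > 0" using d pos by (simp add: s_def)
    have "s * (norm a + norm b) \<le> s * (norm a + norm b + 1)" using s by simp
    also have "\<dots> = \<delta> / 2" using pos by (simp add: s_def field_simps)
    also have "\<dots> < \<delta>" using d by simp
    finally have s': "s * (norm a + norm b) < \<delta>" .
    obtain y1 where y1: "y1 \<in> ball x \<delta>"
      "g (x + s *\<^sub>R a + s *\<^sub>R b) - g (x + s *\<^sub>R a) - g (x + s *\<^sub>R b) + g x = s * (s * gba y1)"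
      using key[OF d(2) s s' a ba] by blast
    have s'': "s * (norm b + norm a) < \<delta>" using s' by (simp add: add.commute)
    obtain y2 where y2: "y2 \<in> ball x \<delta>"
      "g (x + s *\<^sub>R b + s *\<^sub>R a) - g (x + s *\<^sub>R b) - g (x + s *\<^sub>R a) + g x = s * (s * gab y2)"
      using key[OF d(2) s s'' b ab] by blast
    have "s * (s * gba y1) = s * (s * gab y2)"
      using y1(2) y2(2) by (simp add: add.commute add.left_commute algebra_simps)
    then have "gba y1 = gab y2" using s by simp
    moreover have "dist (gba y1) (gba x) < e" "dist (gab y2) (gab x) < e"
      using y1(1) y2(1) d2(2)[of y1] d1(2)[of y2] by (simp_all add: \<delta>_def dist_commute[of x])
    ultimately have "\<bar>gab x - gba x\<bar> < e + e" unfolding dist_real_def by (smt (verit))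
    then show False by (simp add: e_def)
  qed
qed

section \<open>Functions of class C^k and boundary charts\<close>

lemma sum_axis_Basis:
  fixes f :: "real ^ 'n \<Rightarrow> 'b::comm_monoid_add"
  shows "(\<Sum>b\<in>Basis. f b) = (\<Sum>i\<in>UNIV. f (axis i 1))"
proof -
  have B: "(Basis :: (real^'n) set) = (\<lambda>i. axis i 1) ` UNIV" by (auto simp: Basis_vec_def)
  have I: "inj (\<lambda>i::'n. axis i (1::real))" by (auto simp: inj_on_def axis_eq_axis)
  show ?thesis unfolding B by (rule sum.reindex[OF I, unfolded o_def])
qed

lemma inner_vec_sum: "(\<chi> i. a i) \<bullet> (h::real^'n) = (\<Sum>i\<in>UNIV. h $ i * a i)"
  by (simp add: inner_vec_def mult.commute)

lemma weighted_C_partial: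
  assumes "weighted_C w k Q S u" "set (b # bs) \<subseteq> Basis" "sum_list (map w (b # bs)) \<le> k" "x \<in> Q"
  shows "((\<lambda>s. iter_deriv bs u (x + s *\<^sub>R b)) has_real_derivative iter_deriv (b # bs) u x) (at 0)"
proof -
  have "(\<lambda>s::real. iter_deriv bs u (x + s *\<^sub>R b)) differentiable (at 0)"
    using assms unfolding weighted_C_def by blast
  then have "((\<lambda>s. iter_deriv bs u (x + s *\<^sub>R b)) has_real_derivative deriv (\<lambda>s. iter_deriv bs u (x + s *\<^sub>R b)) 0) (at 0)"
    using DERIV_deriv_iff_real_differentiable by blast
  then show ?thesis by (simp add: iter_deriv_def dir_deriv_def)
qed

lemma weighted_C_continuous:
  assumes "weighted_C w k Q S u" "set bs \<subseteq> Basis" "sum_list (map w bs) \<le> k" "Q \<subseteq> S"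
  shows "continuous_on Q (iter_deriv bs u)"
proof -
  obtain g where "continuous_on S g" "\<forall>x\<in>Q. g x = iter_deriv bs u x"
    using assms unfolding weighted_C_def by meson
  then show ?thesis using assms(4) by (metis continuous_on_cong continuous_on_subset)
qed

lemma C_class_has_derivative:
  assumes "C_class k Q S u" "open Q" "Q \<subseteq> S" "set bs \<subseteq> Basis" "length bs < k" "x \<in> Q"
  shows "(iter_deriv bs u has_derivative (\<lambda>h. \<Sum>b\<in>Basis. (h \<bullet> b) * iter_deriv (b # bs) u x)) (at x)"
proof (rule has_derivative_of_continuous_partials[OF assms(2,6)])
  have s: "sum_list (map (\<lambda>_. 1) xs) = length xs" for xs :: "'a list" by (induction xs) auto
  have w: "weighted_C (\<lambda>_. 1) k Q S u" using assms(1) by (simp add: C_class_def)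
  fix b y :: 'a
  show "((\<lambda>s. iter_deriv bs u (y + s *\<^sub>R b)) has_real_derivative iter_deriv (b # bs) u y) (at 0)"
    if "b \<in> Basis" "y \<in> Q"
    by (rule weighted_C_partial[OF w]) (use that assms s in auto)
  show "continuous_on Q (iter_deriv (b # bs) u)" if "b \<in> Basis"
    by (rule weighted_C_continuous[OF w _ _ assms(3)]) (use that assms s in auto)
qed

lemma C_class_gradient:
  fixes u :: "real ^ 'n \<Rightarrow> real"
  assumes "C_class k Q S u" "open Q" "Q \<subseteq> S" "0 < k" "x \<in> Q"
  shows "(u has_derivative (\<lambda>h. grad u x \<bullet> h)) (at x)"
  using C_class_has_derivative[OF assms(1-3), of "[]" x] assms
  by (simp add: iter_deriv_def grad_def sum_axis_Basis inner_axis inner_vec_sum)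

lemma C_class_continuous:
  assumes "C_class k Q S u" "Q \<subseteq> S" "set bs \<subseteq> Basis" "length bs \<le> k"
  shows "continuous_on Q (iter_deriv bs u)"
proof -
  have s: "sum_list (map (\<lambda>_. 1) xs) = length xs" for xs :: "'a list" by (induction xs) auto
  show ?thesis
    by (rule weighted_C_continuous[OF assms(1)[unfolded C_class_def] assms(3) _ assms(2)])
      (simp only: s assms(4))
qed

lemma C_class_mono: "C_class k Q S u \<Longrightarrow> j \<le> k \<Longrightarrow> C_class j Q S u"
  unfolding C_class_def weighted_C_def by (meson order_trans)

lemma C_class_grad_continuous:
  fixes u :: "real ^ 'n \<Rightarrow> real"
  assumes "C_class k Q S u" "Q \<subseteq> S" "0 < k"
  shows "continuous_on Q (grad u)"
proof -
  have "continuous_on Q (\<lambda>x. dir_deriv (axis i 1) u x)" for i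
    using C_class_continuous[OF assms(1,2), of "[axis i 1]"] assms(3)
    by (simp add: iter_deriv_def)
  then show ?thesis unfolding grad_def by (intro continuous_intros)
qed

text \<open>
  The mean value inequality for \<open>f - F0\<close>, with derivatives required only on the open segment, so that the
  end points may lie on the boundary of the domain.
\<close>

lemma segment_increment_bound:
  fixes f :: "'a::real_normed_vector \<Rightarrow> 'b::real_inner"
  assumes cont: "continuous_on (closed_segment a b) f"
    and der: "\<And>z. z \<in> open_segment a b \<Longrightarrow> (f has_derivative F z) (at z)"
    and bd: "\<And>z h. z \<in> open_segment a b \<Longrightarrow> norm (F z h - F0 h) \<le> \<epsilon> * norm h"
    and F0: "bounded_linear F0"
  shows "norm (f b - f a - F0 (b - a)) \<le> \<epsilon> * norm (b - a)"
proof (cases "a = b")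
  case True
  then show ?thesis using F0 by (simp add: linear_simps)
next
  case False
  define k where "k s = f (a + s *\<^sub>R (b - a)) - s *\<^sub>R F0 (b - a)" for s :: real
  have seg: "a + s *\<^sub>R (b - a) = (1 - s) *\<^sub>R a + s *\<^sub>R b" for s by (simp add: algebra_simps)
  have "\<exists>x\<in>{0<..<1}. norm (k 1 - k 0) \<le> norm ((\<lambda>r. F (a + x *\<^sub>R (b - a)) (r *\<^sub>R (b - a)) - r *\<^sub>R F0 (b - a)) (1 - 0))"
  proof (rule mvt_general)
    have "continuous_on {0..1} (\<lambda>s. f (a + s *\<^sub>R (b - a)))"
      by (rule continuous_on_compose2[OF cont])
        (auto intro!: continuous_intros simp: seg closed_segment_def)
    then show "continuous_on {0..1} k" unfolding k_def by (intro continuous_intros)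
    fix s :: real assume s: "0 < s" "s < 1"
    have "a + s *\<^sub>R (b - a) \<in> open_segment a b" using s False unfolding in_segment seg by auto
    then have d: "(f has_derivative F (a + s *\<^sub>R (b - a))) (at (a + s *\<^sub>R (b - a)))" by (rule der)
    have "((\<lambda>s. f (a + s *\<^sub>R (b - a))) has_derivative (\<lambda>r. F (a + s *\<^sub>R (b - a)) (r *\<^sub>R (b - a)))) (at s)"
      by (rule has_derivative_compose[of "\<lambda>s. a + s *\<^sub>R (b - a)", OF _ d])
        (auto intro!: derivative_eq_intros)
    then show "(k has_derivative (\<lambda>r. F (a + s *\<^sub>R (b - a)) (r *\<^sub>R (b - a)) - r *\<^sub>R F0 (b - a))) (at s)"
      unfolding k_def by (auto intro!: derivative_eq_intros)
  qed simp
  then obtain s where s: "0 < s" "s < 1" "norm (k 1 - k 0) \<le> norm (F (a + s *\<^sub>R (b - a)) (b - a) - F0 (b - a))"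
    by auto
  have "a + s *\<^sub>R (b - a) \<in> open_segment a b" using s False unfolding in_segment seg by auto
  from bd[OF this, of "b - a"] s(3) show ?thesis by (simp add: k_def algebra_simps)
qed

lemma graph_chart_mono: "graph_chart k \<Omega> x r e \<gamma> \<Longrightarrow> j \<le> k \<Longrightarrow> graph_chart j \<Omega> x r e \<gamma>"
  unfolding graph_chart_def using C_class_mono by blast

text \<open>
  A chart serves all boundary points in its ball, in particular for computing their normals.
\<close>

lemma graph_chart_recenter:
  assumes "graph_chart k \<Omega> x r e \<gamma>" "y \<in> ball x r"
  shows "graph_chart k \<Omega> y (r - dist x y) e \<gamma>"
proof -
  have sub: "ball y (r - dist x y) \<subseteq> ball x r"
    by (auto, smt (verit) dist_triangle)
  then have "\<Omega> \<inter> ball y (r - dist x y) = (\<Omega> \<inter> ball x r) \<inter> ball y (r - dist x y)"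
    "{z \<in> ball y (r - dist x y). \<gamma> z < z \<bullet> e} = {z \<in> ball x r. \<gamma> z < z \<bullet> e} \<inter> ball y (r - dist x y)"
    by blast+
  then show ?thesis using assms unfolding graph_chart_def by simp
qed

text \<open>
  The defining condition of a chart only describes \<open>\<Omega>\<close>; the lemmas below read off the closure, the
  frontier and the tangent directions in the chart.
\<close>

locale chart =
  fixes \<Omega> :: "(real ^ 'n) set" and x r e \<gamma>
  assumes open_domain: "open \<Omega>" and graph: "graph_chart 1 \<Omega> x r e \<gamma>"
begin

lemma r_pos: "r > 0" and norm_e: "norm e = 1" and smooth: "C_class 1 UNIV UNIV \<gamma>"
  and invariant: "\<gamma> (y + s *\<^sub>R e) = \<gamma> y"
  and mem_iff: "y \<in> ball x r \<Longrightarrow> y \<in> \<Omega> \<longleftrightarrow> \<gamma> y < y \<bullet> e"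
  using graph unfolding graph_chart_def by auto

lemma e_e: "e \<bullet> e = 1" using norm_e by (simp add: dot_square_norm)

lemma has_gradient: "(\<gamma> has_derivative (\<lambda>h. grad \<gamma> y \<bullet> h)) (at y)"
  using C_class_gradient[OF smooth] by auto

lemma continuous: "continuous_on A \<gamma>"
  using has_gradient by (meson continuous_at_imp_continuous_on has_derivative_continuous)

lemma continuous_grad: "continuous_on A (grad \<gamma>)"
  by (rule continuous_on_subset[OF C_class_grad_continuous[OF smooth]]) auto

lemma grad_vertical: "grad \<gamma> y \<bullet> e = 0"
proof -
  have "((\<lambda>s. \<gamma> (y + s *\<^sub>R e)) has_derivative (\<lambda>s. grad \<gamma> y \<bullet> (s *\<^sub>R e))) (at 0)"
    by (rule has_derivative_compose[of "\<lambda>s. y + s *\<^sub>R e"])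
      (auto intro!: derivative_eq_intros has_gradient)
  then have "((\<lambda>s. \<gamma> y) has_derivative (\<lambda>s. grad \<gamma> y \<bullet> (s *\<^sub>R e))) (at (0::real))"
    by (simp add: invariant)
  moreover have "((\<lambda>s. \<gamma> y) has_derivative (\<lambda>s. 0)) (at (0::real))" by simp
  ultimately have "(\<lambda>s. grad \<gamma> y \<bullet> (s *\<^sub>R e)) = (\<lambda>s. 0)" by (rule has_derivative_unique)
  from fun_cong[OF this, of 1] show ?thesis by simp
qed

lemma closure_le: "y \<in> closure \<Omega> \<Longrightarrow> y \<in> ball x r \<Longrightarrow> \<gamma> y \<le> y \<bullet> e"
proof (rule ccontr)
  assume y: "y \<in> closure \<Omega>" "y \<in> ball x r" "\<not> \<gamma> y \<le> y \<bullet> e"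
  define A where "A = ball x r \<inter> {z. z \<bullet> e < \<gamma> z}"
  have "open A" unfolding A_def
    by (intro open_Int open_Collect_less continuous_intros continuous) auto
  moreover have "A \<inter> \<Omega> = {}" unfolding A_def using mem_iff by force
  ultimately have "A \<inter> closure \<Omega> = {}" using open_Int_closure_eq_empty by blast
  then show False using y unfolding A_def by auto
qed

lemma frontier_eq: "y \<in> frontier \<Omega> \<Longrightarrow> y \<in> ball x r \<Longrightarrow> \<gamma> y = y \<bullet> e"
  using closure_le[of y] mem_iff[of y] open_domain by (auto simp: frontier_def interior_open)

lemma above_mem:
  assumes "y \<in> closure \<Omega>" "y \<in> ball x r" "s > 0" "y + s *\<^sub>R e \<in> ball x r"
  shows "y + s *\<^sub>R e \<in> \<Omega>"
  using closure_le[OF assms(1,2)] mem_iff[OF assms(4)] assms(3)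
  by (simp add: invariant inner_add_left e_e)

lemma frontierI:
  assumes "y \<in> ball x r" "\<gamma> y = y \<bullet> e" shows "y \<in> frontier \<Omega>"
proof -
  have "y \<in> closure \<Omega>"
  proof (rule ccontr)
    assume "y \<notin> closure \<Omega>"
    then have "open (ball x r - closure \<Omega>)" "y \<in> ball x r - closure \<Omega>" using assms by auto
    then obtain \<delta> where d: "\<delta> > 0" "ball y \<delta> \<subseteq> ball x r - closure \<Omega>"
      by (meson openE)
    have m: "y + (\<delta>/2) *\<^sub>R e \<in> ball y \<delta>" using d norm_e by (simp add: dist_norm)
    then have "y + (\<delta>/2) *\<^sub>R e \<in> ball x r" using d by blast
    then have "y + (\<delta>/2) *\<^sub>R e \<in> \<Omega>"
      using mem_iff assms d by (simp add: invariant inner_add_left e_e)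
    then show False using m d closure_subset by blast
  qed
  then show ?thesis using assms mem_iff open_domain by (simp add: frontier_def interior_open)
qed

lemma level_derivative:
  "((\<lambda>s. \<gamma> (y + s *\<^sub>R v) - (y + s *\<^sub>R v) \<bullet> e) has_real_derivative (grad \<gamma> y - e) \<bullet> v) (at 0)"
proof -
  have "((\<lambda>s. \<gamma> (y + s *\<^sub>R v)) has_derivative (\<lambda>s. grad \<gamma> y \<bullet> (s *\<^sub>R v))) (at 0)"
    by (rule has_derivative_compose[of "\<lambda>s. y + s *\<^sub>R v"])
      (auto intro!: derivative_eq_intros has_gradient)
  then have "((\<lambda>s. \<gamma> (y + s *\<^sub>R v)) has_real_derivative grad \<gamma> y \<bullet> v) (at 0)"
    by (simp add: has_field_derivative_def mult.commute[of _ "grad \<gamma> y \<bullet> v"])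
  moreover have "((\<lambda>s. (y + s *\<^sub>R v) \<bullet> e) has_real_derivative v \<bullet> e) (at 0)"
    unfolding inner_add_left inner_scaleR_left by (auto intro!: derivative_eq_intros)
  ultimately show ?thesis unfolding inner_diff_left inner_commute[of e v] by (rule DERIV_diff)
qed

lemma near_center: "\<exists>\<delta>>0. \<forall>s. \<bar>s\<bar> < \<delta> \<longrightarrow> x + s *\<^sub>R v \<in> ball x r"
proof -
  have "\<bar>s\<bar> * norm v < r" if "\<bar>s\<bar> < r / (norm v + 1)" for s
  proof -
    have p: "norm v + 1 > 0" by (simp add: add_nonneg_pos)
    then have "\<bar>s\<bar> * (norm v + 1) < r" using that by (simp add: field_simps)
    then show ?thesis by (simp add: algebra_simps)
  qed
  then show ?thesis using r_pos
    by (intro exI[of _ "r / (norm v + 1)"]) (auto simp: dist_norm add_nonneg_pos)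
qed

lemma inward_mem:
  assumes "x \<in> frontier \<Omega>" "(grad \<gamma> x - e) \<bullet> v < 0"
  shows "\<exists>\<delta>>0. \<forall>s. 0 < s \<and> s < \<delta> \<longrightarrow> x + s *\<^sub>R v \<in> \<Omega>"
proof -
  obtain d where d: "d > 0" "\<And>h. h > 0 \<Longrightarrow> h < d \<Longrightarrow> \<gamma> (x + h *\<^sub>R v) - (x + h *\<^sub>R v) \<bullet> e < \<gamma> x - x \<bullet> e"
    using DERIV_neg_dec_right[OF level_derivative[of x v] assms(2)] by auto
  obtain d' where d': "d' > 0" "\<forall>s. \<bar>s\<bar> < d' \<longrightarrow> x + s *\<^sub>R v \<in> ball x r" using near_center by blast
  have "\<gamma> x = x \<bullet> e" using frontier_eq[OF assms(1)] r_pos by simp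
  then show ?thesis using d d' mem_iff by (intro exI[of _ "min d d'"]) auto
qed

lemma outward_not_mem:
  assumes "x \<in> frontier \<Omega>" "(grad \<gamma> x - e) \<bullet> v > 0"
  shows "\<exists>\<delta>>0. \<forall>s. 0 < s \<and> s < \<delta> \<longrightarrow> x + s *\<^sub>R v \<notin> \<Omega>"
proof -
  obtain d where d: "d > 0" "\<And>h. h > 0 \<Longrightarrow> h < d \<Longrightarrow> \<gamma> (x + h *\<^sub>R v) - (x + h *\<^sub>R v) \<bullet> e > \<gamma> x - x \<bullet> e"
    using DERIV_pos_inc_right[OF level_derivative[of x v] assms(2)] by auto
  obtain d' where d': "d' > 0" "\<forall>s. \<bar>s\<bar> < d' \<longrightarrow> x + s *\<^sub>R v \<in> ball x r" using near_center by blast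
  have "\<gamma> x = x \<bullet> e" using frontier_eq[OF assms(1)] r_pos by simp
  then show ?thesis using d d' mem_iff by (intro exI[of _ "min d d'"]) force
qed

text \<open>
  The curve lifts the straight line in direction \<open>\<tau>\<close> vertically onto the graph. As \<open>\<gamma>\<close> is invariant in
  the direction \<open>e\<close>, the lift does not change its value, and the vertical correction is of second order
  because \<open>\<tau>\<close> is tangential.
\<close>

lemma boundary_curve:
  assumes "x \<in> frontier \<Omega>" "(grad \<gamma> x - e) \<bullet> \<tau> = 0"
  shows "\<exists>\<delta>>0. \<exists>y. y 0 = x \<and> (\<forall>s. \<bar>s\<bar> < \<delta> \<longrightarrow> y s \<in> frontier \<Omega>) \<and> (y has_vector_derivative \<tau>) (at 0)"
proof -
  define y where "y s = x + s *\<^sub>R \<tau> + (\<gamma> (x + s *\<^sub>R \<tau>) - (x + s *\<^sub>R \<tau>) \<bullet> e) *\<^sub>R e" for s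
  have y0: "y 0 = x" using frontier_eq[OF assms(1)] r_pos by (simp add: y_def)
  have "(y has_vector_derivative \<tau>) (at 0)"
  proof -
    define k where "k s = \<gamma> (x + s *\<^sub>R \<tau>) - (x + s *\<^sub>R \<tau>) \<bullet> e" for s
    have "(k has_real_derivative 0) (at 0)"
      using level_derivative[of x \<tau>] unfolding k_def assms(2) .
    then have "((\<lambda>s. x + s *\<^sub>R \<tau> + k s *\<^sub>R e) has_vector_derivative \<tau>) (at 0)"
      by (auto intro!: derivative_eq_intros)
    then show ?thesis unfolding y_def k_def .
  qed
  moreover from this have "isCont y 0"
    using has_vector_derivative_continuous by blast
  then have "\<forall>\<^sub>F s in at 0. y s \<in> ball x r"
    using r_pos y0 unfolding isCont_def by (auto dest!: tendstoD simp: dist_commute)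
  then obtain \<delta> where d: "\<delta> > 0" "\<And>s. s \<noteq> 0 \<Longrightarrow> \<bar>s\<bar> < \<delta> \<Longrightarrow> y s \<in> ball x r"
    unfolding eventually_at by (auto simp: dist_real_def)
  have "y s \<in> frontier \<Omega>" if "\<bar>s\<bar> < \<delta>" for s
  proof (cases "s = 0")
    case True then show ?thesis using y0 assms by simp
  next
    case False
    have "\<gamma> (y s) = \<gamma> (x + s *\<^sub>R \<tau>)" unfolding y_def by (rule invariant)
    also have "\<dots> = y s \<bullet> e" by (simp add: y_def inner_add_left e_e)
    finally show ?thesis using d(2)[OF False that] frontierI by blast
  qed
  ultimately show ?thesis using d y0 by blast
qed

text \<open>
  A domain above a Lipschitz graph is quasiconvex: \<open>x\<close> and \<open>y\<close> are joined by a path of length comparable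
  with \<open>|y - x|\<close> that goes up from \<open>x\<close> by \<open>s = K |y - x|\<close>, then moves parallel to \<open>y - x\<close>, and then goes
  down to \<open>y\<close>. If \<open>K\<close> exceeds the Lipschitz constant of \<open>\<gamma>\<close> sufficiently, the path is inside \<open>\<Omega>\<close> except
  for its end points, and the mean value inequality applies to its three pieces.
\<close>

lemma derivative_up_to_boundary:
  fixes f :: "real ^ 'n \<Rightarrow> 'b::real_inner"
  assumes x: "x \<in> frontier \<Omega>"
    and cont: "continuous_on (closure \<Omega>) f"
    and der: "\<And>y. y \<in> \<Omega> \<Longrightarrow> (f has_derivative F y) (at y)"
    and F0: "bounded_linear F0"
    and lim: "\<And>\<epsilon>. \<epsilon> > 0 \<Longrightarrow> \<exists>\<delta>>0. \<forall>y\<in>\<Omega> \<inter> ball x \<delta>. \<forall>h. norm (F y h - F0 h) \<le> \<epsilon> * norm h"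
  shows "(f has_derivative F0) (at x within closure \<Omega>)"
  unfolding has_derivative_within_alt
proof (intro conjI F0 allI impI)
  fix \<epsilon> :: real assume "\<epsilon> > 0"
  define G where "G = grad \<gamma> x"
  obtain r1 where r1: "r1 > 0" "\<And>z. dist z x < r1 \<Longrightarrow> dist (grad \<gamma> z) G < 1"
    using continuous_grad[of UNIV] unfolding G_def continuous_on_eq_continuous_at[OF open_UNIV] continuous_at_eps_delta
    by (meson UNIV_I zero_less_one)
  \<comment> \<open>\<open>norm G + 1\<close> is a Lipschitz constant of \<open>\<gamma>\<close> near \<open>x\<close>; one more unit compensates the change of \<open>y \<bullet> e\<close>, and
    the last one keeps the middle segment strictly inside. The path has length \<open>m * norm (y - x)\<close>.\<close>
  define K where "K = norm G + 3"
  define m where "m = 2 * K + 1"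
  have K: "K \<ge> 3" by (simp add: K_def)
  have m: "m > 0" using K by (simp add: m_def)
  then have em: "\<epsilon> / m > 0" using \<open>\<epsilon> > 0\<close> by simp
  then obtain r2 where r2: "r2 > 0" "\<And>y h. y \<in> \<Omega> \<inter> ball x r2 \<Longrightarrow> norm (F y h - F0 h) \<le> \<epsilon> / m * norm h"
    using lim[of "\<epsilon> / m"] by blast
  define \<rho> where "\<rho> = min r (min r1 r2)"
  have rho: "\<rho> > 0" using r_pos r1 r2 by (simp add: \<rho>_def)
  have lip: "\<gamma> z - \<gamma> x \<le> (norm G + 1) * norm (z - x)" if "z \<in> ball x \<rho>" for z
  proof -
    have "norm (\<gamma> z - \<gamma> x - G \<bullet> (z - x)) \<le> 1 * norm (z - x)"
    proof (rule segment_increment_bound[where F="\<lambda>z h. grad \<gamma> z \<bullet> h"])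
      fix y h :: "real ^ 'n" assume "y \<in> open_segment x z"
      then have "dist y x < dist z x" using dist_in_open_segment[of y x z] by (auto simp: dist_commute)
      then have "dist (grad \<gamma> y) G < 1" using r1 that by (auto simp: \<rho>_def dist_commute)
      then have "norm (grad \<gamma> y - G) * norm h \<le> 1 * norm h"
        by (intro mult_right_mono) (auto simp: dist_norm)
      then show "norm (grad \<gamma> y \<bullet> h - G \<bullet> h) \<le> 1 * norm h"
        unfolding inner_diff_left[symmetric] using Cauchy_Schwarz_ineq2[of "grad \<gamma> y - G" h] by simp
    qed (auto intro: continuous has_gradient bounded_linear_inner_right)
    moreover have "G \<bullet> (z - x) \<le> norm G * norm (z - x)" by (rule norm_cauchy_schwarz)
    ultimately show ?thesis by (simp add: algebra_simps)
  qed
  have xc: "x \<in> closure \<Omega>" using x by (simp add: frontier_def)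
  have "norm (f y - f x - F0 (y - x)) \<le> \<epsilon> * norm (y - x)"
    if y: "y \<in> closure \<Omega>" "norm (y - x) < \<rho> / (K + 1)" for y
  proof (cases "y = x")
    case True then show ?thesis using F0 by (simp add: linear_simps)
  next
    case False
    define d where "d = norm (y - x)"
    have d: "d > 0" "(K + 1) * d < \<rho>" using False y K by (auto simp: d_def field_simps)
    define s where "s = K * d"
    have s: "s > 0" using d K by (simp add: s_def)
    define a where "a = x + s *\<^sub>R e"
    define b where "b = y + s *\<^sub>R e"
    have ball: "x + k *\<^sub>R (y - x) + t *\<^sub>R e \<in> ball x \<rho>" if "0 \<le> k" "k \<le> 1" "0 \<le> t" "t \<le> s" for k t
    proof -
      have "norm (k *\<^sub>R (y - x) + t *\<^sub>R e) \<le> k * d + t"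
        using norm_triangle_ineq[of "k *\<^sub>R (y - x)" "t *\<^sub>R e"] that norm_e by (simp add: d_def)
      also have "\<dots> \<le> 1 * d + K * d" using that d by (intro add_mono mult_right_mono) (auto simp: s_def)
      also have "\<dots> < \<rho>" using d by (simp add: algebra_simps)
      finally show ?thesis
        by (metis add.assoc add_diff_cancel_left' dist_commute dist_norm mem_ball)
    qed
    have sub: "ball x \<rho> \<subseteq> ball x r" "ball x \<rho> \<subseteq> ball x r2" by (auto simp: \<rho>_def)
    have up1: "x + t *\<^sub>R e \<in> \<Omega> \<inter> ball x \<rho>" if "0 < t" "t \<le> s" for t
      using above_mem[OF xc _ that(1)] ball[of 0 t] sub that r_pos by auto
    have up2: "y + t *\<^sub>R e \<in> \<Omega> \<inter> ball x \<rho>" if "0 < t" "t \<le> s" for t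
    proof -
      have "y \<in> ball x \<rho>" "y + t *\<^sub>R e \<in> ball x \<rho>" using ball[of 1 0] ball[of 1 t] that s by simp_all
      then show ?thesis using above_mem[OF y(1) _ that(1)] sub by blast
    qed
    have mid: "x + k *\<^sub>R (y - x) + s *\<^sub>R e \<in> \<Omega> \<inter> ball x \<rho>" if k: "0 \<le> k" "k \<le> 1" for k
    proof -
      let ?z = "x + k *\<^sub>R (y - x)"
      have zb: "?z \<in> ball x \<rho>" using ball[of k 0] that s by simp
      have "norm (?z - x) \<le> d" using k d mult_right_mono[of k 1 d] by (simp add: d_def)
      then have "(norm G + 1) * norm (?z - x) \<le> (norm G + 1) * d" by (intro mult_left_mono) auto
      then have "\<gamma> ?z \<le> \<gamma> x + (norm G + 1) * d" using lip[OF zb] by linarith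
      moreover have "\<gamma> x = x \<bullet> e" using frontier_eq[OF x] r_pos by simp
      moreover have "\<bar>(y - x) \<bullet> e\<bar> \<le> d"
        using Cauchy_Schwarz_ineq2[of "y - x" e] norm_e by (simp add: d_def)
      then have "\<bar>k * ((y - x) \<bullet> e)\<bar> \<le> 1 * d" using k d
        unfolding abs_mult by (intro mult_mono) auto
      then have "?z \<bullet> e \<ge> x \<bullet> e - d" by (simp add: inner_add_left abs_le_iff)
      moreover have "s = (norm G + 1) * d + 2 * d" by (simp add: s_def K_def algebra_simps)
      ultimately have "\<gamma> (?z + s *\<^sub>R e) < (?z + s *\<^sub>R e) \<bullet> e"
        using d unfolding invariant inner_add_left[of ?z] inner_scaleR_left[of s] e_e by linarith
      then show ?thesis using mem_iff ball[OF k, of s] s sub by auto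
    qed
    have step: "norm (f q - f p - F0 (q - p)) \<le> \<epsilon> / m * norm (q - p)"
      if "open_segment p q \<subseteq> \<Omega> \<inter> ball x \<rho>" "p \<in> closure \<Omega>" "q \<in> closure \<Omega>" for p q
    proof (rule segment_increment_bound)
      have "closed_segment p q \<subseteq> closure \<Omega>"
        using that closure_subset unfolding closed_segment_eq_open by blast
      then show "continuous_on (closed_segment p q) f" using cont continuous_on_subset by blast
      show "(f has_derivative F z) (at z)" if "z \<in> open_segment p q" for z
        using that \<open>open_segment p q \<subseteq> _\<close> der by blast
      show "norm (F z h - F0 h) \<le> \<epsilon> / m * norm h" if "z \<in> open_segment p q" for z h
        using that \<open>open_segment p q \<subseteq> _\<close> sub r2(2) by blast
    qed (rule F0)
    have ac: "a \<in> closure \<Omega>" "b \<in> closure \<Omega>"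
      using up1[of s] up2[of s] s closure_subset by (auto simp: a_def b_def)
    have "open_segment x a \<subseteq> \<Omega> \<inter> ball x \<rho>"
    proof
      fix z assume "z \<in> open_segment x a"
      then obtain k where k: "0 < k" "k < 1" "z = (1 - k) *\<^sub>R x + k *\<^sub>R a" unfolding in_segment by auto
      then have "z = x + (k * s) *\<^sub>R e" by (simp add: a_def algebra_simps)
      then show "z \<in> \<Omega> \<inter> ball x \<rho>" using up1[of "k * s"] k s by simp
    qed
    then have 1: "norm (f a - f x - F0 (a - x)) \<le> \<epsilon> / m * s"
      using step[OF _ xc ac(1)] s norm_e by (simp add: a_def)
    have "open_segment a b \<subseteq> \<Omega> \<inter> ball x \<rho>"
    proof
      fix z assume "z \<in> open_segment a b"
      then obtain k where k: "0 < k" "k < 1" "z = (1 - k) *\<^sub>R a + k *\<^sub>R b" unfolding in_segment by auto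
      then have "z = x + k *\<^sub>R (y - x) + s *\<^sub>R e" by (simp add: a_def b_def algebra_simps)
      then show "z \<in> \<Omega> \<inter> ball x \<rho>" using mid[of k] k by simp
    qed
    then have 2: "norm (f b - f a - F0 (b - a)) \<le> \<epsilon> / m * d"
      using step[OF _ ac] by (simp add: a_def b_def d_def)
    have "open_segment b y \<subseteq> \<Omega> \<inter> ball x \<rho>"
    proof
      fix z assume "z \<in> open_segment b y"
      then obtain k where k: "0 < k" "k < 1" "z = (1 - k) *\<^sub>R b + k *\<^sub>R y" unfolding in_segment by auto
      then have "z = y + ((1 - k) * s) *\<^sub>R e" by (simp add: b_def algebra_simps)
      then show "z \<in> \<Omega> \<inter> ball x \<rho>" using up2[of "(1 - k) * s"] k s by simp
    qed
    then have 3: "norm (f y - f b - F0 (y - b)) \<le> \<epsilon> / m * s"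
      using step[OF _ ac(2) y(1)] s norm_e by (simp add: b_def)
    have "f y - f x - F0 (y - x) = (f a - f x - F0 (a - x)) + ((f b - f a - F0 (b - a)) + (f y - f b - F0 (y - b)))"
      using F0 by (simp add: linear_simps)
    then have "norm (f y - f x - F0 (y - x)) \<le> \<epsilon> / m * s + (\<epsilon> / m * d + \<epsilon> / m * s)"
      using 1 2 3 by (metis (no_types, lifting) add_mono norm_triangle_le)
    also have "\<dots> = \<epsilon> / m * (s + (d + s))" by (simp only: distrib_left)
    also have "s + (d + s) = m * d" by (simp add: s_def m_def algebra_simps)
    also have "\<epsilon> / m * (m * d) = \<epsilon> * d" using m by simp
    finally show ?thesis by (simp add: d_def)
  qed
  then show "\<exists>d>0. \<forall>y\<in>closure \<Omega>. norm (y - x) < d \<longrightarrow> norm (f y - f x - F0 (y - x)) \<le> \<epsilon> * norm (y - x)"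
    using rho K by (intro exI[of _ "\<rho> / (K + 1)"]) auto
qed

end

text \<open>
  If the half-space \<open>{v. a \<bullet> v < 0}\<close> lies in \<open>{v. b \<bullet> v \<le> 0}\<close>, then the component \<open>c\<close> of \<open>b\<close> orthogonal
  to \<open>a\<close> vanishes, since \<open>c - k a\<close> with small \<open>k > 0\<close> is in the first half-space.
\<close>

lemma sgn_eq_of_half_spaces:
  fixes a b :: "'a::real_inner"
  assumes "a \<noteq> 0" "b \<noteq> 0" "\<And>v. a \<bullet> v < 0 \<Longrightarrow> b \<bullet> v \<le> 0"
  shows "sgn a = sgn b"
proof -
  define \<beta> where "\<beta> = (b \<bullet> a) / (a \<bullet> a)"
  define c where "c = b - \<beta> *\<^sub>R a"
  have aa: "a \<bullet> a > 0" using assms by simp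
  have ca: "a \<bullet> c = 0" "c \<bullet> a = 0" using aa by (auto simp: c_def \<beta>_def inner_diff_right inner_diff_left inner_commute)
  have b: "b = \<beta> *\<^sub>R a + c" by (simp add: c_def)
  have "c \<bullet> c \<le> t" if t: "t > 0" for t
  proof -
    define k where "k = t / (\<bar>\<beta>\<bar> * (a \<bullet> a) + 1)"
    have p: "\<bar>\<beta>\<bar> * (a \<bullet> a) + 1 > 0" using aa by (simp add: add_nonneg_pos)
    have k: "k > 0" using p t by (simp add: k_def)
    have "a \<bullet> (c - k *\<^sub>R a) < 0" using ca aa k by (simp add: inner_diff_right)
    from assms(3)[OF this] have "c \<bullet> c \<le> k * (\<beta> * (a \<bullet> a))"
      unfolding b by (simp add: inner_diff_right inner_add_left ca algebra_simps)
    also have "\<dots> \<le> k * (\<bar>\<beta>\<bar> * (a \<bullet> a) + 1)"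
      using k aa by (intro mult_left_mono) (auto intro: order_trans[OF mult_right_mono[OF abs_ge_self]])
    also have "\<dots> = t" using p by (simp add: k_def)
    finally show ?thesis .
  qed
  then have "c \<bullet> c \<le> 0" by (meson dense not_le order.strict_trans2)
  then have c0: "c = 0" by (metis inner_gt_zero_iff not_le)
  then have "b = \<beta> *\<^sub>R a" using b by simp
  moreover have "\<beta> \<ge> 0"
    using assms(3)[of "- a"] aa b c0 by (simp add: zero_le_mult_iff)
  moreover have "\<beta> \<noteq> 0" using assms(2) b c0 by auto
  ultimately show ?thesis by (simp add: sgn_scaleR)
qed

text \<open>
  The normal depends only on \<open>\<Omega>\<close>: in each chart, the directions that enter \<open>\<Omega>\<close> form, up to the tangent
  directions, the half-space on which the gradient of the defining function is negative.
\<close>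

lemma normal_unique:
  assumes "open \<Omega>" "graph_chart 1 \<Omega> x r e \<gamma>" "graph_chart 1 \<Omega> x r' e' \<gamma>'" "x \<in> frontier \<Omega>"
  shows "sgn (grad \<gamma> x - e) = sgn (grad \<gamma>' x - e')"
proof -
  interpret A: chart \<Omega> x r e \<gamma> using assms by unfold_locales
  interpret B: chart \<Omega> x r' e' \<gamma>' using assms by unfold_locales
  show ?thesis
  proof (rule sgn_eq_of_half_spaces)
    show "grad \<gamma> x - e \<noteq> 0" using A.grad_vertical[of x] A.e_e by auto
    show "grad \<gamma>' x - e' \<noteq> 0" using B.grad_vertical[of x] B.e_e by auto
    fix v assume "(grad \<gamma> x - e) \<bullet> v < 0"
    then obtain d where d: "d > 0" "\<And>s. 0 < s \<Longrightarrow> s < d \<Longrightarrow> x + s *\<^sub>R v \<in> \<Omega>"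
      using A.inward_mem[OF assms(4)] by blast
    show "(grad \<gamma>' x - e') \<bullet> v \<le> 0"
    proof (rule ccontr)
      assume "\<not> ?thesis"
      then obtain d' where d': "d' > 0" "\<And>s. 0 < s \<Longrightarrow> s < d' \<Longrightarrow> x + s *\<^sub>R v \<notin> \<Omega>"
        using B.outward_not_mem[OF assms(4), of v] by auto
      show False using d d' by (metis dense min_less_iff_conj)
    qed
  qed
qed

lemma outward_unit_normal_chart:
  assumes "open \<Omega>" "outward_unit_normal \<Omega> x \<nu>" "x \<in> frontier \<Omega>" "graph_chart k \<Omega> x r e \<gamma>" "1 \<le> k"
  shows "\<nu> = sgn (grad \<gamma> x - e)"
  using assms normal_unique[OF assms(1)] graph_chart_mono[OF assms(4,5)] unfolding outward_unit_normal_def by blast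

section \<open>Functions that are twice differentiable up to the boundary\<close>

text \<open>
  First derivatives are taken within the closure, since the boundary argument differentiates at boundary
  points; second derivatives live in the interior, where the second order conditions at a maximum are
  used. Derivatives are functions of the point and of the directions, which treats scalar and vector
  fields alike.
\<close>

definition C2_bounds ::
  "'a::euclidean_space set \<Rightarrow> ('a \<Rightarrow> 'b::real_normed_vector) \<Rightarrow> ('a \<Rightarrow> 'a \<Rightarrow> 'b) \<Rightarrow> ('a \<Rightarrow> 'a \<Rightarrow> 'a \<Rightarrow> 'b) \<Rightarrow> real \<Rightarrow> bool"
  where
  "C2_bounds \<Omega> f f' f'' B \<longleftrightarrow> 0 \<le> B \<and>
     (\<forall>x\<in>closure \<Omega>. (f has_derivative f' x) (at x within closure \<Omega>) \<and>
        norm (f x) \<le> B \<and> (\<forall>h. norm (f' x h) \<le> B * norm h)) \<and>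
     (\<forall>x\<in>\<Omega>. \<forall>h. ((\<lambda>y. f' y h) has_derivative f'' x h) (at x) \<and>
        (\<forall>k. norm (f'' x h k) \<le> B * norm h * norm k))"

text \<open>
  The first derivative stays explicit because its values on the boundary are prescribed for \<open>\<zeta>\<close> in
  \<open>boundary_functions\<close>.
\<close>

definition C2_upto :: "'a::euclidean_space set \<Rightarrow> ('a \<Rightarrow> 'b::real_normed_vector) \<Rightarrow> ('a \<Rightarrow> 'a \<Rightarrow> 'b) \<Rightarrow> bool" where
  "C2_upto \<Omega> f f' \<longleftrightarrow> (\<exists>f'' B. C2_bounds \<Omega> f f' f'' B)"

lemma C2_boundsD:
  assumes "C2_bounds \<Omega> f f' f'' B"
  shows "0 \<le> B"
    "\<And>x. x \<in> closure \<Omega> \<Longrightarrow> (f has_derivative f' x) (at x within closure \<Omega>)"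
    "\<And>x. x \<in> closure \<Omega> \<Longrightarrow> norm (f x) \<le> B"
    "\<And>x h. x \<in> closure \<Omega> \<Longrightarrow> norm (f' x h) \<le> B * norm h"
    "\<And>x h. x \<in> \<Omega> \<Longrightarrow> ((\<lambda>y. f' y h) has_derivative f'' x h) (at x)"
    "\<And>x h k. x \<in> \<Omega> \<Longrightarrow> norm (f'' x h k) \<le> B * norm h * norm k"
  using assms unfolding C2_bounds_def by blast+

lemma C2_bounds_mono:
  assumes "C2_bounds \<Omega> f f' f'' A" "A \<le> B"
  shows "C2_bounds \<Omega> f f' f'' B"
proof -
  have 1: "a \<le> B * norm h" if "a \<le> A * norm h" for a and h :: 'a
    using that mult_right_mono[OF assms(2), of "norm h"] by simp
  have 2: "a \<le> B * norm h * norm k" if "a \<le> A * norm h * norm k" for a and h k :: 'a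
    using that mult_right_mono[OF assms(2), of "norm h * norm k"] by (simp add: mult.assoc)
  note f = C2_boundsD[OF assms(1)]
  show ?thesis unfolding C2_bounds_def
    using f(1,2,5) order_trans[OF f(3) assms(2)] 1[OF f(4)] 2[OF f(6)] assms(2) by auto
qed

lemma C2_uptoI:
  assumes "\<And>x. x \<in> closure \<Omega> \<Longrightarrow> (f has_derivative f' x) (at x within closure \<Omega>)"
    and B: "\<And>x. x \<in> closure \<Omega> \<Longrightarrow> norm (f x) \<le> B"
    and B': "\<And>x h. x \<in> closure \<Omega> \<Longrightarrow> norm (f' x h) \<le> B' * norm h"
    and f'': "\<And>x h. x \<in> \<Omega> \<Longrightarrow> ((\<lambda>y. f' y h) has_derivative f'' x h) (at x)"
    and B'': "\<And>x h k. x \<in> \<Omega> \<Longrightarrow> norm (f'' x h k) \<le> B'' * norm h * norm k"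
  shows "C2_upto \<Omega> f f'"
proof -
  define A where "A = max 0 (max B (max B' B''))"
  have A: "0 \<le> A" "B \<le> A" "B' \<le> A" "B'' \<le> A" by (auto simp: A_def)
  have 1: "norm (f' x h) \<le> A * norm h" if "x \<in> closure \<Omega>" for x h
    using B'[OF that, of h] mult_right_mono[OF A(3), of "norm h"] by simp
  have 2: "norm (f'' x h k) \<le> A * norm h * norm k" if "x \<in> \<Omega>" for x h k
    using B''[OF that, of h k] mult_right_mono[OF A(4), of "norm h * norm k"] by (simp add: mult.assoc)
  have "C2_bounds \<Omega> f f' f'' A" unfolding C2_bounds_def
    using A(1) assms(1) order_trans[OF B A(2)] 1 f'' 2 by auto
  then show ?thesis unfolding C2_upto_def by blast
qed

lemma C2_upto_continuous: "C2_upto \<Omega> f f' \<Longrightarrow> continuous_on (closure \<Omega>) f"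
  unfolding C2_upto_def continuous_on_eq_continuous_within
  using C2_boundsD(2) has_derivative_continuous by blast

lemma at_within_closure_open: "open \<Omega> \<Longrightarrow> x \<in> \<Omega> \<Longrightarrow> at x within closure \<Omega> = at x"
  by (meson at_within_open_subset closure_subset)

lemma C2_upto_const: "C2_upto \<Omega> (\<lambda>x. c) (\<lambda>x h. 0)"
  by (rule C2_uptoI[where B="norm c" and B'=0 and B''=0 and f''="\<lambda>x h k. 0"]) auto

lemma C2_upto_ident_diff: "bounded \<Omega> \<Longrightarrow> C2_upto \<Omega> (\<lambda>x. x - a) (\<lambda>x h. h)"
proof -
  assume "bounded \<Omega>"
  then obtain B where B: "\<And>x. x \<in> closure \<Omega> \<Longrightarrow> norm x \<le> B"
    using bounded_closure[of \<Omega>] unfolding bounded_iff by blast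
  show ?thesis
    by (rule C2_uptoI[where B="B + norm a" and B'=1 and B''=0 and f''="\<lambda>x h k. 0"])
      (auto intro!: derivative_eq_intros order_trans[OF norm_triangle_ineq4] B)
qed

lemma C2_upto_add:
  assumes "C2_upto \<Omega> f f'" "C2_upto \<Omega> g g'"
  shows "C2_upto \<Omega> (\<lambda>x. f x + g x) (\<lambda>x h. f' x h + g' x h)"
proof -
  obtain B f'' where "C2_bounds \<Omega> f f' f'' B"
    using assms(1) unfolding C2_upto_def by blast
  note f = C2_boundsD[OF this]
  obtain A g'' where "C2_bounds \<Omega> g g' g'' A"
    using assms(2) unfolding C2_upto_def by blast
  note g = C2_boundsD[OF this]
  show ?thesis
  proof (rule C2_uptoI[where B="B + A" and B'="B + A" and B''="B + A" and f''="\<lambda>x h k. f'' x h k + g'' x h k"])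
    show "norm (f x + g x) \<le> B + A" if "x \<in> closure \<Omega>" for x
      by (intro norm_triangle_mono f g that)
    show "norm (f' x h + g' x h) \<le> (B + A) * norm h" if "x \<in> closure \<Omega>" for x h
      unfolding distrib_right by (intro norm_triangle_mono f g that)
    show "norm (f'' x h k + g'' x h k) \<le> (B + A) * norm h * norm k" if "x \<in> \<Omega>" for x h k
      unfolding distrib_right by (intro norm_triangle_mono f g that)
  qed (auto intro!: has_derivative_add f g)
qed

lemma C2_upto_sum:
  assumes "finite I" "\<And>i. i \<in> I \<Longrightarrow> C2_upto \<Omega> (f i) (f' i)"
  shows "C2_upto \<Omega> (\<lambda>x. \<Sum>i\<in>I. f i x) (\<lambda>x h. \<Sum>i\<in>I. f' i x h)"
  using assms
proof (induction I rule: finite_induct)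
  case empty
  then show ?case using C2_upto_const[of \<Omega> 0] by simp
next
  case (insert i I)
  then show ?case using C2_upto_add[of \<Omega> "f i" "f' i"] by simp
qed

lemma C2_upto_bilinear:
  assumes "bounded_bilinear P" "open \<Omega>" "C2_upto \<Omega> f f'" "C2_upto \<Omega> g g'"
  shows "C2_upto \<Omega> (\<lambda>x. P (f x) (g x)) (\<lambda>x h. P (f x) (g' x h) + P (f' x h) (g x))"
proof -
  interpret P: bounded_bilinear P by fact
  obtain B f'' where "C2_bounds \<Omega> f f' f'' B"
    using assms(3) unfolding C2_upto_def by blast
  note f = C2_boundsD[OF this]
  obtain A g'' where "C2_bounds \<Omega> g g' g'' A"
    using assms(4) unfolding C2_upto_def by blast
  note g = C2_boundsD[OF this]
  obtain K where K: "K > 0" "\<And>a b. norm (P a b) \<le> norm a * norm b * K"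
    using P.pos_bounded by blast
  have Pb: "norm (P a b) \<le> s * t * K" if "norm a \<le> s" "norm b \<le> t" for a b s t
    by (rule order_trans[OF K(2)], intro mult_right_mono mult_mono)
      (use that K in \<open>auto intro: order_trans[OF norm_ge_zero]\<close>)
  have cl: "x \<in> closure \<Omega>" if "x \<in> \<Omega>" for x using that closure_subset by blast
  show ?thesis
  proof (rule C2_uptoI[where B="B * A * K" and B'="2 * (B * A * K)" and B''="4 * (B * A * K)" and
        f''="\<lambda>x h k. (P (f x) (g'' x h k) + P (f' x k) (g' x h)) + (P (f' x h) (g' x k) + P (f'' x h k) (g x))"])
    fix x h assume x: "x \<in> closure \<Omega>"
    show "((\<lambda>x. P (f x) (g x)) has_derivative (\<lambda>h. P (f x) (g' x h) + P (f' x h) (g x))) (at x within closure \<Omega>)"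
      by (intro P.FDERIV f g x)
    show "norm (P (f x) (g x)) \<le> B * A * K" by (intro Pb f g x)
    have "norm (P (f x) (g' x h)) \<le> B * (A * norm h) * K" "norm (P (f' x h) (g x)) \<le> (B * norm h) * A * K"
      by (intro Pb f g x)+
    then show "norm (P (f x) (g' x h) + P (f' x h) (g x)) \<le> 2 * (B * A * K) * norm h"
      by (intro norm_triangle_le) (simp add: mult_ac)
  next
    fix x h assume x: "x \<in> \<Omega>"
    have d: "(f has_derivative f' x) (at x)" "(g has_derivative g' x) (at x)"
      using f(2)[OF cl[OF x]] g(2)[OF cl[OF x]] at_within_closure_open[OF assms(2) x] by auto
    show "((\<lambda>y. P (f y) (g' y h) + P (f' y h) (g y)) has_derivative
      (\<lambda>k. (P (f x) (g'' x h k) + P (f' x k) (g' x h)) + (P (f' x h) (g' x k) + P (f'' x h k) (g x)))) (at x)"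
      by (intro has_derivative_add P.FDERIV d f(5) g(5) x)
  next
    fix x h k assume x: "x \<in> \<Omega>"
    note c = cl[OF x]
    have "norm (P (f x) (g'' x h k)) \<le> B * (A * norm h * norm k) * K"
      "norm (P (f' x k) (g' x h)) \<le> (B * norm k) * (A * norm h) * K"
      "norm (P (f' x h) (g' x k)) \<le> (B * norm h) * (A * norm k) * K"
      "norm (P (f'' x h k) (g x)) \<le> (B * norm h * norm k) * A * K"
      by (intro Pb f g x c)+
    then have "norm (P (f x) (g'' x h k) + P (f' x k) (g' x h)) + norm (P (f' x h) (g' x k) + P (f'' x h k) (g x))
        \<le> 4 * (B * A * K * norm h * norm k)"
      using norm_triangle_ineq[of "P (f x) (g'' x h k)" "P (f' x k) (g' x h)"]
        norm_triangle_ineq[of "P (f' x h) (g' x k)" "P (f'' x h k) (g x)"]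
      by (simp add: mult_ac)
    then show "norm ((P (f x) (g'' x h k) + P (f' x k) (g' x h)) + (P (f' x h) (g' x k) + P (f'' x h k) (g x)))
       \<le> 4 * (B * A * K) * norm h * norm k"
      by (intro norm_triangle_le) (simp add: mult_ac)
  qed
qed

lemma C2_upto_compose:
  fixes f :: "'a::euclidean_space \<Rightarrow> real"
  assumes "open \<Omega>" "C2_upto \<Omega> f f'"
    and psi: "\<And>x. x \<in> closure \<Omega> \<Longrightarrow> (\<psi> has_real_derivative \<psi>' (f x)) (at (f x))"
      "\<And>x. x \<in> closure \<Omega> \<Longrightarrow> (\<psi>' has_real_derivative \<psi>'' (f x)) (at (f x))"
    and K: "\<And>x. x \<in> closure \<Omega> \<Longrightarrow> \<bar>\<psi> (f x)\<bar> \<le> K \<and> \<bar>\<psi>' (f x)\<bar> \<le> K \<and> \<bar>\<psi>'' (f x)\<bar> \<le> K"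
  shows "C2_upto \<Omega> (\<lambda>x. \<psi> (f x)) (\<lambda>x h. \<psi>' (f x) * f' x h)"
proof -
  obtain B f'' where "C2_bounds \<Omega> f f' f'' B"
    using assms(2) unfolding C2_upto_def by blast
  note f = C2_boundsD[OF this]
  have cl: "x \<in> closure \<Omega>" if "x \<in> \<Omega>" for x using that closure_subset by blast
  have mm: "\<bar>a * b\<bar> \<le> s * t" if "\<bar>a\<bar> \<le> s" "\<bar>b\<bar> \<le> t" for a b s t :: real
    unfolding abs_mult by (intro mult_mono that) (use that in linarith)+
  show ?thesis
  proof (rule C2_uptoI[where B=K and B'="K * B" and B''="K * B + K * B * B" and
        f''="\<lambda>x h k. \<psi>' (f x) * f'' x h k + (\<psi>'' (f x) * f' x k) * f' x h"])
    fix x h assume x: "x \<in> closure \<Omega>"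
    show "((\<lambda>x. \<psi> (f x)) has_derivative (\<lambda>h. \<psi>' (f x) * f' x h)) (at x within closure \<Omega>)"
      by (rule has_derivative_compose[OF f(2)[OF x] psi(1)[OF x, unfolded has_field_derivative_def]])
    show "norm (\<psi> (f x)) \<le> K" using K[OF x] by simp
    show "norm (\<psi>' (f x) * f' x h) \<le> K * B * norm h"
      using mm[of "\<psi>' (f x)" K "f' x h" "B * norm h"] K[OF x] f(4)[OF x, of h] by (simp add: mult.assoc)
  next
    fix x h assume x: "x \<in> \<Omega>"
    have d: "(f has_derivative f' x) (at x)"
      using f(2)[OF cl[OF x]] at_within_closure_open[OF assms(1) x] by auto
    show "((\<lambda>y. \<psi>' (f y) * f' y h) has_derivative (\<lambda>k. \<psi>' (f x) * f'' x h k + (\<psi>'' (f x) * f' x k) * f' x h)) (at x)"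
      by (intro has_derivative_mult f(5) x has_derivative_compose[OF d psi(2)[OF cl[OF x], unfolded has_field_derivative_def]])
  next
    fix x h k assume x: "x \<in> \<Omega>"
    have "\<bar>\<psi>' (f x) * f'' x h k\<bar> \<le> K * (B * norm h * norm k)"
      using K[OF cl[OF x]] f(6)[OF x, of h k] by (intro mm) auto
    moreover have "\<bar>(\<psi>'' (f x) * f' x k) * f' x h\<bar> \<le> (K * (B * norm k)) * (B * norm h)"
      using K[OF cl[OF x]] f(4)[OF cl[OF x]] by (intro mm) auto
    ultimately show "norm (\<psi>' (f x) * f'' x h k + (\<psi>'' (f x) * f' x k) * f' x h) \<le> (K * B + K * B * B) * norm h * norm k"
      by (intro norm_triangle_le) (simp add: algebra_simps)
  qed
qed

lemma norm_sum_Basis_le: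
  fixes G :: "'a::euclidean_space \<Rightarrow> 'b::real_normed_vector"
  assumes "\<And>b. b \<in> Basis \<Longrightarrow> norm (G b) \<le> B"
  shows "norm (\<Sum>b\<in>Basis. (h \<bullet> b) *\<^sub>R G b) \<le> (real DIM('a) * B) * norm h"
proof -
  have "norm (\<Sum>b\<in>Basis. (h \<bullet> b) *\<^sub>R G b) \<le> (\<Sum>b\<in>(Basis::'a set). norm h * B)"
    by (rule sum_norm_le) (auto intro!: mult_mono assms Basis_le_norm)
  then show ?thesis by (simp add: mult_ac)
qed

lemma continuous_family_bounded:
  fixes g :: "'i \<Rightarrow> 'a::topological_space \<Rightarrow> 'b::real_normed_vector"
  assumes "finite I" "compact K" "\<And>i. i \<in> I \<Longrightarrow> continuous_on K (g i)"
  shows "\<exists>B\<ge>0. \<forall>i\<in>I. \<forall>x\<in>K. norm (g i x) \<le> B"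
proof -
  have "bounded (\<Union>i\<in>I. g i ` K)"
    using assms by (intro bounded_UN) (auto intro: compact_imp_bounded compact_continuous_image)
  then obtain B where "\<forall>y\<in>(\<Union>i\<in>I. g i ` K). norm y \<le> B" unfolding bounded_iff by blast
  then show ?thesis by (intro exI[of _ "max 0 B"]) (auto simp: le_max_iff_disj)
qed

text \<open>
  Functions with continuous partial derivatives on the compact closure are covered, as continuity gives
  all the bounds.
\<close>

lemma C2_uptoI_partials:
  fixes f :: "'a::euclidean_space \<Rightarrow> real"
  assumes "bounded \<Omega>" "open \<Omega>"
    and f: "continuous_on (closure \<Omega>) f"
    and der: "\<And>x. x \<in> closure \<Omega> \<Longrightarrow> (f has_derivative (\<lambda>h. \<Sum>b\<in>Basis. (h \<bullet> b) *\<^sub>R G b x)) (at x within closure \<Omega>)"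
    and G: "\<And>b. b \<in> Basis \<Longrightarrow> continuous_on (closure \<Omega>) (G b)"
    and der2: "\<And>b x. b \<in> Basis \<Longrightarrow> x \<in> \<Omega> \<Longrightarrow> (G b has_derivative (\<lambda>h. \<Sum>c\<in>Basis. (h \<bullet> c) *\<^sub>R H c b x)) (at x)"
    and H: "\<And>b c. b \<in> Basis \<Longrightarrow> c \<in> Basis \<Longrightarrow> continuous_on (closure \<Omega>) (H c b)"
  shows "C2_upto \<Omega> f (\<lambda>x h. \<Sum>b\<in>Basis. (h \<bullet> b) *\<^sub>R G b x)"
proof -
  have K: "compact (closure \<Omega>)" using assms(1) by (simp add: compact_closure)
  obtain B0 where B0: "\<And>x. x \<in> closure \<Omega> \<Longrightarrow> norm (f x) \<le> B0"
    using continuous_family_bounded[of "{()}" "closure \<Omega>" "\<lambda>_. f"] K f by auto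
  obtain B1 where B1: "\<And>b x. b \<in> Basis \<Longrightarrow> x \<in> closure \<Omega> \<Longrightarrow> norm (G b x) \<le> B1"
    using continuous_family_bounded[OF finite_Basis K, of G] G by blast
  obtain B2 where B2: "\<And>b c x. b \<in> Basis \<Longrightarrow> c \<in> Basis \<Longrightarrow> x \<in> closure \<Omega> \<Longrightarrow> norm (H c b x) \<le> B2"
    using continuous_family_bounded[OF _ K, of "Basis \<times> Basis" "\<lambda>(c, b). H c b"] H by fastforce
  show ?thesis
  proof (rule C2_uptoI[where B=B0 and B'="real DIM('a) * B1" and B''="real DIM('a) * (real DIM('a) * B2)" and
      f''="\<lambda>x h k. \<Sum>b\<in>Basis. (h \<bullet> b) *\<^sub>R (\<Sum>c\<in>Basis. (k \<bullet> c) *\<^sub>R H c b x)"])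
    fix x h assume "x \<in> \<Omega>"
    then show "((\<lambda>y. \<Sum>b\<in>Basis. (h \<bullet> b) *\<^sub>R G b y) has_derivative
      (\<lambda>k. \<Sum>b\<in>Basis. (h \<bullet> b) *\<^sub>R (\<Sum>c\<in>Basis. (k \<bullet> c) *\<^sub>R H c b x))) (at x)"
      by (intro has_derivative_sum has_derivative_scaleR_right der2)
  next
    fix x h k assume "x \<in> \<Omega>"
    then have x: "x \<in> closure \<Omega>" using closure_subset by blast
    have "norm (\<Sum>b\<in>Basis. (h \<bullet> b) *\<^sub>R (\<Sum>c\<in>Basis. (k \<bullet> c) *\<^sub>R H c b x))
      \<le> real DIM('a) * (real DIM('a) * B2 * norm k) * norm h"
      by (intro norm_sum_Basis_le B2 x)
    then show "norm (\<Sum>b\<in>Basis. (h \<bullet> b) *\<^sub>R (\<Sum>c\<in>Basis. (k \<bullet> c) *\<^sub>R H c b x))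
      \<le> real DIM('a) * (real DIM('a) * B2) * norm h * norm k"
      by (simp add: mult_ac)
  next
    fix x h assume x: "x \<in> closure \<Omega>"
    show "norm (\<Sum>b\<in>Basis. (h \<bullet> b) *\<^sub>R G b x) \<le> (real DIM('a) * B1) * norm h"
      by (intro norm_sum_Basis_le B1 x)
  qed (fact der B0)+
qed

lemma C2_upto_iter_deriv:
  fixes \<gamma> :: "'a::euclidean_space \<Rightarrow> real"
  assumes "bounded \<Omega>" "open \<Omega>" "C_class k UNIV UNIV \<gamma>" "set bs \<subseteq> Basis" "length bs + 2 \<le> k"
  shows "C2_upto \<Omega> (iter_deriv bs \<gamma>) (\<lambda>x h. \<Sum>b\<in>Basis. (h \<bullet> b) *\<^sub>R iter_deriv (b # bs) \<gamma> x)"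
proof -
  have c: "continuous_on A (iter_deriv cs \<gamma>)" if "set cs \<subseteq> Basis" "length cs \<le> k" for cs A
    using C_class_continuous[OF assms(3) subset_UNIV that] continuous_on_subset by blast
  have d: "(iter_deriv cs \<gamma> has_derivative (\<lambda>h. \<Sum>b\<in>Basis. (h \<bullet> b) *\<^sub>R iter_deriv (b # cs) \<gamma> x)) (at x within A)"
    if "set cs \<subseteq> Basis" "length cs < k" for cs A x
    unfolding real_scaleR_def
    by (rule has_derivative_at_withinI, rule C_class_has_derivative[OF assms(3)]) (use that in auto)
  show ?thesis
    by (rule C2_uptoI_partials[where H="\<lambda>c b. iter_deriv (c # b # bs) \<gamma>", OF assms(1,2) c d c d c])
      (use assms in auto)
qed

text \<open>
  Continuity of the coefficients \<open>G b\<close> on the closure makes the derivative in \<open>\<Omega>\<close> converge uniformly in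
  direction, as \<open>derivative_up_to_boundary\<close> requires.
\<close>

lemma derivative_up_to_closure:
  fixes f :: "real ^ 'n \<Rightarrow> 'b::real_inner"
  assumes "open \<Omega>" and charts: "\<And>x. x \<in> frontier \<Omega> \<Longrightarrow> \<exists>r e \<gamma>. graph_chart 1 \<Omega> x r e \<gamma>"
    and f: "continuous_on (closure \<Omega>) f"
    and der: "\<And>x. x \<in> \<Omega> \<Longrightarrow> (f has_derivative (\<lambda>h. \<Sum>b\<in>Basis. (h \<bullet> b) *\<^sub>R G b x)) (at x)"
    and G: "\<And>b. b \<in> Basis \<Longrightarrow> continuous_on (closure \<Omega>) (G b)"
    and x: "x \<in> closure \<Omega>"
  shows "(f has_derivative (\<lambda>h. \<Sum>b\<in>Basis. (h \<bullet> b) *\<^sub>R G b x)) (at x within closure \<Omega>)"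
proof (cases "x \<in> \<Omega>")
  case True
  then show ?thesis by (rule has_derivative_at_withinI[OF der])
next
  case False
  then have xf: "x \<in> frontier \<Omega>" using x assms(1) by (simp add: frontier_def interior_open)
  then obtain r e \<gamma> where "graph_chart 1 \<Omega> x r e \<gamma>" using charts by blast
  then interpret chart \<Omega> x r e \<gamma> using assms(1) by unfold_locales
  show ?thesis
  proof (rule derivative_up_to_boundary[OF xf f der])
    show "bounded_linear (\<lambda>h. \<Sum>b\<in>Basis. (h \<bullet> b) *\<^sub>R G b x)"
      by (intro bounded_linear_sum bounded_linear_scaleR_const bounded_linear_inner_left)
    fix \<epsilon> :: real assume "\<epsilon> > 0"
    define d where "d = \<epsilon> / real DIM(real^'n)"
    have d: "d > 0" "real DIM(real^'n) * d = \<epsilon>" using \<open>\<epsilon> > 0\<close> by (auto simp: d_def)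
    have "\<forall>\<^sub>F y in at x within closure \<Omega>. \<forall>b\<in>Basis. dist (G b y) (G b x) < d"
    proof (subst eventually_ball_finite_distrib[OF finite_Basis], intro ballI)
      fix b :: "real^'n" assume "b \<in> Basis"
      then have "(G b \<longlongrightarrow> G b x) (at x within closure \<Omega>)"
        using G x by (simp add: continuous_on_def)
      then show "\<forall>\<^sub>F y in at x within closure \<Omega>. dist (G b y) (G b x) < d" using d(1) by (rule tendstoD)
    qed
    then obtain \<delta> where dl: "\<delta> > 0" "\<And>y b. y \<in> closure \<Omega> \<Longrightarrow> y \<noteq> x \<Longrightarrow> dist y x < \<delta> \<Longrightarrow> b \<in> Basis \<Longrightarrow> dist (G b y) (G b x) < d"
      unfolding eventually_at by blast
    have "norm ((\<Sum>b\<in>Basis. (h \<bullet> b) *\<^sub>R G b y) - (\<Sum>b\<in>Basis. (h \<bullet> b) *\<^sub>R G b x)) \<le> \<epsilon> * norm h"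
      if "y \<in> \<Omega> \<inter> ball x \<delta>" for y h
    proof -
      have "y \<in> closure \<Omega>" "dist y x < \<delta>" "y \<noteq> x" using that False closure_subset by (auto simp: dist_commute)
      then have "norm (G b y - G b x) \<le> d" if "b \<in> Basis" for b
        using dl(2)[of y b] that by (simp add: dist_norm less_imp_le)
      then have "norm (\<Sum>b\<in>Basis. (h \<bullet> b) *\<^sub>R (G b y - G b x)) \<le> real DIM(real^'n) * d * norm h"
        by (rule norm_sum_Basis_le)
      then show ?thesis using d(2) by (simp add: sum_subtractf scaleR_diff_right)
    qed
    then show "\<exists>\<delta>>0. \<forall>y\<in>\<Omega> \<inter> ball x \<delta>. \<forall>h. norm ((\<Sum>b\<in>Basis. (h \<bullet> b) *\<^sub>R G b y) - (\<Sum>b\<in>Basis. (h \<bullet> b) *\<^sub>R G b x)) \<le> \<epsilon> * norm h"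
      using dl(1) by blast
  qed
qed

lemma C2_upto_of_C_class:
  fixes \<phi> :: "real ^ 'n \<Rightarrow> real"
  assumes "open \<Omega>" "bounded \<Omega>" and charts: "\<And>x. x \<in> frontier \<Omega> \<Longrightarrow> \<exists>r e \<gamma>. graph_chart 1 \<Omega> x r e \<gamma>"
    and "C_class 2 \<Omega> (closure \<Omega>) \<phi>"
  shows "\<exists>\<phi>'. C2_upto \<Omega> \<phi> \<phi>'"
proof -
  have s: "sum_list (map (\<lambda>_. 1) xs) = length xs" for xs :: "'a list" by (induction xs) auto
  have "\<exists>g. continuous_on (closure \<Omega>) g \<and> (\<forall>x\<in>\<Omega>. g x = iter_deriv bs \<phi> x)"
    if "set bs \<subseteq> Basis" "length bs \<le> 2" for bs
  proof -
    have "sum_list (map (\<lambda>_. 1) bs) \<le> (2::nat)" using that(2) by (simp only: s)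
    then show ?thesis using assms(4) that(1) unfolding C_class_def weighted_C_def by blast
  qed
  then obtain g where g: "\<And>bs. set bs \<subseteq> Basis \<Longrightarrow> length bs \<le> 2 \<Longrightarrow> continuous_on (closure \<Omega>) (g bs)"
    "\<And>bs x. set bs \<subseteq> Basis \<Longrightarrow> length bs \<le> 2 \<Longrightarrow> x \<in> \<Omega> \<Longrightarrow> g bs x = iter_deriv bs \<phi> x" by metis
  have phi: "continuous_on (closure \<Omega>) \<phi>" using assms(4) by (simp add: C_class_def weighted_C_def)
  have d: "(iter_deriv bs \<phi> has_derivative (\<lambda>h. \<Sum>b\<in>Basis. (h \<bullet> b) *\<^sub>R g (b # bs) x)) (at x)"
    if "set bs \<subseteq> Basis" "length bs < 2" "x \<in> \<Omega>" for bs x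
    using C_class_has_derivative[OF assms(4,1) closure_subset that] g(2)[OF _ _ that(3)] that
    by (simp add: Suc_le_eq)
  have "C2_upto \<Omega> \<phi> (\<lambda>x h. \<Sum>b\<in>Basis. (h \<bullet> b) *\<^sub>R g [b] x)"
  proof (rule C2_uptoI_partials[where H="\<lambda>c b. g [c, b]"])
    show "(\<phi> has_derivative (\<lambda>h. \<Sum>b\<in>Basis. (h \<bullet> b) *\<^sub>R g [b] x)) (at x within closure \<Omega>)" if "x \<in> closure \<Omega>" for x
      by (rule derivative_up_to_closure[OF assms(1) charts phi _ _ that])
        (use d[of "[]"] g(1) in \<open>auto simp: iter_deriv_def\<close>)
    show "(g [b] has_derivative (\<lambda>h. \<Sum>c\<in>Basis. (h \<bullet> c) *\<^sub>R g [c, b] x)) (at x)" if "b \<in> Basis" "x \<in> \<Omega>" for b x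
      by (rule has_derivative_transform_within_open[OF d[of "[b]" x] assms(1)]) (use that g(2) in auto)
  qed (use assms phi g(1) in auto)
  then show ?thesis by blast
qed

section \<open>Extension of the normal field and a defining function\<close>

lemma DERIV_pos_part_power:
  "((\<lambda>s::real. max 0 s ^ Suc (Suc n)) has_real_derivative real (n + 2) * max 0 s ^ Suc n) (at s)"
proof (cases s "0::real" rule: linorder_cases)
  case less
  have "((\<lambda>s::real. 0) has_real_derivative 0) (at s)" by simp
  then have "((\<lambda>s::real. max 0 s ^ Suc (Suc n)) has_real_derivative 0) (at s)"
    by (rule has_field_derivative_transform_within_open[where S="{..<0}"]) (use less in auto)
  then show ?thesis using less by simp
next
  case greater
  have "((\<lambda>s::real. s ^ Suc (Suc n)) has_real_derivative real (n + 2) * s ^ Suc n) (at s)"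
    by (rule derivative_eq_intros refl | simp)+
  then have "((\<lambda>s::real. max 0 s ^ Suc (Suc n)) has_real_derivative real (n + 2) * s ^ Suc n) (at s)"
    by (rule has_field_derivative_transform_within_open[where S="{0<..}"]) (use greater in auto)
  then show ?thesis using greater by simp
next
  case equal
  have lim: "((\<lambda>h. max 0 h ^ Suc n) \<longlongrightarrow> max 0 0 ^ Suc n) (at (0::real))"
    by (intro tendsto_intros)
  have "\<bar>(max 0 h ^ Suc (Suc n)) / h\<bar> \<le> max 0 h ^ Suc n" for h :: real
  proof (cases "h > 0")
    case True
    then have "max 0 h = h" by simp
    then show ?thesis using True by simp
  next
    case False
    then have "max 0 h = 0" by simp
    then show ?thesis by simp
  qed
  note bound = this
  have "\<forall>\<^sub>F h in at 0. norm ((max 0 h ^ Suc (Suc n)) / h) \<le> max 0 h ^ Suc n"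
    unfolding real_norm_def by (rule always_eventually, rule allI, rule bound)
  moreover have "((\<lambda>h. max 0 h ^ Suc n) \<longlongrightarrow> 0) (at (0::real))" using lim by simp
  ultimately have "((\<lambda>h. (max 0 h ^ Suc (Suc n)) / h) \<longlongrightarrow> 0) (at (0::real))"
    by (rule Lim_null_comparison)
  moreover have "(max 0 (0 + h) ^ Suc (Suc n) - max 0 (0::real) ^ Suc (Suc n)) / h = (max 0 h ^ Suc (Suc n)) / h" for h :: real
    by simp
  moreover have "real (n + 2) * max 0 (0::real) ^ Suc n = 0" by simp
  ultimately show ?thesis unfolding DERIV_def equal by (simp only:)
qed

text \<open>
  The third power makes the truncation at \<open>0\<close> twice continuously differentiable. The derivative is
  recorded to vanish wherever the bump does, also on the sphere.
\<close>

lemma C2_upto_bump: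
  fixes a :: "'a::euclidean_space"
  assumes "open \<Omega>" "bounded \<Omega>"
  shows "\<exists>b'. C2_upto \<Omega> (\<lambda>x. max 0 (r\<^sup>2 - (norm (x - a))\<^sup>2) ^ 3) b' \<and>
    (\<forall>x h. r \<le> dist a x \<longrightarrow> 0 \<le> r \<longrightarrow> b' x h = 0)"
proof -
  define f where "f x = r\<^sup>2 + - 1 * ((x - a) \<bullet> (x - a))" for x
  define f' where "f' x h = - 1 * ((x - a) \<bullet> h + h \<bullet> (x - a)) + 0 * ((x - a) \<bullet> (x - a))" for x h
  have f: "C2_upto \<Omega> f (\<lambda>x h. 0 + f' x h)"
    unfolding f_def f'_def
    by (intro C2_upto_add C2_upto_const C2_upto_bilinear[OF bounded_bilinear_mult]
        C2_upto_bilinear[OF bounded_bilinear_inner] C2_upto_ident_diff assms)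
  then obtain B where B: "\<And>x. x \<in> closure \<Omega> \<Longrightarrow> norm (f x) \<le> B" "B \<ge> 0"
    unfolding C2_upto_def using C2_boundsD(1,3) by metis
  have mB: "max 0 (f x) \<le> B" "0 \<le> max 0 (f x)" if "x \<in> closure \<Omega>" for x
    using B(1)[OF that] B(2) by auto
  have mp: "max 0 (f x) ^ n \<le> B ^ n" if "x \<in> closure \<Omega>" for x n
    using power_mono[OF mB[OF that]] .
  define K where "K = B^3 + 3 * B\<^sup>2 + 6 * B"
  have "C2_upto \<Omega> (\<lambda>x. (\<lambda>s. max 0 s ^ 3) (f x)) (\<lambda>x h. (\<lambda>s. 3 * max 0 s ^ 2) (f x) * (0 + f' x h))"
  proof (rule C2_upto_compose[OF assms(1) f, where \<psi>''="\<lambda>s. 6 * max 0 s" and K=K])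
    show "((\<lambda>s. max 0 s ^ 3) has_real_derivative 3 * (max 0 (f x))\<^sup>2) (at (f x))" for x
      using DERIV_pos_part_power[of 1 "f x"] by (simp add: numeral_eq_Suc)
    show "((\<lambda>s. 3 * max 0 s ^ 2) has_real_derivative 6 * (max 0 (f x))) (at (f x))" for x
      using DERIV_cmult[OF DERIV_pos_part_power[of 0 "f x"], of 3] by (simp add: numeral_2_eq_2)
    fix x assume x: "x \<in> closure \<Omega>"
    have nn: "0 \<le> B ^ 3" "0 \<le> B\<^sup>2" using B by auto
    have "max 0 (f x) ^ 3 \<le> K" "3 * (max 0 (f x))\<^sup>2 \<le> K" "6 * max 0 (f x) \<le> K"
      unfolding K_def using mp[OF x, of 3] mp[OF x, of 2] mB(1)[OF x] nn B(2) by linarith+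
    then show "\<bar>max 0 (f x) ^ 3\<bar> \<le> K \<and> \<bar>3 * (max 0 (f x))\<^sup>2\<bar> \<le> K \<and> \<bar>6 * max 0 (f x)\<bar> \<le> K"
      by (intro conjI; subst abs_of_nonneg) auto
  qed
  moreover have "f x = r\<^sup>2 - (norm (x - a))\<^sup>2" for x by (simp add: f_def power2_norm_eq_inner)
  moreover have "r\<^sup>2 - (norm (x - a))\<^sup>2 \<le> 0" if "r \<le> dist a x" "0 \<le> r" for x
    using that power_mono[of r "norm (x - a)" 2] by (simp add: dist_norm norm_minus_commute)
  ultimately show ?thesis
    by (intro exI[of _ "\<lambda>x h. (\<lambda>s. 3 * max 0 s ^ 2) (f x) * (0 + f' x h)"]) (simp add: max_absorb1)
qed

text \<open>
  Bumps subordinate to a finite subcover are divided by their sum, which is positive on the closure.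
  That the derivative of \<open>\<theta> a\<close> vanishes outside the ball of \<open>a\<close> is what later permits to differentiate
  products \<open>\<theta> a * g\<close> in which \<open>g\<close> is meaningful only near \<open>a\<close>.
\<close>

lemma C2_partition_of_unity:
  fixes \<Omega> :: "'a::euclidean_space set"
  assumes "open \<Omega>" "bounded \<Omega>" and r: "\<forall>x\<in>closure \<Omega>. r x > 0"
  shows "\<exists>F (\<theta> :: 'a \<Rightarrow> 'a \<Rightarrow> real) \<theta>'. finite F \<and> F \<subseteq> closure \<Omega> \<and>
    (\<forall>a\<in>F. C2_upto \<Omega> (\<theta> a) (\<theta>' a) \<and>
       (\<forall>x\<in>closure \<Omega>. \<theta> a x \<ge> 0 \<and> (x \<notin> ball a (r a) \<longrightarrow> \<theta> a x = 0 \<and> (\<forall>h. \<theta>' a x h = 0)))) \<and>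
    (\<forall>x\<in>closure \<Omega>. (\<Sum>a\<in>F. \<theta> a x) = 1)"
proof -
  have K: "compact (closure \<Omega>)" using assms(2) by (simp add: compact_closure)
  obtain F where F: "F \<subseteq> closure \<Omega>" "finite F" "closure \<Omega> \<subseteq> (\<Union>a\<in>F. ball a (r a))"
    by (rule compactE_image[OF K, of "closure \<Omega>" "\<lambda>a. ball a (r a)"]) (use r in force)+
  define b where "b a x = max 0 ((r a)\<^sup>2 - (norm (x - a))\<^sup>2) ^ 3" for a x :: 'a
  have "\<exists>b'. C2_upto \<Omega> (b a) b' \<and> (\<forall>x h. r a \<le> dist a x \<longrightarrow> 0 \<le> r a \<longrightarrow> b' x h = 0)" for a
    unfolding b_def by (rule C2_upto_bump[OF assms(1,2)])
  then obtain b' where b': "\<And>a. C2_upto \<Omega> (b a) (b' a)"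
    "\<And>a x h. r a \<le> dist a x \<Longrightarrow> 0 \<le> r a \<Longrightarrow> b' a x h = 0" by metis
  have b0: "b a x \<ge> 0" for a x by (simp add: b_def)
  have bpos: "b a x > 0" if "x \<in> ball a (r a)" for a x
  proof -
    have "norm (x - a) < r a" using that by (simp add: dist_norm norm_minus_commute)
    then have "(norm (x - a))\<^sup>2 < (r a)\<^sup>2" by (intro power_strict_mono) auto
    then show ?thesis by (simp add: b_def)
  qed
  have bz: "b a x = 0" if "x \<notin> ball a (r a)" "r a > 0" for a x
  proof -
    have "r a \<le> norm (x - a)" using that by (simp add: dist_norm norm_minus_commute)
    then have "(r a)\<^sup>2 \<le> (norm (x - a))\<^sup>2" using that by (intro power_mono) auto
    then show ?thesis by (simp add: b_def max_absorb1)
  qed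
  define S where "S x = (\<Sum>a\<in>F. b a x)" for x
  define S' where "S' x h = (\<Sum>a\<in>F. b' a x h)" for x h
  have S: "C2_upto \<Omega> S S'" unfolding S_def S'_def by (intro C2_upto_sum F b')
  have Spos: "S x > 0" if "x \<in> closure \<Omega>" for x
  proof -
    have "x \<in> (\<Union>a\<in>F. ball a (r a))" using F(3) that by blast
    then obtain a where "a \<in> F" "x \<in> ball a (r a)" by blast
    then show ?thesis unfolding S_def using F b0 bpos by (intro sum_pos2[of F a]) auto
  qed
  have "continuous_on (closure \<Omega>) (\<lambda>x. inverse (S x))"
    using C2_upto_continuous[OF S] by (rule continuous_on_inverse) (use Spos in \<open>metis less_irrefl\<close>)
  then obtain B where B: "B \<ge> 0" "\<And>x. x \<in> closure \<Omega> \<Longrightarrow> \<bar>inverse (S x)\<bar> \<le> B"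
    using continuous_family_bounded[of "{()}" "closure \<Omega>" "\<lambda>_ x. inverse (S x)"] K by auto
  have iS: "C2_upto \<Omega> (\<lambda>x. inverse (S x)) (\<lambda>x h. (\<lambda>s. - (inverse s)\<^sup>2) (S x) * S' x h)"
  proof (rule C2_upto_compose[OF assms(1) S, where \<psi>''="\<lambda>s. 2 * inverse s ^ 3" and K="B + B\<^sup>2 + 2 * B^3"])
    fix x assume x: "x \<in> closure \<Omega>"
    have ne: "S x \<noteq> 0" using Spos[OF x] by simp
    show "(inverse has_real_derivative - (inverse (S x))\<^sup>2) (at (S x))"
      using ne by (auto intro!: derivative_eq_intros simp: power2_eq_square)
    show "((\<lambda>s. - (inverse s)\<^sup>2) has_real_derivative 2 * inverse (S x) ^ 3) (at (S x))"
      using ne by (auto intro!: derivative_eq_intros simp: power2_eq_square power3_eq_cube)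
    have "\<bar>inverse (S x)\<bar> ^ n \<le> B ^ n" for n by (intro power_mono B x) simp
    from this[of 1] this[of 2] this[of 3]
    have "\<bar>inverse (S x)\<bar> \<le> B" "\<bar>(inverse (S x))\<^sup>2\<bar> \<le> B\<^sup>2" "\<bar>inverse (S x) ^ 3\<bar> \<le> B ^ 3"
      unfolding power_abs by simp_all
    moreover have "0 \<le> B\<^sup>2" "0 \<le> B ^ 3" using B(1) by simp_all
    ultimately show "\<bar>inverse (S x)\<bar> \<le> B + B\<^sup>2 + 2 * B^3 \<and> \<bar>- (inverse (S x))\<^sup>2\<bar> \<le> B + B\<^sup>2 + 2 * B^3
      \<and> \<bar>2 * inverse (S x) ^ 3\<bar> \<le> B + B\<^sup>2 + 2 * B^3"
      using B(1) unfolding abs_minus_cancel abs_mult[of 2] abs_numeral by linarith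
  qed
  define \<theta> where "\<theta> a x = b a x * inverse (S x)" for a x
  define \<theta>' where "\<theta>' a x h = b a x * ((\<lambda>s. - (inverse s)\<^sup>2) (S x) * S' x h) + b' a x h * inverse (S x)" for a x h
  have "C2_upto \<Omega> (\<theta> a) (\<theta>' a)" for a
    unfolding \<theta>_def \<theta>'_def by (intro C2_upto_bilinear[OF bounded_bilinear_mult] assms b' iS)
  moreover have "\<theta> a x \<ge> 0" if "x \<in> closure \<Omega>" for a x
    unfolding \<theta>_def using b0 Spos[OF that] by (simp add: less_imp_le)
  moreover have "\<theta> a x = 0 \<and> (\<forall>h. \<theta>' a x h = 0)" if "a \<in> F" "x \<notin> ball a (r a)" for a x
  proof -
    have ra: "r a > 0" using that F r by blast
    then have "b' a x h = 0" for h using b'(2)[of a x h] that by simp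
    then show ?thesis using bz[OF that(2) ra] by (simp add: \<theta>_def \<theta>'_def)
  qed
  moreover have "(\<Sum>a\<in>F. \<theta> a x) = 1" if "x \<in> closure \<Omega>" for x
    unfolding \<theta>_def sum_distrib_right[symmetric] using Spos[OF that] by (simp flip: S_def)
  ultimately show ?thesis using F(1,2) by (intro exI[of _ F] exI[of _ \<theta>] exI[of _ \<theta>']) auto
qed

lemma C2_upto_chart:
  fixes \<gamma> :: "real ^ 'n \<Rightarrow> real"
  assumes "open \<Omega>" "bounded \<Omega>" "C_class 3 UNIV UNIV \<gamma>"
  shows "C2_upto \<Omega> (\<lambda>x. x \<bullet> e - \<gamma> x) (\<lambda>x h. (e - grad \<gamma> x) \<bullet> h)"
    and "\<exists>g'. C2_upto \<Omega> (\<lambda>x. grad \<gamma> x - e) g'"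
proof -
  have g: "C2_upto \<Omega> \<gamma> (\<lambda>x h. grad \<gamma> x \<bullet> h)"
  proof -
    have "C2_upto \<Omega> \<gamma> (\<lambda>x h. \<Sum>b\<in>Basis. (h \<bullet> b) * dir_deriv b \<gamma> x)"
      using C2_upto_iter_deriv[OF assms(2,1,3), of "[]"] by (simp add: iter_deriv_def)
    moreover have "(\<Sum>b\<in>Basis. (h \<bullet> b) * dir_deriv b \<gamma> x) = grad \<gamma> x \<bullet> h" for h x
      by (simp add: grad_def sum_axis_Basis inner_axis inner_vec_sum)
    ultimately show ?thesis by simp
  qed
  have "C2_upto \<Omega> (\<lambda>x. (x - 0) \<bullet> e + (- 1) * \<gamma> x) (\<lambda>x h. ((x - 0) \<bullet> 0 + h \<bullet> e) + ((- 1) * (grad \<gamma> x \<bullet> h) + 0 * \<gamma> x))"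
    by (intro C2_upto_add C2_upto_bilinear[OF bounded_bilinear_inner] C2_upto_bilinear[OF bounded_bilinear_mult]
        C2_upto_const C2_upto_ident_diff assms g)
  then show "C2_upto \<Omega> (\<lambda>x. x \<bullet> e - \<gamma> x) (\<lambda>x h. (e - grad \<gamma> x) \<bullet> h)"
    by (simp add: inner_diff_left inner_diff_right inner_commute)
  have p: "\<exists>p'. C2_upto \<Omega> (\<lambda>x. grad \<gamma> x $ i) p'" for i
    using C2_upto_iter_deriv[OF assms(2,1,3), of "[axis i 1]"] by (auto simp: iter_deriv_def grad_def)
  then obtain p' where p': "\<And>i. C2_upto \<Omega> (\<lambda>x. grad \<gamma> x $ i) (p' i)" by metis
  have "C2_upto \<Omega> (\<lambda>x. (\<Sum>i\<in>UNIV. (grad \<gamma> x $ i) *\<^sub>R axis i 1) + (- e))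
     (\<lambda>x h. (\<Sum>i\<in>UNIV. (grad \<gamma> x $ i) *\<^sub>R 0 + p' i x h *\<^sub>R axis i 1) + 0)"
    by (intro C2_upto_add C2_upto_sum C2_upto_bilinear[OF bounded_bilinear_scaleR] C2_upto_const assms p') auto
  moreover have "(\<Sum>i\<in>UNIV. (v $ i) *\<^sub>R axis i 1) = v" for v :: "real ^ 'n"
    using basis_expansion[of v] by (simp add: scalar_mult_eq_scaleR)
  ultimately show "\<exists>g'. C2_upto \<Omega> (\<lambda>x. grad \<gamma> x - e) g'" by auto
qed

lemma C2_upto_sgn:
  fixes g :: "'a::euclidean_space \<Rightarrow> 'b::real_inner"
  assumes "open \<Omega>" "C2_upto \<Omega> g g'" "\<And>x. x \<in> closure \<Omega> \<Longrightarrow> norm (g x) \<ge> 1"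
  shows "\<exists>n'. C2_upto \<Omega> (\<lambda>x. sgn (g x)) n'"
proof -
  define s where "s x = g x \<bullet> g x" for x
  have s: "C2_upto \<Omega> s (\<lambda>x h. g x \<bullet> g' x h + g' x h \<bullet> g x)"
    unfolding s_def by (intro C2_upto_bilinear[OF bounded_bilinear_inner] assms)
  have s1: "s x \<ge> 1" if "x \<in> closure \<Omega>" for x
    using power_mono[OF assms(3)[OF that], of 2] by (simp add: s_def power2_norm_eq_inner)
  have "C2_upto \<Omega> (\<lambda>x. (\<lambda>r. r powr (-1/2)) (s x)) (\<lambda>x h. (\<lambda>r. (-1/2) * r powr (-3/2)) (s x) * (g x \<bullet> g' x h + g' x h \<bullet> g x))"
  proof (rule C2_upto_compose[OF assms(1) s, where \<psi>''="\<lambda>r. (3/4) * r powr (-5/2)" and K=1])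
    fix x assume x: "x \<in> closure \<Omega>"
    have p: "s x > 0" using s1[OF x] by simp
    show "((\<lambda>r. r powr (-1/2)) has_real_derivative (-1/2) * s x powr (-3/2)) (at (s x))"
      using has_real_derivative_powr[OF p, of "-1/2"] by simp
    show "((\<lambda>r. (-1/2) * r powr (-3/2)) has_real_derivative (3/4) * s x powr (-5/2)) (at (s x))"
      using DERIV_cmult[OF has_real_derivative_powr[OF p, of "-3/2"], of "-1/2"] by simp
    have "s x powr a \<le> 1" if "a \<le> 0" for a using powr_mono[OF that s1[OF x]] p by simp
    from this[of "-1/2"] this[of "-3/2"] this[of "-5/2"]
    show "\<bar>s x powr (-1/2)\<bar> \<le> 1 \<and> \<bar>(-1/2) * s x powr (-3/2)\<bar> \<le> 1 \<and> \<bar>(3/4) * s x powr (-5/2)\<bar> \<le> 1"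
      by (simp add: abs_mult)
  qed
  then have "C2_upto \<Omega> (\<lambda>x. (s x powr (-1/2)) *\<^sub>R g x) (\<lambda>x h. (s x powr (-1/2)) *\<^sub>R g' x h +
     ((-1/2) * s x powr (-3/2) * (g x \<bullet> g' x h + g' x h \<bullet> g x)) *\<^sub>R g x)"
    using assms by (intro C2_upto_bilinear[OF bounded_bilinear_scaleR]) auto
  moreover have "(s x powr (-1/2)) *\<^sub>R g x = sgn (g x)" for x
  proof -
    have "s x powr (-1/2) = inverse (norm (g x))"
      by (simp add: s_def powr_minus powr_half_sqrt norm_eq_sqrt_inner flip: powr_minus_divide)
    then show ?thesis by (simp add: sgn_div_norm)
  qed
  ultimately show ?thesis by auto
qed

text \<open>
  The closure is covered by chart balls around boundary points and by balls inside \<open>\<Omega>\<close>; on the frontier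
  only the former contribute to the partition of unity. There all charts give the same unit normal, so
  the average of the chart normals is \<open>\<nu>\<close>. The defining functions \<open>x \<bullet> e - \<gamma> x\<close> of the charts vanish on
  the frontier and their gradients are multiples of \<open>- \<nu>\<close> of length at least \<open>1\<close>, so averaging them gives
  \<open>\<zeta>\<close>. Normals of charts of class \<open>C\<^sup>3\<close> are of class \<open>C\<^sup>2\<close>.
\<close>

lemma boundary_functions:
  fixes \<Omega> :: "(real ^ 'n) set"
  assumes "open \<Omega>" "bounded \<Omega>" "C_boundary 3 \<Omega>"
    and nu: "\<forall>x\<in>frontier \<Omega>. outward_unit_normal \<Omega> x (\<nu> x)"
  shows "\<exists>N N' \<zeta> \<zeta>'. C2_upto \<Omega> N N' \<and> C2_upto \<Omega> \<zeta> \<zeta>' \<and>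
    (\<forall>x\<in>frontier \<Omega>. N x = \<nu> x \<and> \<zeta> x = 0 \<and> (\<exists>m\<ge>1. \<forall>h. \<zeta>' x h = - m * (\<nu> x \<bullet> h)))"
proof -
  obtain r0 e \<gamma> where ch0: "\<And>x. x \<in> frontier \<Omega> \<Longrightarrow> graph_chart 3 \<Omega> x (r0 x) (e x) (\<gamma> x)"
    using assms(3) unfolding C_boundary_def by metis
  have "\<exists>r>0. ball x r \<subseteq> \<Omega>" if "x \<in> \<Omega>" for x using assms(1) that openE by blast
  then obtain r1 where r1: "\<And>x. x \<in> \<Omega> \<Longrightarrow> r1 x > 0 \<and> ball x (r1 x) \<subseteq> \<Omega>" by metis
  define r where "r x = (if x \<in> \<Omega> then r1 x else r0 x)" for x
  have split: "x \<in> \<Omega> \<or> x \<in> frontier \<Omega>" if "x \<in> closure \<Omega>" for x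
    using that assms(1) by (simp add: frontier_def interior_open)
  have disj: "x \<notin> \<Omega>" if "x \<in> frontier \<Omega>" for x using that assms(1) by (simp add: frontier_def interior_open)
  have fcl: "x \<in> closure \<Omega>" if "x \<in> frontier \<Omega>" for x using that by (simp add: frontier_def)
  have rpos: "\<forall>x\<in>closure \<Omega>. r x > 0"
  proof
    fix x assume "x \<in> closure \<Omega>"
    then show "r x > 0"
      using split[of x] r1[of x] ch0[of x] disj[of x] unfolding r_def graph_chart_def by auto
  qed
  obtain F and \<theta> :: "real ^ 'n \<Rightarrow> real ^ 'n \<Rightarrow> real" and \<theta>' where F: "finite F" "F \<subseteq> closure \<Omega>"
    and th: "\<And>a. a \<in> F \<Longrightarrow> C2_upto \<Omega> (\<theta> a) (\<theta>' a)"
      "\<And>a x. a \<in> F \<Longrightarrow> x \<in> closure \<Omega> \<Longrightarrow> \<theta> a x \<ge> 0"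
      "\<And>a x. a \<in> F \<Longrightarrow> x \<in> closure \<Omega> \<Longrightarrow> x \<notin> ball a (r a) \<Longrightarrow> \<theta> a x = 0"
      "\<And>a x h. a \<in> F \<Longrightarrow> x \<in> closure \<Omega> \<Longrightarrow> x \<notin> ball a (r a) \<Longrightarrow> \<theta>' a x h = 0"
    and one: "\<And>x. x \<in> closure \<Omega> \<Longrightarrow> (\<Sum>a\<in>F. \<theta> a x) = 1"
  proof -
    from C2_partition_of_unity[where r=r, OF assms(1,2) rpos] obtain F and \<theta> :: "real ^ 'n \<Rightarrow> real ^ 'n \<Rightarrow> real" and \<theta>' where pu: "finite F" "F \<subseteq> closure \<Omega>"
      "\<forall>a\<in>F. C2_upto \<Omega> (\<theta> a) (\<theta>' a) \<and>
       (\<forall>x\<in>closure \<Omega>. \<theta> a x \<ge> 0 \<and> (x \<notin> ball a (r a) \<longrightarrow> \<theta> a x = 0 \<and> (\<forall>h. \<theta>' a x h = 0)))"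
      "\<forall>x\<in>closure \<Omega>. (\<Sum>a\<in>F. \<theta> a x) = 1"
      by (elim exE conjE)
    show thesis by (rule that[of F \<theta> \<theta>']) (use pu in blast)+
  qed
  define J where "J = F \<inter> frontier \<Omega>"
  have J: "finite J" "J \<subseteq> F" using F by (auto simp: J_def)
  have ch: "graph_chart 3 \<Omega> a (r a) (e a) (\<gamma> a)" if "a \<in> J" for a
    using ch0[of a] disj[of a] that by (simp add: r_def J_def)
  have sumJ: "(\<Sum>a\<in>J. \<theta> a x) = 1" if "x \<in> frontier \<Omega>" for x
  proof -
    have "\<theta> a x = 0" if "a \<in> F - J" for a
    proof -
      have "a \<in> \<Omega>" using that F split[of a] by (auto simp: J_def)
      then have "x \<notin> ball a (r a)" using r1[of a] disj[OF \<open>x \<in> frontier \<Omega>\<close>] by (auto simp: r_def)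
      then show ?thesis using th(3) that fcl[OF \<open>x \<in> frontier \<Omega>\<close>] by auto
    qed
    then have "(\<Sum>a\<in>J. \<theta> a x) = (\<Sum>a\<in>F. \<theta> a x)" using F J by (intro sum.mono_neutral_left) auto
    then show ?thesis using one[OF fcl[OF that]] by simp
  qed
  define g where "g a x = grad (\<gamma> a) x - e a" for a x
  have cint: "chart \<Omega> a (r a) (e a) (\<gamma> a)" if "a \<in> J" for a
    using graph_chart_mono[OF ch[OF that]] assms(1) by unfold_locales auto
  have g1: "norm (g a x) \<ge> 1" if "a \<in> J" for a x
  proof -
    interpret chart \<Omega> a "r a" "e a" "\<gamma> a" by (rule cint[OF that])
    have "g a x \<bullet> (- e a) = 1" using grad_vertical[of x] e_e by (simp add: g_def inner_diff_left)
    then show ?thesis using norm_cauchy_schwarz[of "g a x" "- e a"] norm_e by simp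
  qed
  have smooth: "C_class 3 UNIV UNIV (\<gamma> a)" if "a \<in> J" for a
    using ch[OF that] by (simp add: graph_chart_def)
  have "\<exists>n'. C2_upto \<Omega> (\<lambda>x. sgn (g a x)) n'" if a: "a \<in> J" for a
  proof -
    obtain g' where "C2_upto \<Omega> (\<lambda>x. g a x) g'"
      unfolding g_def using C2_upto_chart(2)[OF assms(1,2) smooth[OF a]] by blast
    then show ?thesis by (rule C2_upto_sgn[OF assms(1)]) (use g1 a in auto)
  qed
  then obtain n' where n': "\<And>a. a \<in> J \<Longrightarrow> C2_upto \<Omega> (\<lambda>x. sgn (g a x)) (n' a)" by metis
  have normal: "sgn (g a x) = \<nu> x" if a: "a \<in> J" and x: "x \<in> frontier \<Omega>" "x \<in> ball a (r a)" for a x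
    unfolding g_def
    by (rule outward_unit_normal_chart[symmetric, OF assms(1) _ x(1) graph_chart_recenter[OF ch[OF a] x(2)]])
      (use nu x in auto)
  define N where "N x = (\<Sum>a\<in>J. \<theta> a x *\<^sub>R sgn (g a x))" for x
  define N' where "N' x h = (\<Sum>a\<in>J. \<theta> a x *\<^sub>R n' a x h + \<theta>' a x h *\<^sub>R sgn (g a x))" for x h
  define \<zeta> where "\<zeta> x = (\<Sum>a\<in>J. \<theta> a x * (x \<bullet> e a - \<gamma> a x))" for x
  define \<zeta>' where "\<zeta>' x h = (\<Sum>a\<in>J. \<theta> a x * ((e a - grad (\<gamma> a) x) \<bullet> h) + \<theta>' a x h * (x \<bullet> e a - \<gamma> a x))" for x h
  have "C2_upto \<Omega> N N'" unfolding N_def N'_def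
    by (intro C2_upto_sum J C2_upto_bilinear[OF bounded_bilinear_scaleR] assms(1) n' th(1)) (use J in auto)
  moreover have "C2_upto \<Omega> \<zeta> \<zeta>'" unfolding \<zeta>_def \<zeta>'_def
    by (intro C2_upto_sum J C2_upto_bilinear[OF bounded_bilinear_mult] assms(1,2) C2_upto_chart smooth th(1)) (use J in auto)
  moreover have "N x = \<nu> x \<and> \<zeta> x = 0 \<and> (\<exists>m\<ge>1. \<forall>h. \<zeta>' x h = - m * (\<nu> x \<bullet> h))" if x: "x \<in> frontier \<Omega>" for x
  proof -
    have out: "\<theta> a x = 0" "\<theta>' a x h = 0" if "a \<in> J" "x \<notin> ball a (r a)" for a h
      using th(3,4) that J fcl[OF x] by blast+
    have lev: "x \<bullet> e a - \<gamma> a x = 0" if "a \<in> J" "x \<in> ball a (r a)" for a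
      using chart.frontier_eq[OF cint[OF that(1)] x that(2)] by simp
    have "N x = (\<Sum>a\<in>J. \<theta> a x *\<^sub>R \<nu> x)"
      unfolding N_def by (rule sum.cong) (use out normal x in force)+
    also have "\<dots> = \<nu> x" using sumJ[OF x] by (simp flip: scaleR_sum_left)
    finally have 1: "N x = \<nu> x" .
    have 2: "\<zeta> x = 0" unfolding \<zeta>_def by (rule sum.neutral) (use out lev in force)
    define m where "m = (\<Sum>a\<in>J. \<theta> a x * norm (g a x))"
    have "(\<Sum>a\<in>J. \<theta> a x * 1) \<le> m"
      unfolding m_def by (intro sum_mono mult_left_mono g1 th(2) fcl x) (use J in auto)
    then have m1: "m \<ge> 1" using sumJ[OF x] by simp
    have "\<zeta>' x h = - m * (\<nu> x \<bullet> h)" for h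
    proof -
      have "\<theta> a x * ((e a - grad (\<gamma> a) x) \<bullet> h) + \<theta>' a x h * (x \<bullet> e a - \<gamma> a x)
        = - (\<theta> a x * norm (g a x) * (\<nu> x \<bullet> h))" if a: "a \<in> J" for a
      proof (cases "x \<in> ball a (r a)")
        case True
        have "norm (g a x) *\<^sub>R \<nu> x = g a x"
        proof -
          have "norm (g a x) \<noteq> 0" using g1[OF a, of x] by linarith
          then show ?thesis unfolding normal[OF a x True, symmetric] by (simp add: sgn_div_norm)
        qed
        then have "g a x \<bullet> h = norm (g a x) * (\<nu> x \<bullet> h)" by (metis inner_scaleR_left)
        then show ?thesis using lev[OF a True] by (simp add: g_def inner_diff_left algebra_simps)
      next
        case False
        then show ?thesis using out[OF a False] by simp
      qed
      then have "\<zeta>' x h = (\<Sum>a\<in>J. - (\<theta> a x * norm (g a x) * (\<nu> x \<bullet> h)))"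
        unfolding \<zeta>'_def by (rule sum.cong[OF refl])
      then show ?thesis by (simp add: m_def sum_negf sum_distrib_right)
    qed
    then show ?thesis using 1 2 m1 by blast
  qed
  ultimately show ?thesis by (intro exI[of _ N] exI[of _ N'] exI[of _ \<zeta>] exI[of _ \<zeta>']) blast
qed

section \<open>Derivatives of the solution and of the coefficients\<close>

lemma has_derivative_vec_lambda:
  fixes f :: "'n::finite \<Rightarrow> 'a::real_normed_vector \<Rightarrow> real"
  assumes "\<And>i. (f i has_derivative f' i) (at x within A)"
  shows "((\<lambda>y. \<chi> i. f i y) has_derivative (\<lambda>h. \<chi> i. f' i h)) (at x within A)"
  by (subst has_derivative_componentwise_within) (use assms in \<open>auto simp: Basis_vec_def inner_axis\<close>)

lemma dir_deriv_cong_open: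
  fixes f g :: "'a::real_normed_vector \<Rightarrow> real"
  assumes "open Q" "x \<in> Q" "\<And>y. y \<in> Q \<Longrightarrow> f y = g y"
  shows "dir_deriv b f x = dir_deriv b g x"
  unfolding dir_deriv_def
proof (rule deriv_cong_ev[OF _ refl])
  have "open ((\<lambda>s::real. x + s *\<^sub>R b) -` Q)"
    by (rule open_vimage[OF assms(1)]) (intro continuous_intros)
  then have "\<forall>\<^sub>F s in nhds 0. x + s *\<^sub>R b \<in> Q"
    unfolding eventually_nhds using assms(2) by (intro exI[of _ "(\<lambda>s::real. x + s *\<^sub>R b) -` Q"]) auto
  then show "\<forall>\<^sub>F s in nhds 0. f (x + s *\<^sub>R b) = g (x + s *\<^sub>R b)"
    by (rule eventually_mono) (rule assms(3))
qed

lemma weighted_C_commute: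
  fixes u :: "'a::euclidean_space \<Rightarrow> real"
  assumes "weighted_C w k Q S u" "open Q" "Q \<subseteq> S"
    "set (a # b # bs) \<subseteq> Basis" "w a + w b + sum_list (map w bs) \<le> k" "x \<in> Q"
  shows "iter_deriv (a # b # bs) u x = iter_deriv (b # a # bs) u x"
  by (rule mixed_partials_commute[OF assms(2,6), where g="iter_deriv bs u" and a=a and b=b
        and ga="iter_deriv (a # bs) u" and gb="iter_deriv (b # bs) u"])
    (rule weighted_C_partial[OF assms(1)] weighted_C_continuous[OF assms(1)]; use assms(3-5) in auto)+

text \<open>
  The spatial Hessian as an operator, so that \<open>hess_x u p h\<close> is the derivative of the spatial gradient in
  direction \<open>h\<close>; \<open>third_x\<close> and \<open>grad_t\<close> are its derivative in space and the time derivative of the gradient.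
\<close>

definition hess_x :: "((real ^ 'n) \<times> real \<Rightarrow> real) \<Rightarrow> (real ^ 'n) \<times> real \<Rightarrow> real ^ 'n \<Rightarrow> real ^ 'n" where
  "hess_x u p h = (\<chi> i. \<Sum>j\<in>UNIV. h $ j * iter_deriv [(axis j 1, 0), (axis i 1, 0)] u p)"

definition third_x :: "((real ^ 'n) \<times> real \<Rightarrow> real) \<Rightarrow> (real ^ 'n) \<times> real \<Rightarrow> real ^ 'n \<Rightarrow> real ^ 'n \<Rightarrow> real ^ 'n" where
  "third_x u p h k = (\<chi> i. \<Sum>j\<in>UNIV. h $ j *
     (\<Sum>l\<in>UNIV. k $ l * iter_deriv [(axis l 1, 0), (axis j 1, 0), (axis i 1, 0)] u p))"

definition grad_t :: "((real ^ 'n) \<times> real \<Rightarrow> real) \<Rightarrow> (real ^ 'n) \<times> real \<Rightarrow> real ^ 'n" where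
  "grad_t u p = (\<chi> i. iter_deriv [(0, 1), (axis i 1, 0)] u p)"

lemma axis_in_Basis_prod [simp]:
  "(axis i 1, 0) \<in> (Basis :: ((real ^ 'n) \<times> real) set)" "(0, 1) \<in> (Basis :: ((real ^ 'n) \<times> real) set)"
  by (auto simp: Basis_prod_def Basis_vec_def)

lemma parabolic_weight_simps [simp]: "parabolic_weight (b, 0) = 1" "parabolic_weight (0, 1) = 2"
  by (simp_all add: parabolic_weight_def)

text \<open>
  At fixed time only the spatial derivatives are used, each of which costs weight one.
\<close>

lemma weighted_C_slice:
  fixes u :: "(real ^ 'n) \<times> real \<Rightarrow> real"
  assumes w: "weighted_C w k (\<Omega> \<times> J) S u" "open \<Omega>" "\<Omega> \<times> J \<subseteq> S"
    and w1: "\<And>b. w (b, 0) = 1"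
    and "set bs \<subseteq> Basis" "sum_list (map w bs) < k" "x \<in> \<Omega>" "t \<in> J"
  shows "((\<lambda>y. iter_deriv bs u (y, t)) has_derivative
    (\<lambda>h. \<Sum>i\<in>UNIV. h $ i * iter_deriv ((axis i 1, 0) # bs) u (x, t))) (at x)"
proof -
  have "((\<lambda>y. iter_deriv bs u (y, t)) has_derivative
    (\<lambda>h. \<Sum>b\<in>Basis. (h \<bullet> b) * iter_deriv ((b, 0) # bs) u (x, t))) (at x)"
  proof (rule has_derivative_of_continuous_partials[OF assms(2) \<open>x \<in> \<Omega>\<close>])
    fix b y :: "real ^ 'n" assume b: "b \<in> Basis"
    then have bb: "(b, 0::real) \<in> Basis" by (simp add: Basis_prod_def)
    show "((\<lambda>s. iter_deriv bs u (y + s *\<^sub>R b, t)) has_real_derivative iter_deriv ((b, 0) # bs) u (y, t)) (at 0)"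
      if "y \<in> \<Omega>"
      using weighted_C_partial[OF w(1), of "(b, 0)" bs "(y, t)"] bb w1 that assms by simp
    have "continuous_on (\<Omega> \<times> J) (iter_deriv ((b, 0) # bs) u)"
      by (rule weighted_C_continuous[OF w(1) _ _ assms(3)]) (use bb w1 assms in auto)
    then show "continuous_on \<Omega> (\<lambda>y. iter_deriv ((b, 0) # bs) u (y, t))"
      by (rule continuous_on_compose2) (use assms in \<open>auto intro!: continuous_intros\<close>)
  qed
  then show ?thesis by (simp add: sum_axis_Basis inner_axis)
qed

lemma iter_deriv_single: "iter_deriv [b] u p = dir_deriv b u p"
  by (simp add: iter_deriv_def)

lemma hess_x_symmetric:
  assumes "\<And>i j. iter_deriv [(axis j 1, 0), (axis i 1, 0)] u p = iter_deriv [(axis i 1, 0), (axis j 1, 0)] u p"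
  shows "hess_x u p h \<bullet> k = hess_x u p k \<bullet> h"
proof -
  have e: "hess_x u p h \<bullet> k = (\<Sum>i\<in>UNIV. \<Sum>j\<in>UNIV. h $ j * k $ i * iter_deriv [(axis j 1, 0), (axis i 1, 0)] u p)"
    for h k by (simp add: hess_x_def inner_vec_def sum_distrib_left sum_distrib_right mult_ac)
  show ?thesis unfolding e[of h k] e[of k h]
    by (subst sum.swap) (use assms in \<open>simp add: mult_ac\<close>)
qed

locale smooth_interior =
  fixes \<Omega> :: "(real ^ 'n) set" and T :: real and S and u :: "(real ^ 'n) \<times> real \<Rightarrow> real"
  assumes open_domain: "open \<Omega>" and subset: "\<Omega> \<times> {0<..<T} \<subseteq> S"
    and C3: "weighted_C parabolic_weight 3 (\<Omega> \<times> {0<..<T}) S u"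
begin

lemma open_cylinder: "open (\<Omega> \<times> {0<..<T})" using open_domain by (simp add: open_Times)

lemmas slice = weighted_C_slice[OF C3 open_domain subset parabolic_weight_simps(1)]

lemmas commute = weighted_C_commute[OF C3 open_cylinder subset]

lemma grad_derivative:
  "x \<in> \<Omega> \<Longrightarrow> t \<in> {0<..<T} \<Longrightarrow> ((\<lambda>y. u (y, t)) has_derivative (\<lambda>h. grad_x u (x, t) \<bullet> h)) (at x)"
  using slice[of "[]" x t] by (simp add: iter_deriv_def grad_x_def inner_vec_sum)

lemma hess_derivative:
  "x \<in> \<Omega> \<Longrightarrow> t \<in> {0<..<T} \<Longrightarrow> ((\<lambda>y. grad_x u (y, t)) has_derivative hess_x u (x, t)) (at x)"
  unfolding grad_x_def hess_x_def iter_deriv_single[symmetric]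
  by (intro has_derivative_vec_lambda slice) auto

lemma third_derivative:
  "x \<in> \<Omega> \<Longrightarrow> t \<in> {0<..<T} \<Longrightarrow> ((\<lambda>y. hess_x u (y, t) h) has_derivative third_x u (x, t) h) (at x)"
  unfolding hess_x_def third_x_def
  by (intro has_derivative_vec_lambda has_derivative_sum has_derivative_mult_right slice) auto

lemma time_derivative_of_grad:
  assumes "x \<in> \<Omega>" "t \<in> {0<..<T}"
  shows "((\<lambda>s. grad_x u (x, s)) has_vector_derivative grad_t u (x, t)) (at t)"
proof -
  have "((\<lambda>s. dir_deriv (axis i 1, 0) u (x, s)) has_derivative (*) (iter_deriv [(0, 1), (axis i 1, 0)] u (x, t))) (at t)" for i
  proof -
    have "((\<lambda>s. iter_deriv [(axis i 1, 0)] u (((x, 0) + t *\<^sub>R (0, 1)) + s *\<^sub>R (0, 1))) has_real_derivative iter_deriv [(0, 1), (axis i 1, 0)] u (x, t)) (at 0)"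
      using weighted_C_partial[OF C3, of "(0, 1)" "[(axis i 1, 0)]" "(x, t)"] assms by simp
    then have "((\<lambda>s. iter_deriv [(axis i 1, 0)] u ((x, 0) + s *\<^sub>R (0, 1))) has_real_derivative iter_deriv [(0, 1), (axis i 1, 0)] u (x, t)) (at t)"
      by (rule DERIV_along_line)
    then show ?thesis by (simp add: has_field_derivative_def iter_deriv_single)
  qed
  from has_derivative_vec_lambda[OF this] show ?thesis
    unfolding has_vector_derivative_def grad_x_def grad_t_def by (simp add: scaleR_vec_def mult.commute)
qed

text \<open>
  This is where the two orders of differentiation in space and time are exchanged: the gradient of \<open>u\<^sub>t\<close>
  comes from differentiating the equation, the time derivative of the gradient from differentiating \<open>w\<close>.
\<close>

lemma space_derivative_of_dt:
  assumes "x \<in> \<Omega>" "t \<in> {0<..<T}"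
  shows "((\<lambda>y. deriv_snd u (y, t)) has_derivative (\<lambda>h. grad_t u (x, t) \<bullet> h)) (at x)"
proof -
  have "iter_deriv [(axis i 1, 0), (0, 1)] u (x, t) = iter_deriv [(0, 1), (axis i 1, 0)] u (x, t)" for i
    by (rule commute) (use assms in auto)
  then show ?thesis
    using slice[of "[(0, 1)]" x t] assms by (simp add: iter_deriv_single deriv_snd_def grad_t_def inner_vec_sum)
qed

lemma hess_commute:
  "p \<in> \<Omega> \<times> {0<..<T} \<Longrightarrow> iter_deriv [(axis j 1, 0), (axis i 1, 0)] u p = iter_deriv [(axis i 1, 0), (axis j 1, 0)] u p"
  by (rule commute) auto

lemma hess_sym:
  assumes "x \<in> \<Omega>" "t \<in> {0<..<T}"
  shows "hess_x u (x, t) h \<bullet> k = hess_x u (x, t) k \<bullet> h"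
  by (rule hess_x_symmetric, rule hess_commute) (use assms in auto)

lemma third_sym:
  assumes "x \<in> \<Omega>" "t \<in> {0<..<T}"
  shows "third_x u (x, t) h k \<bullet> l = third_x u (x, t) k h \<bullet> l"
    and "third_x u (x, t) h k \<bullet> l = third_x u (x, t) l k \<bullet> h"
proof -
  let ?d = "\<lambda>l j i. iter_deriv [(axis l 1, 0), (axis j 1, 0), (axis i 1, 0)] u (x, t)"
  have e: "third_x u (x, t) h k \<bullet> l = (\<Sum>i\<in>UNIV. \<Sum>j\<in>UNIV. \<Sum>m\<in>UNIV. l $ i * h $ j * k $ m * ?d m j i)" for h k l
    by (simp add: third_x_def inner_vec_def sum_distrib_left sum_distrib_right mult_ac)
  have d1: "?d m j i = ?d j m i" for m j i by (rule commute) (use assms in auto)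
  have d2: "?d m j i = ?d m i j" for m j i
  proof -
    have "dir_deriv (axis m 1, 0) (iter_deriv [(axis j 1, 0), (axis i 1, 0)] u) (x, t)
      = dir_deriv (axis m 1, 0) (iter_deriv [(axis i 1, 0), (axis j 1, 0)] u) (x, t)"
      by (rule dir_deriv_cong_open[OF open_cylinder]) (use assms hess_commute in auto)
    then show ?thesis by (simp add: iter_deriv_def)
  qed
  show "third_x u (x, t) h k \<bullet> l = third_x u (x, t) k h \<bullet> l"
    unfolding e
    by (rule sum.cong[OF refl], subst sum.swap) (simp add: d1 mult_ac)
  show "third_x u (x, t) h k \<bullet> l = third_x u (x, t) l k \<bullet> h"
    unfolding e
    by (subst sum.swap) (intro sum.cong refl, subst d2, simp add: mult_ac)
qed

lemma third_linear: "linear (\<lambda>h. third_x u p h k)"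
  by (rule linearI) (simp_all add: third_x_def vec_eq_iff algebra_simps sum.distrib sum_distrib_left)

end

text \<open>
  The continuous extension from \<open>Q\<close> is the only candidate for the limit, as every point of the closure of
  an open set is a limit point of it.
\<close>

lemma Lim_within_open_eq:
  fixes g :: "'a::euclidean_space \<Rightarrow> 'b::t2_space"
  assumes "open Q" "continuous_on S G" "\<And>x. x \<in> Q \<Longrightarrow> G x = g x" "Q \<subseteq> S" "S \<subseteq> closure Q" "p \<in> S"
  shows "ext Q g p = G p"
proof -
  have "p islimpt Q"
    using assms interior_limit_point[of p Q] by (auto simp: closure_def interior_open)
  then have nt: "\<not> trivial_limit (at p within Q)" by (simp add: trivial_limit_within)
  have "(G \<longlongrightarrow> G p) (at p within S)" using assms(2,6) by (simp add: continuous_on_def)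
  then have "(G \<longlongrightarrow> G p) (at p within Q)" by (rule tendsto_within_subset[OF _ assms(4)])
  then have "(g \<longlongrightarrow> G p) (at p within Q)"
    by (rule Lim_transform_eventually) (auto simp: eventually_at_filter assms(3))
  then show ?thesis unfolding ext_def by (rule tendsto_Lim[OF nt])
qed

lemma sum_Basis_prod:
  fixes g :: "'a::euclidean_space \<times> real \<Rightarrow> 'b::comm_monoid_add"
  shows "(\<Sum>b\<in>Basis. g b) = (\<Sum>b\<in>Basis. g (b, 0)) + g (0, 1)"
proof -
  have B: "(Basis :: ('a \<times> real) set) = insert (0, 1) ((\<lambda>b. (b, 0)) ` Basis)" by (simp add: Basis_prod_def)
  have I: "inj_on (\<lambda>b::'a. (b, 0::real)) Basis" by (simp add: inj_on_def)
  have "(0, 1) \<notin> (\<lambda>b::'a. (b, 0::real)) ` Basis" by auto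
  then have "(\<Sum>b\<in>insert (0, 1) ((\<lambda>b. (b, 0)) ` Basis). g b) = g (0, 1) + (\<Sum>b\<in>((\<lambda>b. (b, 0)) ` Basis). g b)"
    by (intro sum.insert) auto
  then show ?thesis unfolding B sum.reindex[OF I] by (simp add: o_def add.commute)
qed

lemma first_order_coefficient:
  fixes c :: "(real ^ 'n) \<times> real \<Rightarrow> real"
  assumes c: "C_class 1 (\<Omega> \<times> UNIV) (closure \<Omega> \<times> UNIV) c" and "open \<Omega>" "x \<in> \<Omega>"
  shows "(c has_derivative (\<lambda>h. grad_x c (x, z) \<bullet> fst h + deriv_snd c (x, z) * snd h)) (at (x, z))"
    and "ext (\<Omega> \<times> UNIV) (grad_x c) (x, z) = grad_x c (x, z)"
    and "ext (\<Omega> \<times> UNIV) (deriv_snd c) (x, z) = deriv_snd c (x, z)"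
proof -
  have Q: "open (\<Omega> \<times> (UNIV :: real set))" using assms(2) by (simp add: open_Times)
  have sub: "\<Omega> \<times> (UNIV :: real set) \<subseteq> closure \<Omega> \<times> UNIV" using closure_subset by blast
  have cont: "continuous_on (\<Omega> \<times> UNIV) (\<lambda>p. dir_deriv b c p)" if "b \<in> Basis" for b
    using C_class_continuous[OF c sub, of "[b]"] that by (simp add: iter_deriv_def)
  have "(c has_derivative (\<lambda>h. \<Sum>b\<in>Basis. (h \<bullet> b) * dir_deriv b c (x, z))) (at (x, z))"
    using C_class_has_derivative[OF c Q sub, of "[]" "(x, z)"] assms by (simp add: iter_deriv_def)
  moreover have "(\<Sum>b\<in>Basis. (h \<bullet> b) * dir_deriv b c (x, z)) = grad_x c (x, z) \<bullet> fst h + deriv_snd c (x, z) * snd h" for h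
    by (cases h) (simp add: sum_Basis_prod sum_axis_Basis inner_axis grad_x_def deriv_snd_def inner_vec_sum mult.commute)
  ultimately show "(c has_derivative (\<lambda>h. grad_x c (x, z) \<bullet> fst h + deriv_snd c (x, z) * snd h)) (at (x, z))"
    by simp
  have "continuous_on (\<Omega> \<times> UNIV) (grad_x c)"
    unfolding grad_x_def by (intro continuous_intros cont) auto
  then show "ext (\<Omega> \<times> UNIV) (grad_x c) (x, z) = grad_x c (x, z)"
    by (intro Lim_within_open_eq[OF Q, where S="\<Omega> \<times> UNIV"]) (use assms closure_subset[of "\<Omega> \<times> UNIV"] in auto)
  have "continuous_on (\<Omega> \<times> UNIV) (deriv_snd c)"
    unfolding deriv_snd_def by (intro cont) auto
  then show "ext (\<Omega> \<times> UNIV) (deriv_snd c) (x, z) = deriv_snd c (x, z)"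
    by (intro Lim_within_open_eq[OF Q, where S="\<Omega> \<times> UNIV"]) (use assms closure_subset[of "\<Omega> \<times> UNIV"] in auto)
qed

lemma closed_cylinder: "0 < T \<Longrightarrow> closure (\<Omega> \<times> {0<..<T::real}) = closure \<Omega> \<times> {0..T}"
  by (simp add: closure_Times)

text \<open>
  At boundary points the gradient is the extension \<open>G\<close>. It is differentiable within the closure, and the
  symmetry of its derivative passes to the boundary by continuity.
\<close>

lemma extended_gradient:
  fixes u :: "(real ^ 'n) \<times> real \<Rightarrow> real"
  assumes "open \<Omega>" "0 < T" and charts: "\<And>x. x \<in> frontier \<Omega> \<Longrightarrow> \<exists>r e \<gamma>. graph_chart 1 \<Omega> x r e \<gamma>"
    and w: "weighted_C parabolic_weight 2 (\<Omega> \<times> {0<..<T}) (closure \<Omega> \<times> {0..T}) u"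
  defines "G \<equiv> ext (\<Omega> \<times> {0<..<T}) (grad_x u)"
  shows "continuous_on (closure \<Omega> \<times> {0..T}) G"
    and "\<And>p. p \<in> \<Omega> \<times> {0<..<T} \<Longrightarrow> G p = grad_x u p"
    and "\<exists>U. (\<forall>t\<in>{0<..<T}. \<forall>x\<in>closure \<Omega>. ((\<lambda>y. G (y, t)) has_derivative U (x, t)) (at x within closure \<Omega>) \<and>
      (\<forall>h k. U (x, t) h \<bullet> k = U (x, t) k \<bullet> h))"
proof -
  let ?Q = "\<Omega> \<times> {0<..<T}" and ?S = "closure \<Omega> \<times> {0..T}"
  have Q: "open ?Q" using assms(1) by (simp add: open_Times)
  have cl: "closure ?Q = ?S" by (rule closed_cylinder[OF assms(2)])
  have sub: "?Q \<subseteq> ?S" using closure_subset cl by metis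
  have "\<exists>g. continuous_on ?S g \<and> (\<forall>p\<in>?Q. g p = iter_deriv bs u p)"
    if "set bs \<subseteq> Basis" "sum_list (map parabolic_weight bs) \<le> 2" for bs
    using w that unfolding weighted_C_def by meson
  then obtain g where g: "\<And>bs. set bs \<subseteq> Basis \<Longrightarrow> sum_list (map parabolic_weight bs) \<le> 2 \<Longrightarrow> continuous_on ?S (g bs)"
    "\<And>bs p. set bs \<subseteq> Basis \<Longrightarrow> sum_list (map parabolic_weight bs) \<le> 2 \<Longrightarrow> p \<in> ?Q \<Longrightarrow> g bs p = iter_deriv bs u p"
    by metis
  define G' where "G' p = (\<chi> i. g [(axis i 1, 0)] p)" for p
  have G'c: "continuous_on ?S G'" unfolding G'_def by (intro continuous_intros g(1)) auto
  have G'Q: "G' p = grad_x u p" if "p \<in> ?Q" for p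
  proof -
    have "g [(axis i 1, 0)] p = dir_deriv (axis i 1, 0) u p" for i
      using g(2)[of "[(axis i 1, 0)]" p] that by (simp add: iter_deriv_single)
    then show ?thesis by (simp add: G'_def grad_x_def)
  qed
  have GG: "G p = G' p" if "p \<in> ?S" for p
    unfolding G_def by (rule Lim_within_open_eq[OF Q G'c G'Q sub _ that]) (simp_all add: cl)
  show Gc: "continuous_on ?S G" using G'c GG by (metis continuous_on_cong)
  show GQ: "G p = grad_x u p" if "p \<in> ?Q" for p using GG G'Q that sub by auto
  define H where "H b p = (\<chi> i. g [(b, 0), (axis i 1, 0)] p)" for b p
  have Hc: "continuous_on ?S (H b)" if "b \<in> Basis" for b
    unfolding H_def using that by (intro continuous_intros g(1)) (auto simp: Basis_prod_def)
  define U where "U p h = (\<Sum>b\<in>Basis. (h \<bullet> b) *\<^sub>R H b p)" for p h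
  have UQ: "U p h = hess_x u p h" if "p \<in> ?Q" for p h
  proof -
    have "g [(b, 0), (axis i 1, 0)] p = iter_deriv [(b, 0), (axis i 1, 0)] u p" if "b \<in> Basis" for i b
      by (rule g(2)) (use that \<open>p \<in> ?Q\<close> in \<open>auto simp: Basis_prod_def\<close>)
    moreover have "axis j 1 \<in> (Basis :: (real^'n) set)" for j
      by (auto simp: Basis_vec_def intro!: exI[of _ j])
    ultimately show ?thesis
      by (simp add: U_def H_def hess_x_def sum_axis_Basis inner_axis vec_eq_iff)
  qed
  have "((\<lambda>y. G (y, t)) has_derivative U (x, t)) (at x within closure \<Omega>)"
    if t: "t \<in> {0<..<T}" and x: "x \<in> closure \<Omega>" for x t
    unfolding U_def
  proof (rule derivative_up_to_closure[OF assms(1) charts _ _ _ x])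
    have im: "(\<lambda>y. (y, t)) ` closure \<Omega> \<subseteq> ?S" using t by auto
    show "continuous_on (closure \<Omega>) (\<lambda>y. G (y, t))"
      by (rule continuous_on_compose2[OF Gc _ im]) (intro continuous_intros)
    show "continuous_on (closure \<Omega>) (\<lambda>y. H b (y, t))" if "b \<in> Basis" for b
      by (rule continuous_on_compose2[OF Hc[OF that] _ im]) (intro continuous_intros)
    fix y assume y: "y \<in> \<Omega>"
    have "((\<lambda>y. grad_x u (y, t)) has_derivative hess_x u (y, t)) (at y)"
      unfolding grad_x_def hess_x_def iter_deriv_single[symmetric]
      by (intro has_derivative_vec_lambda weighted_C_slice[OF w assms(1) sub]) (use y t in auto)
    then have "((\<lambda>y. grad_x u (y, t)) has_derivative U (y, t)) (at y)"
    proof -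
      have "U (y, t) = hess_x u (y, t)" using UQ[of "(y, t)"] y t by (simp add: fun_eq_iff)
      then show ?thesis using \<open>((\<lambda>y. grad_x u (y, t)) has_derivative hess_x u (y, t)) (at y)\<close> by simp
    qed
    then show "((\<lambda>y. G (y, t)) has_derivative (\<lambda>h. \<Sum>b\<in>Basis. (h \<bullet> b) *\<^sub>R H b (y, t))) (at y)"
      unfolding U_def[symmetric]
      by (rule has_derivative_transform_within_open[OF _ assms(1) y]) (use GQ t in auto)
  qed
  moreover have "U p h \<bullet> k = U p k \<bullet> h" if pS: "p \<in> ?S" for p h k
  proof -
    have "continuous_on (closure ?Q) (\<lambda>p. U p h \<bullet> k - U p k \<bullet> h)"
      unfolding U_def cl by (intro continuous_intros Hc)
    moreover have "U q h \<bullet> k - U q k \<bullet> h = 0" if "q \<in> ?Q" for q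
    proof -
      have "hess_x u q h \<bullet> k = hess_x u q k \<bullet> h"
        by (rule hess_x_symmetric, rule weighted_C_commute[OF w Q sub]) (use that in auto)
      then show ?thesis using UQ[OF that] by simp
    qed
    ultimately have "U p h \<bullet> k - U p k \<bullet> h = 0"
      by (rule continuous_constant_on_closure) (assumption, unfold cl, rule pS)
    then show ?thesis by simp
  qed
  ultimately show "\<exists>U. (\<forall>t\<in>{0<..<T}. \<forall>x\<in>closure \<Omega>. ((\<lambda>y. G (y, t)) has_derivative U (x, t)) (at x within closure \<Omega>) \<and>
      (\<forall>h k. U (x, t) h \<bullet> k = U (x, t) k \<bullet> h))"
    by (intro exI[of _ U]) auto
qed

text \<open>
  The increments of \<open>u\<close> along a segment at a small positive time are close to those predicted by
  \<open>G (x, 0)\<close>, uniformly in time; letting the time tend to zero identifies \<open>G (x, 0)\<close> as the gradient of the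
  initial values.
\<close>

lemma initial_gradient:
  fixes u :: "(real ^ 'n) \<times> real \<Rightarrow> real"
  assumes "open \<Omega>" "0 < T"
    and uc: "continuous_on (closure \<Omega> \<times> {0..T}) u"
    and Gc: "continuous_on (closure \<Omega> \<times> {0..T}) G"
    and der: "\<And>x t. x \<in> \<Omega> \<Longrightarrow> t \<in> {0<..<T} \<Longrightarrow> ((\<lambda>y. u (y, t)) has_derivative (\<lambda>h. G (x, t) \<bullet> h)) (at x)"
    and x: "x \<in> \<Omega>"
  shows "((\<lambda>y. u (y, 0)) has_derivative (\<lambda>h. G (x, 0) \<bullet> h)) (at x)"
  unfolding has_derivative_at_alt
proof (intro conjI bounded_linear_inner_right allI impI)
  let ?S = "closure \<Omega> \<times> {0..T}"
  have sub: "\<Omega> \<subseteq> closure \<Omega>" by (rule closure_subset)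
  fix \<epsilon> :: real assume ep: "\<epsilon> > 0"
  obtain d0 where d0: "d0 > 0" "ball x d0 \<subseteq> \<Omega>" using assms(1) x openE by blast
  have "(x, 0) \<in> ?S" using x sub assms(2) by auto
  then obtain d1 where d1: "d1 > 0" "\<And>p. p \<in> ?S \<Longrightarrow> dist p (x, 0) < d1 \<Longrightarrow> dist (G p) (G (x, 0)) < \<epsilon>"
    using Gc ep unfolding continuous_on_iff by meson
  define \<delta> where "\<delta> = min d0 (d1 / 2)"
  have dl: "\<delta> > 0" using d0 d1 by (simp add: \<delta>_def)
  have "norm (u (y, 0) - u (x, 0) - G (x, 0) \<bullet> (y - x)) \<le> \<epsilon> * norm (y - x)" if y: "norm (y - x) < \<delta>" for y
  proof -
    have ball: "z \<in> \<Omega>" if "z \<in> ball x \<delta>" for z using d0 that by (auto simp: \<delta>_def)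
    have yb: "y \<in> ball x \<delta>" using y by (simp add: dist_norm norm_minus_commute)
    have seg: "closed_segment x y \<subseteq> ball x \<delta>"
      using yb dl by (simp add: closed_segment_subset)
    have ev: "norm (u (y, t) - u (x, t) - G (x, 0) \<bullet> (y - x)) \<le> \<epsilon> * norm (y - x)"
      if t: "0 < t" "t < min T (d1 / 2)" for t
    proof (rule segment_increment_bound[where f="\<lambda>y. u (y, t)" and F="\<lambda>z h. G (z, t) \<bullet> h"])
      have "closed_segment x y \<subseteq> \<Omega>" using seg ball by blast
      then show "continuous_on (closed_segment x y) (\<lambda>y. u (y, t))"
        using sub t by (intro continuous_on_compose2[OF uc]) (auto intro!: continuous_intros)
      fix z assume "z \<in> open_segment x y"
      then have z: "z \<in> ball x \<delta>" using seg segment_open_subset_closed by blast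
      then show "((\<lambda>y. u (y, t)) has_derivative (\<lambda>h. G (z, t) \<bullet> h)) (at z)"
        using der ball t by auto
      fix h :: "real ^ 'n"
      have "dist (z, t) (x, 0) \<le> dist z x + dist t 0" by (simp add: dist_Pair_Pair sqrt_sum_squares_le_sum_abs[of "dist z x" t, simplified])
      also have "\<dots> < d1" using z t by (auto simp: \<delta>_def dist_commute)
      finally have "dist (G (z, t)) (G (x, 0)) < \<epsilon>"
        using d1(2)[of "(z, t)"] ball[OF z] sub t by auto
      then have "norm (G (z, t) - G (x, 0)) * norm h \<le> \<epsilon> * norm h"
        by (intro mult_right_mono) (auto simp: dist_norm)
      then show "norm (G (z, t) \<bullet> h - G (x, 0) \<bullet> h) \<le> \<epsilon> * norm h"
        unfolding inner_diff_left[symmetric] using Cauchy_Schwarz_ineq2[of "G (z, t) - G (x, 0)" h] by simp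
    qed (rule bounded_linear_inner_right)
    have lim: "((\<lambda>t. u (z, t)) \<longlongrightarrow> u (z, 0)) (at_right 0)" if "z \<in> \<Omega>" for z
    proof -
      have "continuous_on {0..T} (\<lambda>t. u (z, t))"
        using that sub by (intro continuous_on_compose2[OF uc]) (auto intro!: continuous_intros)
      then have "((\<lambda>t. u (z, t)) \<longlongrightarrow> u (z, 0)) (at 0 within {0..T})"
        using assms(2) by (simp add: continuous_on_def)
      then show ?thesis using at_within_Icc_at_right[OF assms(2)] by simp
    qed
    have "((\<lambda>t. norm (u (y, t) - u (x, t) - G (x, 0) \<bullet> (y - x))) \<longlongrightarrow> norm (u (y, 0) - u (x, 0) - G (x, 0) \<bullet> (y - x))) (at_right 0)"
      by (intro tendsto_intros lim x ball yb)
    moreover have "\<forall>\<^sub>F t in at_right 0. norm (u (y, t) - u (x, t) - G (x, 0) \<bullet> (y - x)) \<le> \<epsilon> * norm (y - x)"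
      unfolding eventually_at_right_field using ev assms(2) d1 by (intro exI[of _ "min T (d1 / 2)"]) auto
    ultimately show ?thesis by (rule tendsto_upperbound) simp
  qed
  then show "\<exists>d>0. \<forall>y. norm (y - x) < d \<longrightarrow> norm (u (y, 0) - u (x, 0) - G (x, 0) \<bullet> (y - x)) \<le> \<epsilon> * norm (y - x)"
    using dl by blast
qed

section \<open>Algebra of the mean curvature operator\<close>

lemma sum_scaled_axis: "(\<Sum>m\<in>UNIV. (a $ m) *\<^sub>R axis m 1) = (a :: real ^ 'n)"
  using basis_expansion[of a] by (simp add: scalar_mult_eq_scaleR)

text \<open>
  The vectors \<open>\<xi> m\<close> are the columns of the square root \<open>I - \<theta> a a\<^sup>T\<close> of \<open>I - a a\<^sup>T\<close>, where \<open>\<theta>\<close> solves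
  \<open>\<theta>\<^sup>2 |a|\<^sup>2 = 2 \<theta> - 1\<close>. With \<open>a = Du / v\<close> they turn the mean curvature operator into a sum of pure second
  derivatives, so the second derivative test along lines suffices, and all quadratic terms become sums
  over \<open>m\<close> of expressions in \<open>D\<^sup>2u \<xi> m\<close>.
\<close>

lemma square_root_frame:
  fixes a :: "real ^ 'n"
  assumes "norm a \<le> 1"
  obtains \<xi> :: "'n \<Rightarrow> real ^ 'n" where "\<And>m. norm (\<xi> m) \<le> 1"
    "\<And>\<beta> :: real ^ 'n \<Rightarrow> real ^ 'n \<Rightarrow> real. bilinear \<beta> \<Longrightarrow>
       (\<Sum>m\<in>UNIV. \<beta> (\<xi> m) (\<xi> m)) = (\<Sum>m\<in>UNIV. \<beta> (axis m 1) (axis m 1)) - \<beta> a a"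
proof -
  define s where "s = sqrt (1 - (norm a)\<^sup>2)"
  have a1: "(norm a)\<^sup>2 \<le> 1" using assms by (simp add: power_le_one)
  have s: "s \<ge> 0" "(norm a)\<^sup>2 = (1 - s) * (1 + s)"
    using a1 by (simp_all add: s_def algebra_simps power2_eq_square[symmetric])
  define \<theta> where "\<theta> = 1 / (1 + s)"
  have th: "\<theta> * (1 + s) = 1" using s by (simp add: \<theta>_def)
  have key: "\<theta>\<^sup>2 * (norm a)\<^sup>2 = 2 * \<theta> - 1"
  proof -
    have "\<theta>\<^sup>2 * (norm a)\<^sup>2 = (\<theta> * (1 + s)) * (\<theta> * (1 - s))"
      unfolding s(2) by (simp add: power2_eq_square algebra_simps)
    also have "\<dots> = \<theta> * (1 - s)" using th by simp
    also have "\<dots> = 2 * \<theta> - \<theta> * (1 + s)" by (simp add: algebra_simps)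
    finally show ?thesis using th by simp
  qed
  define \<xi> :: "'n \<Rightarrow> real ^ 'n" where "\<xi> m = axis m 1 - (\<theta> * a $ m) *\<^sub>R a" for m
  show ?thesis
  proof (rule that[of \<xi>])
    fix m
    have "(norm (\<xi> m))\<^sup>2 = 1 - 2 * \<theta> * (a $ m)\<^sup>2 + (\<theta>\<^sup>2 * (norm a)\<^sup>2) * (a $ m)\<^sup>2"
      unfolding \<xi>_def power2_norm_eq_inner
      by (simp add: inner_diff_left inner_diff_right inner_axis inner_axis' power2_eq_square algebra_simps)
    also have "\<dots> = 1 - (a $ m)\<^sup>2" unfolding key by (simp add: algebra_simps)
    finally have "(norm (\<xi> m))\<^sup>2 \<le> 1\<^sup>2" by simp
    then show "norm (\<xi> m) \<le> 1" by (rule power2_le_imp_le) simp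
  next
    fix \<beta> :: "real ^ 'n \<Rightarrow> real ^ 'n \<Rightarrow> real" assume b: "bilinear \<beta>"
    have l: "(\<Sum>m\<in>UNIV. a $ m * \<beta> a (axis m 1)) = \<beta> a a"
    proof -
      have "\<beta> a (\<Sum>m\<in>UNIV. (a $ m) *\<^sub>R axis m 1) = (\<Sum>m\<in>UNIV. a $ m * \<beta> a (axis m 1))"
        using b unfolding bilinear_def by (simp add: linear_sum linear_cmul)
      then show ?thesis by (simp add: sum_scaled_axis)
    qed
    have r: "(\<Sum>m\<in>UNIV. a $ m * \<beta> (axis m 1) a) = \<beta> a a"
    proof -
      have "\<beta> (\<Sum>m\<in>UNIV. (a $ m) *\<^sub>R axis m 1) a = (\<Sum>m\<in>UNIV. a $ m * \<beta> (axis m 1) a)"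
        using b unfolding bilinear_def by (simp add: linear_sum[of "\<lambda>x. \<beta> x a"] linear_cmul[of "\<lambda>x. \<beta> x a"])
      then show ?thesis by (simp add: sum_scaled_axis)
    qed
    have sq: "(\<Sum>m\<in>UNIV. (a $ m)\<^sup>2) = (norm a)\<^sup>2"
      unfolding power2_norm_eq_inner inner_vec_def by (simp add: power2_eq_square)
    have "\<beta> (\<xi> m) (\<xi> m) = \<beta> (axis m 1) (axis m 1) - \<theta> * (a $ m * \<beta> a (axis m 1)) - \<theta> * (a $ m * \<beta> (axis m 1) a)
        + \<theta>\<^sup>2 * (a $ m)\<^sup>2 * \<beta> a a" for m
      unfolding \<xi>_def using b
      by (simp add: bilinear_lsub bilinear_rsub bilinear_lmul bilinear_rmul power2_eq_square algebra_simps)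
    then have "(\<Sum>m\<in>UNIV. \<beta> (\<xi> m) (\<xi> m)) = (\<Sum>m\<in>UNIV. \<beta> (axis m 1) (axis m 1))
        - \<theta> * (\<Sum>m\<in>UNIV. a $ m * \<beta> a (axis m 1)) - \<theta> * (\<Sum>m\<in>UNIV. a $ m * \<beta> (axis m 1) a)
        + \<theta>\<^sup>2 * (\<Sum>m\<in>UNIV. (a $ m)\<^sup>2) * \<beta> a a"
      by (simp add: sum.distrib sum_subtractf sum_distrib_left sum_distrib_right)
    then have "(\<Sum>m\<in>UNIV. \<beta> (\<xi> m) (\<xi> m)) = (\<Sum>m\<in>UNIV. \<beta> (axis m 1) (axis m 1)) - \<theta> * \<beta> a a - \<theta> * \<beta> a a
        + \<theta>\<^sup>2 * (norm a)\<^sup>2 * \<beta> a a"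
      unfolding l r sq .
    then show "(\<Sum>m\<in>UNIV. \<beta> (\<xi> m) (\<xi> m)) = (\<Sum>m\<in>UNIV. \<beta> (axis m 1) (axis m 1)) - \<beta> a a"
      unfolding key by (simp add: algebra_simps)
  qed
qed

lemma second_derivative_test:
  fixes k :: "real \<Rightarrow> real"
  assumes "\<delta> > 0" and d1: "\<And>s. \<bar>s\<bar> < \<delta> \<Longrightarrow> (k has_real_derivative k1 s) (at s)"
    and d2: "(k1 has_real_derivative k2) (at 0)"
    and max: "\<And>s. \<bar>s\<bar> < \<delta> \<Longrightarrow> k s \<le> k 0"
  shows "k1 0 = 0" "k2 \<le> 0"
proof -
  show z: "k1 0 = 0"
    by (rule DERIV_local_max[OF d1[of 0] assms(1)]) (use assms(1) max in auto)
  show "k2 \<le> 0"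
  proof (rule ccontr)
    assume "\<not> k2 \<le> 0"
    then obtain d where d: "d > 0" "\<And>h. 0 < h \<Longrightarrow> h < d \<Longrightarrow> k1 0 < k1 (0 + h)"
      using DERIV_pos_inc_right[OF d2] by auto
    define h where "h = min d \<delta> / 2"
    have h: "0 < h" "h < d" "h < \<delta>" using d(1) assms(1) by (auto simp: h_def)
    obtain s where s: "0 < s" "s < h" "k h - k 0 = (h - 0) * k1 s"
      using MVT2[OF h(1), of k k1] d1 h by fastforce
    have "k1 s > 0" using d(2)[of s] s h z by simp
    then have "k h > k 0" using s h by (smt (verit) mult_pos_pos)
    then show False using max[of h] h by simp
  qed
qed

lemma slope_pos: "0 < \<eta> \<Longrightarrow> 0 < slope \<eta> p"
  by (simp add: slope_def add_pos_nonneg)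

lemma slope_sq: "(slope \<eta> p)\<^sup>2 = \<eta>\<^sup>2 + p \<bullet> p"
  by (simp add: slope_def power2_norm_eq_inner)

lemma norm_le_slope: "norm p \<le> slope \<eta> p"
  unfolding slope_def by (rule real_le_rsqrt) simp

lemma slope_powr: "slope \<eta> p powr r = (\<eta>\<^sup>2 + p \<bullet> p) powr (r / 2)"
proof -
  have "slope \<eta> p = (\<eta>\<^sup>2 + p \<bullet> p) powr (1 / 2)"
    by (simp add: slope_def powr_half_sqrt power2_norm_eq_inner)
  then show ?thesis by (simp add: powr_powr)
qed

lemma slope_powr_has_derivative:
  assumes "0 < \<eta>" "(P has_derivative P') (at s within A)"
  shows "((\<lambda>s. slope \<eta> (P s) powr r) has_derivative (\<lambda>h. r * slope \<eta> (P s) powr (r - 2) * (P s \<bullet> P' h))) (at s within A)"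
proof -
  have pos: "\<eta>\<^sup>2 + P s \<bullet> P s > 0" using assms(1) by (simp add: add_pos_nonneg)
  have 1: "((\<lambda>s. \<eta>\<^sup>2 + P s \<bullet> P s) has_derivative (\<lambda>h. 2 * (P s \<bullet> P' h))) (at s within A)"
    by (auto intro!: derivative_eq_intros assms(2) simp: inner_commute)
  have 2: "((\<lambda>z. z powr (r/2)) has_derivative (*) ((r/2) * (\<eta>\<^sup>2 + P s \<bullet> P s) powr (r/2 - 1))) (at (\<eta>\<^sup>2 + P s \<bullet> P s))"
    using has_real_derivative_powr[OF pos, of "r/2"] by (simp add: has_field_derivative_def)
  have "(r - 2) / 2 = r / 2 - 1" by (simp add: field_simps)
  then show ?thesis
    using has_derivative_compose[OF 1 2] unfolding slope_powr \<open>(r - 2) / 2 = r / 2 - 1\<close> by (simp add: mult_ac)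
qed

text \<open>
  The contribution of one frame vector \<open>\<xi>\<close>, with \<open>y = D\<^sup>2u \<xi>\<close>, \<open>Y = |y|\<close>, \<open>a = Du \<bullet> y\<close>, \<open>b = y \<bullet> V\<close>,
  \<open>d = y \<bullet> X\<close> and \<open>e = X' \<xi> \<bullet> y\<close>, where \<open>X = \<phi> N\<close>. The first two terms come from the second derivatives of \<open>w\<close> in \<open>Du\<close> and
  amount to at most \<open>- \<kappa> v\<^bsup>q-1\<^esup> Y\<^sup>2\<close>. Half of this absorbs \<open>2 e\<close>. The last term comes from
  differentiating the coefficients; as \<open>a\<close> is a positive multiple of \<open>b + d\<close>, completing the square leaves
  only \<open>d\<^sup>2 / 4\<close>, and the other half absorbs it once \<open>v\<close> is large.
\<close>

lemma quadratic_term_bound: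
  fixes q v Y a b d e B :: real
  defines "\<kappa> \<equiv> min 1 q"
  assumes "0 < q" "0 < v" "B\<^sup>2 \<le> \<kappa> * v powr (2 * q)"
    and a: "a = v powr (1 - q) * (b + d)" "\<bar>a\<bar> \<le> v * Y"
    and d: "\<bar>d\<bar> \<le> B * Y" and e: "e \<le> B * Y"
  shows "- (v powr (q - 1) * Y\<^sup>2) - (q - 1) * v powr (q - 3) * a\<^sup>2 + 2 * e - 2 / v\<^sup>2 * (b * a)
    \<le> 2 * B\<^sup>2 / \<kappa> * v powr (1 - q)"
proof -
  define r where "r = v powr (q - 1)"
  have r: "r > 0" using assms by (simp add: r_def)
  have inv: "v powr (1 - q) = 1 / r"
    using assms(3) by (simp add: r_def powr_minus_divide[symmetric])
  have r3: "v powr (q - 3) = r / v\<^sup>2"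
    using assms(3) powr_diff[of v "q - 1" 2] by (simp add: r_def)
  have "v powr (2 * q) = v powr (q - 1) * v powr (q - 1) * v powr 2"
    by (simp add: powr_add[symmetric])
  then have B2: "B\<^sup>2 \<le> \<kappa> * (v\<^sup>2 * r\<^sup>2)" using assms by (simp add: r_def power2_eq_square mult_ac)
  have k: "0 < \<kappa>" "\<kappa> \<le> 1" "1 - q \<le> 1 - \<kappa>" using assms(2) by (auto simp: \<kappa>_def)
  have a2: "a\<^sup>2 / v\<^sup>2 \<le> Y\<^sup>2"
    using a(2) assms(3) power_mono[of "\<bar>a\<bar>" "v * Y" 2] by (simp add: field_simps power_mult_distrib)
  have "(1 - q) * (r * (a\<^sup>2 / v\<^sup>2)) \<le> (1 - \<kappa>) * (r * (a\<^sup>2 / v\<^sup>2))"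
    using k r by (intro mult_right_mono) auto
  also have "\<dots> \<le> (1 - \<kappa>) * (r * Y\<^sup>2)"
    using k r a2 by (intro mult_left_mono) auto
  finally have 1: "- (q - 1) * v powr (q - 3) * a\<^sup>2 \<le> (1 - \<kappa>) * (r * Y\<^sup>2)"
    by (simp add: r3 algebra_simps)
  have "- (b * (b + d)) \<le> d\<^sup>2 / 4"
    using zero_le_power2[of "b + d / 2"] by (simp add: power2_eq_square field_simps)
  then have "2 / (v\<^sup>2 * r) * (- (b * (b + d))) \<le> 2 / (v\<^sup>2 * r) * (d\<^sup>2 / 4)"
    using r by (intro mult_left_mono) auto
  also have "d\<^sup>2 \<le> (B * Y)\<^sup>2" using d power_mono[of "\<bar>d\<bar>" "B * Y" 2] by simp
  then have "2 / (v\<^sup>2 * r) * (d\<^sup>2 / 4) \<le> 2 / (v\<^sup>2 * r) * ((B * Y)\<^sup>2 / 4)"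
    using r by (intro mult_left_mono divide_right_mono) auto
  also have "\<dots> = B\<^sup>2 * (Y\<^sup>2 / (2 * (v\<^sup>2 * r)))" by (simp add: power_mult_distrib)
  also have "\<dots> \<le> (\<kappa> * (v\<^sup>2 * r\<^sup>2)) * (Y\<^sup>2 / (2 * (v\<^sup>2 * r)))"
    using r by (intro mult_right_mono B2) auto
  also have "\<dots> = \<kappa> * (r * Y\<^sup>2) / 2" using r assms(3) by (simp add: power2_eq_square)
  also have "2 / (v\<^sup>2 * r) * (- (b * (b + d))) = - (2 / v\<^sup>2 * (b * a))"
    by (simp add: a(1) inv)
  finally have 2: "- (2 / v\<^sup>2 * (b * a)) \<le> \<kappa> * (r * Y\<^sup>2) / 2" .
  have "0 \<le> (\<kappa> * r * Y - 2 * B)\<^sup>2 / (2 * (\<kappa> * r))" using k r by simp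
  also have "\<dots> = \<kappa> * (r * Y\<^sup>2) / 2 + 2 * B\<^sup>2 / \<kappa> * (1 / r) - 2 * (B * Y)"
    using k r by (simp add: power2_eq_square field_simps)
  finally have 3: "2 * e \<le> \<kappa> * (r * Y\<^sup>2) / 2 + 2 * B\<^sup>2 / \<kappa> * (1 / r)" using e by linarith
  show ?thesis using 1 2 3 unfolding inv r_def[symmetric] by (simp add: algebra_simps)
qed

text \<open>
  For \<open>v\<^sup>q \<ge> 2 (1 + q) B\<close> the linear term takes away at most half of the leading term of \<open>w\<close>, and
  \<open>|p| \<ge> v / 2\<close> (which uses \<open>\<eta> \<le> 1\<close> and \<open>v \<ge> 2\<close>) makes \<open>p \<bullet> V\<close> nonnegative; the sign of \<open>p \<bullet> V\<close> is what
  brings the monotonicity of \<open>c\<close> and \<open>f\<close> in \<open>z\<close> into play.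
\<close>

lemma large_slope_bounds:
  fixes p Xx :: "real ^ 'n" and B q \<eta> :: real
  assumes "0 < \<eta>" "\<eta> \<le> 1" "0 < q" "norm Xx \<le> B"
    and v: "v = slope \<eta> p" "2 \<le> v" "2 * (1 + q) * B \<le> v powr q"
    and w: "w = v powr (1 + q) / (1 + q) - Xx \<bullet> p"
    and V: "V = v powr (q - 1) *\<^sub>R p - Xx"
  shows "v powr (1 + q) \<le> 2 * (1 + q) * w" "0 < w" "0 \<le> p \<bullet> V" "norm V \<le> (1 + B) * v powr q"
proof -
  have B: "B \<ge> 0" using assms(4) norm_ge_zero order_trans by blast
  have vp: "v powr (1 + q) = v * v powr q" using v by (simp add: powr_add)
  have np: "norm p \<le> v" unfolding v(1) by (rule norm_le_slope)
  have "\<bar>Xx \<bullet> p\<bar> \<le> norm Xx * norm p" by (rule Cauchy_Schwarz_ineq2)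
  also have "\<dots> \<le> B * v" using assms(4) np B by (intro mult_mono) auto
  finally have Xp: "\<bar>Xx \<bullet> p\<bar> \<le> B * v" .
  have "v * (2 * (1 + q) * B) \<le> v powr (1 + q)" unfolding vp using v by (intro mult_left_mono) auto
  moreover have "2 * (1 + q) * w = 2 * v powr (1 + q) - 2 * (1 + q) * (Xx \<bullet> p)"
    using assms(3) unfolding w by (simp add: field_simps)
  moreover have "2 * (1 + q) * (Xx \<bullet> p) \<le> 2 * (1 + q) * (B * v)"
    using Xp assms(3) by (intro mult_left_mono) auto
  ultimately show 1: "v powr (1 + q) \<le> 2 * (1 + q) * w" by (simp add: algebra_simps)
  have "0 < v powr (1 + q)" using v by simp
  then have "0 < 2 * (1 + q) * w" using 1 by linarith
  then show "0 < w" using assms(3) by (simp add: zero_less_mult_iff)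
  have vq1: "v powr (q - 1) * v = v powr q" using v powr_add[of v "q - 1" 1] by simp
  have sq: "v\<^sup>2 = \<eta>\<^sup>2 + (norm p)\<^sup>2" unfolding v(1) slope_sq by (simp add: power2_norm_eq_inner)
  have "\<eta>\<^sup>2 \<le> 1" using assms by (simp add: power_le_one)
  moreover have "4 \<le> v\<^sup>2" using power_mono[OF v(2), of 2] by simp
  ultimately have "(v / 2)\<^sup>2 \<le> (norm p)\<^sup>2" using sq by (simp add: power_divide)
  then have hv: "v / 2 \<le> norm p" by (rule power2_le_imp_le) simp
  have "B \<le> (1 + q) * B" using B assms(3) by (simp add: algebra_simps)
  then have "2 * B \<le> v powr q" using v(3) by (simp add: algebra_simps)
  then have "B \<le> v powr (q - 1) * (v / 2)" using vq1 by simp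
  also have "\<dots> \<le> v powr (q - 1) * norm p" using hv by (intro mult_left_mono) auto
  finally have "B * norm p \<le> v powr (q - 1) * norm p * norm p" by (intro mult_right_mono) auto
  moreover have "Xx \<bullet> p \<le> B * norm p"
    using norm_cauchy_schwarz[of Xx p] mult_right_mono[OF assms(4), of "norm p"] by simp
  moreover have "p \<bullet> V = v powr (q - 1) * norm p * norm p - Xx \<bullet> p"
    unfolding V by (simp add: inner_diff_right inner_commute[of p Xx] dot_square_norm power2_eq_square)
  ultimately show "0 \<le> p \<bullet> V" by simp
  have "norm V \<le> v powr (q - 1) * norm p + norm Xx"
    unfolding V by (rule order_trans[OF norm_triangle_ineq4]) simp
  also have "v powr (q - 1) * norm p \<le> v powr q" unfolding vq1[symmetric] using np by (intro mult_left_mono) auto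
  also have "norm Xx \<le> B * v powr q"
    using assms(4) v assms(3) B ge_one_powr_ge_zero[of v q] mult_left_mono[of 1 "v powr q" B] by simp
  finally show "norm V \<le> (1 + B) * v powr q" by (simp add: algebra_simps)
qed

section \<open>Differential inequalities at a contact point\<close>

lemma has_vector_derivative_along_line:
  assumes "(F has_derivative F') (at (x + s *\<^sub>R \<xi>))"
  shows "((\<lambda>s. F (x + s *\<^sub>R \<xi>)) has_vector_derivative F' \<xi>) (at s)"
proof -
  have "((\<lambda>s. F (x + s *\<^sub>R \<xi>)) has_derivative (\<lambda>r. F' (r *\<^sub>R \<xi>))) (at s)"
    by (rule has_derivative_compose[of "\<lambda>s. x + s *\<^sub>R \<xi>", OF _ assms]) (auto intro!: derivative_eq_intros)
  then show ?thesis
    using has_derivative_bounded_linear[OF assms]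
    by (simp add: has_vector_derivative_def linear_simps bounded_linear.linear linear_cmul)
qed

lemma derivatives_at_interior_max:
  fixes F :: "'a::real_normed_vector \<Rightarrow> real"
  assumes "open \<Omega>" "x \<in> \<Omega>"
    and F: "\<And>y. y \<in> \<Omega> \<Longrightarrow> (F has_derivative F' y) (at y)"
    and F': "((\<lambda>z. F' z h) has_derivative F'') (at x)"
    and max: "\<And>y. y \<in> \<Omega> \<Longrightarrow> F y \<le> F x"
  shows "F' x h = 0" "F'' h \<le> 0"
proof -
  obtain d where d: "d > 0" "ball x d \<subseteq> \<Omega>" using assms(1,2) openE by blast
  define \<delta> where "\<delta> = d / (norm h + 1)"
  have p: "norm h + 1 > 0" by (simp add: add_nonneg_pos)
  have mem: "x + s *\<^sub>R h \<in> \<Omega>" if "\<bar>s\<bar> < \<delta>" for s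
  proof -
    have "\<bar>s\<bar> * (norm h + 1) < d" using that p by (simp add: \<delta>_def field_simps)
    then have "\<bar>s\<bar> * norm h < d" by (simp add: algebra_simps)
    then show ?thesis using d by (auto simp: dist_norm)
  qed
  have d1: "((\<lambda>s. F (x + s *\<^sub>R h)) has_real_derivative F' (x + s *\<^sub>R h) h) (at s)" if "\<bar>s\<bar> < \<delta>" for s
    unfolding has_real_derivative_iff_has_vector_derivative
    by (rule has_vector_derivative_along_line[OF F[OF mem[OF that]]])
  have d2: "((\<lambda>s. F' (x + s *\<^sub>R h) h) has_real_derivative F'' h) (at 0)"
    unfolding has_real_derivative_iff_has_vector_derivative
    by (rule has_vector_derivative_along_line) (use F' in simp)
  have "\<delta> > 0" using d p by (simp add: \<delta>_def)
  from second_derivative_test[OF this d1 d2] max mem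
  show "F' x h = 0" "F'' h \<le> 0" by auto
qed

text \<open>
  Expanding \<open>g y\<close> in coordinates reduces the claim to finitely many scalar products, so no continuity of
  \<open>U\<close> as an operator-valued map has to be discussed.
\<close>

lemma has_derivative_applied_operator:
  fixes g :: "real ^ 'n \<Rightarrow> real ^ 'n"
  assumes "open \<Omega>" "x \<in> \<Omega>"
    and lin: "\<And>y. y \<in> \<Omega> \<Longrightarrow> linear (U y)"
    and U: "\<And>h. ((\<lambda>z. U z h) has_derivative W h) (at x)"
    and W: "\<And>k. linear (\<lambda>h. W h k)"
    and g: "(g has_derivative g') (at x)"
  shows "((\<lambda>y. U y (g y)) has_derivative (\<lambda>k. W (g x) k + U x (g' k))) (at x)"
proof -
  have expand: "L a = (\<Sum>i\<in>UNIV. (a $ i) *\<^sub>R L (axis i 1))" if "linear L" for L :: "real ^ 'n \<Rightarrow> 'c::real_normed_vector" and a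
  proof -
    have "L a = L (\<Sum>i\<in>UNIV. (a $ i) *\<^sub>R axis i 1)" by (simp add: sum_scaled_axis)
    then show ?thesis using that by (simp add: linear_sum linear_cmul)
  qed
  have gi: "((\<lambda>y. g y $ i) has_derivative (\<lambda>k. g' k $ i)) (at x)" for i
    by (rule bounded_linear.has_derivative[OF bounded_linear_vec_nth g])
  have "((\<lambda>y. \<Sum>i\<in>UNIV. (g y $ i) *\<^sub>R U y (axis i 1)) has_derivative
    (\<lambda>k. \<Sum>i\<in>UNIV. (g x $ i) *\<^sub>R W (axis i 1) k + (g' k $ i) *\<^sub>R U x (axis i 1))) (at x)"
    by (intro has_derivative_sum has_derivative_scaleR gi U)
  moreover have "(\<Sum>i\<in>UNIV. (g x $ i) *\<^sub>R W (axis i 1) k + (g' k $ i) *\<^sub>R U x (axis i 1)) = W (g x) k + U x (g' k)" for k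
    using expand[OF W[of k], of "g x"] expand[OF lin[OF assms(2)], of "g' k"] by (simp add: sum.distrib)
  ultimately have "((\<lambda>y. \<Sum>i\<in>UNIV. (g y $ i) *\<^sub>R U y (axis i 1)) has_derivative (\<lambda>k. W (g x) k + U x (g' k))) (at x)"
    by simp
  then show ?thesis
    by (rule has_derivative_transform_within_open[OF _ assms(1,2)]) (use expand[OF lin] in auto)
qed

text \<open>
  It is evaluated at \<open>X = \<phi> N\<close> and \<open>p = Du\<close>. The exponent \<open>1 + q\<close> is the one for which, under the boundary
  condition \<open>p \<bullet> \<nu> = \<phi> v\<^bsup>1-q\<^esup>\<close>, the gradient in \<open>p\<close> is tangential on the boundary.
\<close>

definition test_quantity :: "real \<Rightarrow> real \<Rightarrow> real ^ 'n \<Rightarrow> real ^ 'n \<Rightarrow> real" where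
  "test_quantity \<eta> q X p = slope \<eta> p powr (1 + q) / (1 + q) - X \<bullet> p"

text \<open>
  The coefficient of \<open>g' h\<close> is the vector \<open>V\<close>, the gradient of the test quantity in \<open>p\<close>.
\<close>

lemma test_quantity_has_derivative:
  assumes "0 < \<eta>" "0 < q" "(g has_derivative g') (at x within A)" "(X has_derivative X') (at x within A)"
  shows "((\<lambda>y. test_quantity \<eta> q (X y) (g y)) has_derivative
    (\<lambda>h. (slope \<eta> (g x) powr (q - 1) *\<^sub>R g x - X x) \<bullet> g' h - X' h \<bullet> g x)) (at x within A)"
proof -
  have d: "((\<lambda>y. 1 / (1 + q) * slope \<eta> (g y) powr (1 + q) - X y \<bullet> g y) has_derivative
    (\<lambda>h. 1 / (1 + q) * ((1 + q) * slope \<eta> (g x) powr (1 + q - 2) * (g x \<bullet> g' h)) - (X x \<bullet> g' h + X' h \<bullet> g x))) (at x within A)"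
    by (intro has_derivative_diff has_derivative_mult_right slope_powr_has_derivative has_derivative_inner assms)
  have e: "1 / (1 + q) * ((1 + q) * slope \<eta> (g x) powr (1 + q - 2) * (g x \<bullet> g' h)) - (X x \<bullet> g' h + X' h \<bullet> g x)
    = (slope \<eta> (g x) powr (q - 1) *\<^sub>R g x - X x) \<bullet> g' h - X' h \<bullet> g x" for h
    using assms(2) by (simp add: inner_diff_left)
  show ?thesis using d unfolding e test_quantity_def by simp
qed

text \<open>
  The left-hand side is the time derivative of the test quantity \<open>w\<close>, as \<open>\<tau>\<close> is both the gradient of
  \<open>u\<^sub>t\<close> and the time derivative of \<open>Du\<close>. It is computed by differentiating the equation in direction \<open>V\<close>.
  The third derivatives of \<open>u\<close> that appear are those in the second derivatives of \<open>w\<close>, which are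
  bounded from above because \<open>w\<close> touches the barrier \<open>\<beta>\<close> from below. All remaining second derivatives of \<open>u\<close> are
  collected in the frame and absorbed by \<open>quadratic_term_bound\<close>, except for \<open>Du \<bullet> D\<^sup>2u V\<close> in the term with
  \<open>c\<close>, for which the first order contact condition is used.
\<close>

lemma interior_inequality:
  fixes g X :: "real ^ 'n \<Rightarrow> real ^ 'n" and c f :: "(real ^ 'n) \<times> real \<Rightarrow> real" and B L q \<eta> :: real
  defines "\<kappa> \<equiv> \<lambda>q::real. min 1 q"
  assumes \<Omega>: "open \<Omega>" "x \<in> \<Omega>" and eta: "0 < \<eta>" "\<eta> \<le> 1" and q: "0 < q"
    and g: "\<And>y. y \<in> \<Omega> \<Longrightarrow> (g has_derivative U y) (at y)"
    and U: "\<And>y h. y \<in> \<Omega> \<Longrightarrow> ((\<lambda>z. U z h) has_derivative W y h) (at y)"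
    and W_lin: "\<And>k. linear (\<lambda>h. W x h k)"
    and U_sym: "\<And>h k. U x h \<bullet> k = U x k \<bullet> h"
    and W_sym: "\<And>h k l. W x h k \<bullet> l = W x k h \<bullet> l" "\<And>h k l. W x h k \<bullet> l = W x l k \<bullet> h"
    and u: "(u has_derivative (\<lambda>h. g x \<bullet> h)) (at x)"
    and ut: "(ut has_derivative (\<lambda>h. \<tau> \<bullet> h)) (at x)"
    and pde: "\<And>y. y \<in> \<Omega> \<Longrightarrow> ut y = (\<Sum>i\<in>UNIV. U y (axis i 1) \<bullet> axis i 1)
      - (U y (g y) \<bullet> g y) * slope \<eta> (g y) powr (- 2) + c (y, u y) * slope \<eta> (g y) powr 1 - f (y, u y)"
    and c: "(c has_derivative (\<lambda>h. cx \<bullet> fst h + cz * snd h)) (at (x, u x))"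
      "\<bar>c (x, u x)\<bar> \<le> B" "norm cx \<le> B" "cz \<le> 0"
    and f: "(f has_derivative (\<lambda>h. fx \<bullet> fst h + fz * snd h)) (at (x, u x))"
      "norm fx \<le> B" "0 \<le> fz"
    and X: "\<And>y. y \<in> \<Omega> \<Longrightarrow> (X has_derivative X' y) (at y)"
      "\<And>h. ((\<lambda>z. X' z h) has_derivative X'' h) (at x)"
      "norm (X x) \<le> B" "\<And>h. norm (X' x h) \<le> B * norm h" "\<And>h k. norm (X'' h k) \<le> B * norm h * norm k"
    and \<beta>: "\<And>y. y \<in> \<Omega> \<Longrightarrow> (\<beta> has_derivative \<beta>' y) (at y)"
      "\<And>h. ((\<lambda>z. \<beta>' z h) has_derivative \<beta>'' h) (at x)"
    and touch: "\<And>y. y \<in> \<Omega> \<Longrightarrow> test_quantity \<eta> q (X y) (g y) \<le> \<beta> y" "test_quantity \<eta> q (X x) (g x) = \<beta> x"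
    and L: "0 \<le> L" "\<And>h. \<bar>\<beta>' x h\<bar> \<le> L * \<beta> x * norm h" "\<And>h. norm h \<le> 1 \<Longrightarrow> \<beta>'' h h \<le> L * \<beta> x"
    and v: "2 \<le> slope \<eta> (g x)" "2 * (1 + q) * B \<le> slope \<eta> (g x) powr q"
      "B\<^sup>2 \<le> \<kappa> q * slope \<eta> (g x) powr (2 * q)"
  shows "(slope \<eta> (g x) powr (q - 1) *\<^sub>R g x - X x) \<bullet> \<tau>
    \<le> (CARD('n) * L + B * L + 2 * (1 + q) * (CARD('n) * (B + 2 * B\<^sup>2 / \<kappa> q) + 2 * B * (1 + B) + B\<^sup>2)) * \<beta> x"
proof -
  define p where "p = g x"
  define v where "v = slope \<eta> p"
  define V where "V = v powr (q - 1) *\<^sub>R p - X x"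
  define w where "w = \<beta> x"
  define n where "n = real CARD('n)"
  have vv: "2 \<le> v" "2 * (1 + q) * B \<le> v powr q" "B\<^sup>2 \<le> \<kappa> q * v powr (2 * q)"
    using v by (auto simp: v_def p_def)
  have v0: "v > 0" using vv by simp
  have wdef: "w = v powr (1 + q) / (1 + q) - X x \<bullet> p"
    using touch(2) by (simp add: w_def test_quantity_def v_def p_def)
  note large = large_slope_bounds[OF eta q X(3) v_def vv(1,2) wdef V_def]
  have B: "B \<ge> 0" using X(3) norm_ge_zero order_trans by blast
  have Ulin: "linear (U y)" if "y \<in> \<Omega>" for y using g[OF that] by (rule has_derivative_linear)
  have np: "norm p \<le> v" unfolding v_def by (rule norm_le_slope)

  \<comment> \<open>\<open>F'\<close> and \<open>F''\<close> are the derivatives of \<open>w - \<beta>\<close>, which is maximal at \<open>x\<close>\<close>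
  define F' where "F' y h = (slope \<eta> (g y) powr (q - 1) *\<^sub>R g y - X y) \<bullet> U y h - X' y h \<bullet> g y - \<beta>' y h" for y h
  define F'' where "F'' h k = (slope \<eta> (g x) powr (q - 1) *\<^sub>R g x - X x) \<bullet> W x h k
      + (slope \<eta> (g x) powr (q - 1) *\<^sub>R U x k + ((q - 1) * slope \<eta> (g x) powr (q - 1 - 2) * (g x \<bullet> U x k)) *\<^sub>R g x - X' x k) \<bullet> U x h
      - (X' x h \<bullet> U x k + X'' h k \<bullet> g x) - \<beta>'' h k" for h k
  have F: "((\<lambda>y. test_quantity \<eta> q (X y) (g y) - \<beta> y) has_derivative F' y) (at y)" if "y \<in> \<Omega>" for y
    unfolding F'_def
    by (intro has_derivative_diff test_quantity_has_derivative eta(1) q g X(1) \<beta>(1) that)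
  have FF: "((\<lambda>z. F' z h) has_derivative F'' h) (at x)" for h
    unfolding F'_def F''_def
    by (intro has_derivative_diff has_derivative_inner has_derivative_scaleR slope_powr_has_derivative
        eta(1) g X(1,2) \<beta>(2) U \<Omega>(2))
  have touch': "test_quantity \<eta> q (X y) (g y) - \<beta> y \<le> test_quantity \<eta> q (X x) (g x) - \<beta> x" if "y \<in> \<Omega>" for y
    using touch(1)[OF that] touch(2) by simp
  have first: "V \<bullet> U x h = X' x h \<bullet> p + \<beta>' x h" for h
  proof -
    have "F' x h = 0" by (rule derivatives_at_interior_max(1)[OF \<Omega> F FF touch'])
    then show ?thesis unfolding F'_def V_def v_def p_def by linarith
  qed
  have second: "V \<bullet> W x \<xi> \<xi> \<le> L * w - v powr (q - 1) * (norm (U x \<xi>))\<^sup>2 - (q - 1) * v powr (q - 3) * (p \<bullet> U x \<xi>)\<^sup>2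
      + X'' \<xi> \<xi> \<bullet> p + 2 * (X' x \<xi> \<bullet> U x \<xi>)" if "norm \<xi> \<le> 1" for \<xi>
  proof -
    have "F'' \<xi> \<xi> \<le> 0" by (rule derivatives_at_interior_max(2)[OF \<Omega> F FF touch'])
    moreover have "F'' \<xi> \<xi> = V \<bullet> W x \<xi> \<xi> + v powr (q - 1) * (norm (U x \<xi>))\<^sup>2 + (q - 1) * v powr (q - 3) * (p \<bullet> U x \<xi>)\<^sup>2
      - X'' \<xi> \<xi> \<bullet> p - 2 * (X' x \<xi> \<bullet> U x \<xi>) - \<beta>'' \<xi> \<xi>"
      by (simp add: F''_def V_def v_def p_def inner_diff_left inner_add_left dot_square_norm power2_eq_square)
    ultimately show ?thesis using L(3)[OF that] by (simp add: w_def)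
  qed

  \<comment> \<open>\<open>R'\<close> is the derivative of the right-hand side of the equation; it is evaluated in direction \<open>V\<close>\<close>
  have Up: "((\<lambda>y. U y (g y)) has_derivative (\<lambda>k. W x (g x) k + U x (U x k))) (at x)"
    by (rule has_derivative_applied_operator[OF \<Omega> Ulin U[OF \<Omega>(2)] W_lin g[OF \<Omega>(2)]])
  have pair: "((\<lambda>y. (y, u y)) has_derivative (\<lambda>h. (h, g x \<bullet> h))) (at x)"
    by (intro has_derivative_Pair has_derivative_ident u)
  have cd: "((\<lambda>y. c (y, u y)) has_derivative (\<lambda>h. cx \<bullet> h + cz * (g x \<bullet> h))) (at x)"
    using has_derivative_compose[OF pair c(1)] by simp
  have fd: "((\<lambda>y. f (y, u y)) has_derivative (\<lambda>h. fx \<bullet> h + fz * (g x \<bullet> h))) (at x)"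
    using has_derivative_compose[OF pair f(1)] by simp
  define R' where "R' h = (\<Sum>i\<in>UNIV. W x (axis i 1) h \<bullet> axis i 1)
       - ((U x (g x) \<bullet> g x) * ((- 2) * slope \<eta> (g x) powr (- 2 - 2) * (g x \<bullet> U x h))
          + (U x (g x) \<bullet> U x h + (W x (g x) h + U x (U x h)) \<bullet> g x) * slope \<eta> (g x) powr (- 2))
       + (c (x, u x) * (1 * slope \<eta> (g x) powr (1 - 2) * (g x \<bullet> U x h)) + (cx \<bullet> h + cz * (g x \<bullet> h)) * slope \<eta> (g x) powr 1)
       - (fx \<bullet> h + fz * (g x \<bullet> h))" for h
  have "((\<lambda>y. (\<Sum>i\<in>UNIV. U y (axis i 1) \<bullet> axis i 1)
      - (U y (g y) \<bullet> g y) * slope \<eta> (g y) powr (- 2) + c (y, u y) * slope \<eta> (g y) powr 1 - f (y, u y)) has_derivative R') (at x)"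
    unfolding R'_def[abs_def]
    by (intro has_derivative_diff has_derivative_add has_derivative_sum has_derivative_inner_left has_derivative_mult
        has_derivative_inner slope_powr_has_derivative eta(1) g U Up cd fd \<Omega>(2))
  then have "(ut has_derivative R') (at x)"
    by (rule has_derivative_transform_within_open[OF _ \<Omega>]) (simp add: pde)
  from fun_cong[OF has_derivative_unique[OF ut this], of V]
  have tau0: "\<tau> \<bullet> V = (\<Sum>i\<in>UNIV. W x (axis i 1) V \<bullet> axis i 1)
       - ((U x p \<bullet> p) * ((- 2) * v powr (- 2 - 2) * (p \<bullet> U x V))
          + (U x p \<bullet> U x V + (W x p V + U x (U x V)) \<bullet> p) * v powr (- 2))
       + (c (x, u x) * (v powr (- 1) * (p \<bullet> U x V)) + (cx \<bullet> V + cz * (p \<bullet> V)) * v)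
       - (fx \<bullet> V + fz * (p \<bullet> V))"
    using v0 by (simp add: R'_def p_def v_def)
  have pw: "v powr (- 2) = 1 / v\<^sup>2" "v powr (- 2 - 2) = 1 / v\<^sup>2 * (1 / v\<^sup>2)" "v powr (- 1) = 1 / v"
    using v0 powr_add[of v "- 2" "- 2"] by (simp_all add: powr_minus_divide)
  have UUV: "U x (U x V) \<bullet> p = U x p \<bullet> U x V" by (simp add: U_sym[of "U x V" p])

  \<comment> \<open>the coefficient matrix is \<open>I - a a\<^sup>T\<close>; both its trace against third derivatives and the derivative of
    the coefficients become sums over the frame\<close>
  define a where "a = p /\<^sub>R v"
  have "norm a \<le> 1" using np v0 by (simp add: a_def field_simps)
  then obtain \<xi> :: "'n \<Rightarrow> real ^ 'n" where xi: "\<And>m. norm (\<xi> m) \<le> 1"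
    "\<And>\<beta> :: real ^ 'n \<Rightarrow> real ^ 'n \<Rightarrow> real. bilinear \<beta> \<Longrightarrow>
       (\<Sum>m\<in>UNIV. \<beta> (\<xi> m) (\<xi> m)) = (\<Sum>m\<in>UNIV. \<beta> (axis m 1) (axis m 1)) - \<beta> a a"
    using square_root_frame[of a] by blast
  have "bilinear (\<lambda>h k. W x h V \<bullet> k)"
    unfolding bilinear_def by (auto intro!: linearI simp: linear_add[OF W_lin] linear_cmul[OF W_lin] inner_add_left inner_add_right)
  from xi(2)[OF this] have s1: "(\<Sum>m\<in>UNIV. W x (\<xi> m) V \<bullet> \<xi> m) = (\<Sum>i\<in>UNIV. W x (axis i 1) V \<bullet> axis i 1) - W x p V \<bullet> p * (1 / v\<^sup>2)"
    by (simp add: a_def linear_cmul[OF W_lin] power2_eq_square divide_inverse mult_ac)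
  have "bilinear (\<lambda>h k. (h \<bullet> U x p) * (k \<bullet> U x V))"
    unfolding bilinear_def by (auto intro!: linearI simp: inner_add_left algebra_simps)
  from xi(2)[OF this] have s2: "(\<Sum>m\<in>UNIV. (\<xi> m \<bullet> U x p) * (\<xi> m \<bullet> U x V)) = U x p \<bullet> U x V - (U x p \<bullet> p) * (p \<bullet> U x V) * (1 / v\<^sup>2)"
    by (simp add: a_def inner_axis' inner_vec_def[of "U x p" "U x V"] power2_eq_square divide_inverse inner_commute[of p "U x p"] mult_ac)
  have "\<tau> \<bullet> V = (\<Sum>m\<in>UNIV. W x (\<xi> m) V \<bullet> \<xi> m) - 2 / v\<^sup>2 * (\<Sum>m\<in>UNIV. (\<xi> m \<bullet> U x p) * (\<xi> m \<bullet> U x V))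
       + (c (x, u x) * (1 / v * (p \<bullet> U x V)) + (cx \<bullet> V + cz * (p \<bullet> V)) * v)
       - (fx \<bullet> V + fz * (p \<bullet> V))"
    unfolding tau0 s1 s2 pw inner_add_left UUV by (simp add: algebra_simps)
  also have "(\<Sum>m\<in>UNIV. W x (\<xi> m) V \<bullet> \<xi> m) - 2 / v\<^sup>2 * (\<Sum>m\<in>UNIV. (\<xi> m \<bullet> U x p) * (\<xi> m \<bullet> U x V))
     = (\<Sum>m\<in>UNIV. V \<bullet> W x (\<xi> m) (\<xi> m) - 2 / v\<^sup>2 * ((U x (\<xi> m) \<bullet> V) * (p \<bullet> U x (\<xi> m))))"
  proof -
    have "W x h V \<bullet> h = V \<bullet> W x h h" for h
      using W_sym(1)[of h V h] W_sym(2)[of V h h] by (simp add: inner_commute)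
    moreover have "(h \<bullet> U x p) * (h \<bullet> U x V) = (U x h \<bullet> V) * (p \<bullet> U x h)" for h
      using U_sym[of h p] U_sym[of h V] by (simp add: inner_commute mult.commute)
    ultimately show ?thesis by (simp add: sum_subtractf sum_distrib_left)
  qed
  finally have tau: "\<tau> \<bullet> V = (\<Sum>m\<in>UNIV. V \<bullet> W x (\<xi> m) (\<xi> m) - 2 / v\<^sup>2 * ((U x (\<xi> m) \<bullet> V) * (p \<bullet> U x (\<xi> m))))
       + (c (x, u x) * (1 / v * (p \<bullet> U x V)) + (cx \<bullet> V + cz * (p \<bullet> V)) * v)
       - (fx \<bullet> V + fz * (p \<bullet> V))" .

  \<comment> \<open>everything is now compared with \<open>P\<close>, which is of the size of \<open>w\<close>\<close>
  define P where "P = v powr (1 + q)"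
  have P: "P \<le> 2 * (1 + q) * w" using large(1) by (simp add: P_def)
  have v1: "v \<ge> 1" using vv by simp
  have vP: "v \<le> P" "v powr (1 - q) \<le> P" "v powr q \<le> P" "v powr q * v = P"
  proof -
    show "v \<le> P" using powr_mono[of 1 "1 + q" v] v1 q by (simp add: P_def)
    show "v powr (1 - q) \<le> P" "v powr q \<le> P" unfolding P_def by (rule powr_mono; use v1 q in simp)+
    show "v powr q * v = P" using v0 by (simp add: P_def powr_add)
  qed
  have kpos: "0 < \<kappa> q" using q by (simp add: \<kappa>_def)
  have summand: "V \<bullet> W x (\<xi> m) (\<xi> m) - 2 / v\<^sup>2 * ((U x (\<xi> m) \<bullet> V) * (p \<bullet> U x (\<xi> m)))
     \<le> L * w + (B + 2 * B\<^sup>2 / \<kappa> q) * P" for m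
  proof -
    let ?y = "U x (\<xi> m)"
    have "B * norm (\<xi> m) \<le> B * 1" by (intro mult_left_mono xi(1) B)
    then have e1: "norm (X' x (\<xi> m)) \<le> B" using X(4)[of "\<xi> m"] by linarith
    have "- (v powr (q - 1) * (norm ?y)\<^sup>2) - (q - 1) * v powr (q - 3) * (p \<bullet> ?y)\<^sup>2 + 2 * (X' x (\<xi> m) \<bullet> ?y)
       - 2 / v\<^sup>2 * ((?y \<bullet> V) * (p \<bullet> ?y)) \<le> 2 * B\<^sup>2 / min 1 q * v powr (1 - q)"
    proof (rule quadratic_term_bound[where d="?y \<bullet> X x"])
      have "v powr (1 - q) * v powr (q - 1) = 1" using v0 by (simp add: powr_add[symmetric])
      then show "p \<bullet> ?y = v powr (1 - q) * (?y \<bullet> V + ?y \<bullet> X x)"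
        by (simp add: V_def inner_diff_right inner_commute)
      show "\<bar>p \<bullet> ?y\<bar> \<le> v * norm ?y"
        by (rule order_trans[OF Cauchy_Schwarz_ineq2]) (intro mult_right_mono np norm_ge_zero)
      show "\<bar>?y \<bullet> X x\<bar> \<le> B * norm ?y"
        by (subst inner_commute, rule order_trans[OF Cauchy_Schwarz_ineq2]) (intro mult_right_mono X(3) norm_ge_zero)
      show "X' x (\<xi> m) \<bullet> ?y \<le> B * norm ?y"
        by (rule order_trans[OF norm_cauchy_schwarz]) (intro mult_right_mono e1 norm_ge_zero)
    qed (use q v0 vv(3) in \<open>auto simp: \<kappa>_def\<close>)
    moreover have "2 * B\<^sup>2 / \<kappa> q * v powr (1 - q) \<le> 2 * B\<^sup>2 / \<kappa> q * P"
      using kpos vP by (intro mult_left_mono) auto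
    moreover have "X'' (\<xi> m) (\<xi> m) \<bullet> p \<le> B * P"
    proof -
      have "norm (\<xi> m) * norm (\<xi> m) \<le> 1 * 1" by (intro mult_mono xi(1)) auto
      then have "norm (X'' (\<xi> m) (\<xi> m)) \<le> B"
        using order_trans[OF X(5)[of "\<xi> m" "\<xi> m"]] B mult_left_le[of "norm (\<xi> m) * norm (\<xi> m)" B] by (simp add: mult.assoc)
      then have "norm (X'' (\<xi> m) (\<xi> m)) * norm p \<le> B * P" using np vP B by (intro mult_mono) auto
      then show ?thesis using norm_cauchy_schwarz order_trans by blast
    qed
    ultimately show ?thesis using second[OF xi(1)[of m]] by (simp add: \<kappa>_def algebra_simps)
  qed
  have sum: "(\<Sum>m\<in>UNIV. V \<bullet> W x (\<xi> m) (\<xi> m) - 2 / v\<^sup>2 * ((U x (\<xi> m) \<bullet> V) * (p \<bullet> U x (\<xi> m))))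
     \<le> n * (L * w + (B + 2 * B\<^sup>2 / \<kappa> q) * P)"
    using sum_bounded_above[of UNIV, OF summand] by (simp add: n_def)
  have pUV: "\<bar>1 / v * (p \<bullet> U x V)\<bar> \<le> L * w + B * P"
  proof -
    have "p \<bullet> U x V = V \<bullet> U x p" using U_sym[of p V] by (simp add: inner_commute)
    then have "\<bar>p \<bullet> U x V\<bar> \<le> \<bar>X' x p \<bullet> p\<bar> + \<bar>\<beta>' x p\<bar>" using first[of p] by simp
    also have "\<bar>X' x p \<bullet> p\<bar> \<le> (B * v) * v"
      by (rule order_trans[OF Cauchy_Schwarz_ineq2], rule mult_mono, rule order_trans[OF X(4)])
        (use np B v0 in \<open>auto intro: mult_left_mono\<close>)
    also have "\<bar>\<beta>' x p\<bar> \<le> L * w * v"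
      unfolding w_def by (rule order_trans[OF L(2)], rule mult_left_mono[OF np])
        (use L(1) large(2) in \<open>simp add: w_def\<close>)
    finally have "\<bar>p \<bullet> U x V\<bar> \<le> (L * w + B * v) * v" by (simp add: algebra_simps)
    then have "\<bar>1 / v * (p \<bullet> U x V)\<bar> \<le> L * w + B * v" using v0 by (simp add: abs_mult field_simps)
    also have "\<dots> \<le> L * w + B * P" using vP B by (intro add_left_mono mult_left_mono) auto
    finally show ?thesis .
  qed
  have cterm: "c (x, u x) * (1 / v * (p \<bullet> U x V)) \<le> B * (L * w + B * P)"
  proof -
    have "\<bar>c (x, u x) * (1 / v * (p \<bullet> U x V))\<bar> \<le> B * (L * w + B * P)"
      unfolding abs_mult[of "c (x, u x)"] by (intro mult_mono c(2) pUV B) auto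
    then show ?thesis by linarith
  qed
  have vecb: "\<bar>d \<bullet> V\<bar> \<le> B * ((1 + B) * v powr q)" if "norm d \<le> B" for d
    by (rule order_trans[OF Cauchy_Schwarz_ineq2]) (intro mult_mono that large(4) B norm_ge_zero)
  have cx: "(cx \<bullet> V) * v \<le> B * (1 + B) * P"
  proof -
    have "(cx \<bullet> V) * v \<le> (B * ((1 + B) * v powr q)) * v" using vecb[OF c(3)] v0 by (intro mult_right_mono) auto
    then show ?thesis using vP(4) by (simp add: mult.assoc)
  qed
  have fx: "- (fx \<bullet> V) \<le> B * (1 + B) * P"
  proof -
    have "- (fx \<bullet> V) \<le> B * ((1 + B) * v powr q)" using vecb[OF f(2)] by simp
    also have "\<dots> \<le> B * ((1 + B) * P)" using B vP by (intro mult_left_mono) auto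
    finally show ?thesis by (simp add: mult.assoc)
  qed
  have czt: "cz * (p \<bullet> V) * v \<le> 0" using c(4) large(3) v0 by (simp add: mult_nonpos_nonneg)
  have fzt: "fz * (p \<bullet> V) \<ge> 0" using f(3) large(3) by simp
  have "\<tau> \<bullet> V \<le> n * (L * w + (B + 2 * B\<^sup>2 / \<kappa> q) * P) + B * (L * w + B * P) + 2 * (B * (1 + B) * P)"
    using sum cterm cx fx czt fzt unfolding tau by (simp add: algebra_simps)
  also have "\<dots> = (n * L + B * L) * w + (n * (B + 2 * B\<^sup>2 / \<kappa> q) + 2 * B * (1 + B) + B\<^sup>2) * P"
    by (simp add: algebra_simps power2_eq_square)
  also have "\<dots> \<le> (n * L + B * L) * w + (n * (B + 2 * B\<^sup>2 / \<kappa> q) + 2 * B * (1 + B) + B\<^sup>2) * (2 * (1 + q) * w)"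
    using B kpos by (intro add_left_mono mult_left_mono P) (simp add: n_def)
  finally have "\<tau> \<bullet> V \<le> (n * L + B * L + 2 * (1 + q) * (n * (B + 2 * B\<^sup>2 / \<kappa> q) + 2 * B * (1 + B) + B\<^sup>2)) * w"
    by (simp add: algebra_simps)
  then show ?thesis by (simp add: inner_commute V_def v_def p_def w_def n_def)
qed

text \<open>
  Let \<open>pt\<close> be the tangential part of \<open>p\<close>; then \<open>V = v\<^bsup>q-1\<^esup> pt\<close> by the boundary condition. The tangential
  criticality with \<open>\<tau> = pt\<close> bounds \<open>pt \<bullet> U pt\<close>, and the differentiated boundary condition with
  \<open>\<tau> = pt\<close> expresses \<open>(1 - \<theta>) \<nu> \<bullet> U pt\<close> by this and lower order terms. Here \<open>\<theta>\<close> measures the obliqueness lost through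
  the dependence of the boundary condition on \<open>v\<close>, and \<open>|\<theta>| \<le> 1/2\<close> for large \<open>v\<close>. By symmetry of \<open>U\<close> this
  bounds the normal derivative of the test quantity, so \<open>\<mu>\<close> cannot be large.
\<close>

lemma boundary_inequality:
  fixes p \<nu> :: "real ^ 'n" and B q \<eta> :: real
  assumes eta: "0 < \<eta>" "\<eta> \<le> 1" and q: "0 < q"
    and v: "v = slope \<eta> p" "2 \<le> v" "2 * (1 + q) * B \<le> v powr q" "2 * \<bar>1 - q\<bar> * B\<^sup>2 \<le> v powr (2 * q)"
    and w: "w = v powr (1 + q) / (1 + q) - X \<bullet> p"
    and V: "V = v powr (q - 1) *\<^sub>R p - X"
    and nu: "norm \<nu> = 1" and X: "X = \<phi> *\<^sub>R \<nu>" and BC: "p \<bullet> \<nu> = \<phi> * v powr (1 - q)"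
    and bounds: "\<bar>\<phi>\<bar> \<le> B" "\<And>h. norm (X' h) \<le> B * norm h" "\<And>h. norm (N' h) \<le> B * norm h" "\<And>h. \<bar>\<phi>' h\<bar> \<le> B * norm h"
    and U_sym: "\<And>h k. U h \<bullet> k = U k \<bullet> h" and U_lin: "linear U"
    and tangential: "\<And>\<tau>. \<tau> \<bullet> \<nu> = 0 \<Longrightarrow> V \<bullet> U \<tau> - X' \<tau> \<bullet> p = 0"
    and BC': "\<And>\<tau>. \<tau> \<bullet> \<nu> = 0 \<Longrightarrow> N' \<tau> \<bullet> p + \<nu> \<bullet> U \<tau>
      = \<phi>' \<tau> * v powr (1 - q) + \<phi> * ((1 - q) * v powr (- 1 - q) * (p \<bullet> U \<tau>))"
    and normal: "\<mu> * w \<le> V \<bullet> U \<nu> - X' \<nu> \<bullet> p"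
  shows "\<mu> \<le> 2 * (1 + q) * (5 * B + 2 * \<bar>1 - q\<bar> * B\<^sup>2)"
proof -
  have B: "B \<ge> 0" using bounds(1) by linarith
  have nX: "norm X \<le> B" using bounds(1) nu by (simp add: X)
  note large = large_slope_bounds[OF eta q nX v(1-3) w V]
  have v0: "v > 0" using v by simp
  have np: "norm p \<le> v" unfolding v(1) by (rule norm_le_slope)
  define P where "P = v powr (1 + q)"
  define r where "r = v powr (q - 1)"
  have r: "r > 0" using v0 by (simp add: r_def)
  have r1: "v powr (1 - q) * r = 1" using v0 by (simp add: r_def powr_add[symmetric])
  have rP: "r * v * v = P"
    using v0 powr_add[of v "q - 1" 2] by (simp add: r_def P_def power2_eq_square mult.assoc)
  have vP: "v \<le> P" "v powr (1 - q) \<le> P"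
    using v(2) q powr_mono[of 1 "1 + q" v] by (auto simp: P_def intro: powr_mono)
  define pt where "pt = p - (p \<bullet> \<nu>) *\<^sub>R \<nu>"
  have nn: "\<nu> \<bullet> \<nu> = 1" using nu by (simp add: dot_square_norm)
  have ptn: "pt \<bullet> \<nu> = 0" by (simp add: pt_def inner_diff_left nn)
  have Vpt: "V = r *\<^sub>R pt"
    using r1 unfolding V X pt_def BC r_def[symmetric] by (simp add: algebra_simps)
  have npt: "norm pt \<le> v"
  proof -
    have "p = pt + (p \<bullet> \<nu>) *\<^sub>R \<nu>" by (simp add: pt_def)
    then have "(norm p)\<^sup>2 = (norm pt)\<^sup>2 + (norm ((p \<bullet> \<nu>) *\<^sub>R \<nu>))\<^sup>2"
      using norm_add_Pythagorean[of pt "(p \<bullet> \<nu>) *\<^sub>R \<nu>"] ptn by (simp add: orthogonal_def)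
    then have "(norm pt)\<^sup>2 \<le> (norm p)\<^sup>2" by simp
    then have "norm pt \<le> norm p" by (rule power2_le_imp_le) simp
    then show ?thesis using np by simp
  qed
  have bb: "\<bar>L pt \<bullet> p\<bar> \<le> B * v * v" if "\<And>h. norm (L h) \<le> B * norm h" for L :: "real ^ 'n \<Rightarrow> real ^ 'n"
    by (rule order_trans[OF Cauchy_Schwarz_ineq2], rule mult_mono, rule order_trans[OF that])
      (use np npt B v0 in \<open>auto intro: mult_left_mono\<close>)
  have tt: "\<bar>r * (pt \<bullet> U pt)\<bar> \<le> B * v * v"
    using tangential[OF ptn] bb[OF bounds(2)] by (simp add: Vpt)
  define z where "z = V \<bullet> U \<nu>"
  have z: "z = r * (\<nu> \<bullet> U pt)" using U_sym[of \<nu> pt] by (simp add: z_def Vpt inner_commute)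
  have pU: "p \<bullet> U pt = pt \<bullet> U pt + \<phi> * v powr (1 - q) * (\<nu> \<bullet> U pt)"
    using BC by (simp add: pt_def inner_diff_left)
  have s1: "v powr (- 1 - q) * v powr (1 - q) = v powr (- (2 * q))"
    using v0 by (simp add: powr_add[symmetric])
  define \<theta> where "\<theta> = (1 - q) * \<phi>\<^sup>2 * v powr (- (2 * q))"
  have "z * (1 - \<theta>) = \<phi>' pt - r * (N' pt \<bullet> p) + \<phi> * ((1 - q) * v powr (- 1 - q) * (r * (pt \<bullet> U pt)))"
  proof -
    have "r * (\<nu> \<bullet> U pt) = r * (\<phi>' pt * v powr (1 - q)) - r * (N' pt \<bullet> p)
        + r * (\<phi> * ((1 - q) * v powr (- 1 - q) * (p \<bullet> U pt)))"
    proof -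
      have e: "\<nu> \<bullet> U pt = \<phi>' pt * v powr (1 - q) - N' pt \<bullet> p + \<phi> * ((1 - q) * v powr (- 1 - q) * (p \<bullet> U pt))"
        using BC'[OF ptn] by linarith
      show ?thesis by (subst e) (simp only: distrib_left right_diff_distrib)
    qed
    also have "r * (\<phi>' pt * v powr (1 - q)) = \<phi>' pt" using r1 by (simp add: algebra_simps)
    also have "r * (\<phi> * ((1 - q) * v powr (- 1 - q) * (p \<bullet> U pt)))
      = \<phi> * ((1 - q) * v powr (- 1 - q) * (r * (pt \<bullet> U pt))) + (1 - q) * \<phi>\<^sup>2 * (v powr (- 1 - q) * v powr (1 - q)) * (r * (\<nu> \<bullet> U pt))"
      unfolding pU by (simp add: algebra_simps power2_eq_square)
    finally show ?thesis unfolding z \<theta>_def s1 by (simp add: algebra_simps)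
  qed
  note zeq = this
  have th: "\<bar>\<theta>\<bar> \<le> 1 / 2"
  proof -
    have "\<phi>\<^sup>2 \<le> B\<^sup>2" using power_mono[OF bounds(1), of 2] by simp
    then have "\<bar>1 - q\<bar> * \<phi>\<^sup>2 \<le> \<bar>1 - q\<bar> * B\<^sup>2" by (intro mult_left_mono) auto
    then have "\<bar>1 - q\<bar> * \<phi>\<^sup>2 \<le> v powr (2 * q) / 2" using v(4) by simp
    then have "\<bar>1 - q\<bar> * \<phi>\<^sup>2 * v powr (- (2 * q)) \<le> v powr (2 * q) / 2 * v powr (- (2 * q))"
      by (intro mult_right_mono) auto
    also have "\<dots> = 1 / 2" using v0 by (simp add: powr_minus)
    finally show ?thesis by (simp add: \<theta>_def abs_mult)
  qed
  have b1: "\<bar>\<phi>' pt\<bar> \<le> B * P"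
    by (rule order_trans[OF bounds(4)]) (use npt vP B in \<open>auto intro!: mult_left_mono\<close>)
  have b2: "\<bar>r * (N' pt \<bullet> p)\<bar> \<le> B * P"
  proof -
    have "\<bar>r * (N' pt \<bullet> p)\<bar> \<le> r * (B * v * v)"
      unfolding abs_mult abs_of_pos[OF r] using r by (intro mult_left_mono bb bounds(3)) auto
    also have "\<dots> = B * (r * v * v)" by (simp add: algebra_simps)
    finally show ?thesis unfolding rP .
  qed
  have b3: "\<bar>\<phi> * ((1 - q) * v powr (- 1 - q) * (r * (pt \<bullet> U pt)))\<bar> \<le> \<bar>1 - q\<bar> * B\<^sup>2 * P"
  proof -
    have "\<bar>\<phi> * ((1 - q) * v powr (- 1 - q) * (r * (pt \<bullet> U pt)))\<bar> = \<bar>\<phi>\<bar> * (\<bar>1 - q\<bar> * v powr (- 1 - q) * \<bar>r * (pt \<bullet> U pt)\<bar>)"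
      by (simp add: abs_mult)
    also have "\<dots> \<le> B * (\<bar>1 - q\<bar> * v powr (- 1 - q) * (B * v * v))"
      by (intro mult_mono bounds(1) mult_left_mono tt B mult_nonneg_nonneg) auto
    also have "\<dots> = \<bar>1 - q\<bar> * B\<^sup>2 * (v powr (- 1 - q) * (v * v))" by (simp add: power2_eq_square algebra_simps)
    also have "v powr (- 1 - q) * (v * v) = v powr (1 - q)"
      using v0 powr_add[of v "- 1 - q" 2] by (simp add: power2_eq_square)
    also have "\<bar>1 - q\<bar> * B\<^sup>2 * v powr (1 - q) \<le> \<bar>1 - q\<bar> * B\<^sup>2 * P" using vP by (intro mult_left_mono) auto
    finally show ?thesis .
  qed
  have "z / 2 \<le> (2 * B + \<bar>1 - q\<bar> * B\<^sup>2) * P"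
  proof -
    have "\<bar>z * (1 - \<theta>)\<bar> \<le> (2 * B + \<bar>1 - q\<bar> * B\<^sup>2) * P"
      using b1 b2 b3 unfolding zeq by (simp add: algebra_simps)
    moreover have "\<bar>z\<bar> * (1 / 2) \<le> \<bar>z\<bar> * \<bar>1 - \<theta>\<bar>" using th by (intro mult_left_mono) auto
    ultimately show ?thesis by (simp add: abs_mult)
  qed
  moreover have "- (X' \<nu> \<bullet> p) \<le> B * P"
  proof -
    have "\<bar>X' \<nu> \<bullet> p\<bar> \<le> B * P"
      by (rule order_trans[OF Cauchy_Schwarz_ineq2], rule mult_mono, rule order_trans[OF bounds(2)])
        (use np vP B nu in auto)
    then show ?thesis by simp
  qed
  ultimately have "\<mu> * w \<le> (5 * B + 2 * \<bar>1 - q\<bar> * B\<^sup>2) * P"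
    using normal unfolding z_def by (simp add: algebra_simps)
  also have "\<dots> \<le> (5 * B + 2 * \<bar>1 - q\<bar> * B\<^sup>2) * (2 * (1 + q) * w)"
    using B large(1) by (intro mult_left_mono) (auto simp: P_def)
  finally have "\<mu> * w \<le> (2 * (1 + q) * (5 * B + 2 * \<bar>1 - q\<bar> * B\<^sup>2)) * w" by (simp add: algebra_simps)
  then show ?thesis using large(2) by simp
qed

section \<open>The maximum principle\<close>

lemma vector_derivative_along_curve:
  assumes F: "(F has_derivative F') (at (y a) within A)"
    and y: "(y has_vector_derivative h) (at a within J)" and "y ` J \<subseteq> A"
  shows "((\<lambda>s. F (y s)) has_vector_derivative F' h) (at a within J)"
proof -
  have "((\<lambda>s. F (y s)) has_derivative (\<lambda>r. F' (r *\<^sub>R h))) (at a within J)"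
    by (rule has_derivative_in_compose[OF y[unfolded has_vector_derivative_def] has_derivative_subset[OF F assms(3)]])
  then show ?thesis
    using has_derivative_linear[OF F] by (simp add: has_vector_derivative_def linear_cmul)
qed

lemma derivative_nonpos_inward:
  fixes F :: "'a::real_normed_vector \<Rightarrow> real"
  assumes "(F has_derivative F') (at x within A)" "\<delta> > 0"
    and "\<And>s. 0 < s \<Longrightarrow> s < \<delta> \<Longrightarrow> x + s *\<^sub>R h \<in> A \<and> F (x + s *\<^sub>R h) \<le> F x"
    and "x \<in> A"
  shows "F' h \<le> 0"
proof (rule ccontr)
  assume "\<not> F' h \<le> 0"
  have "((\<lambda>s. F (x + s *\<^sub>R h)) has_vector_derivative F' h) (at 0 within {0..<\<delta>})"
  proof (rule vector_derivative_along_curve[where F=F and y="\<lambda>s. x + s *\<^sub>R h" and A=A])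
    show "(F has_derivative F') (at (x + 0 *\<^sub>R h) within A)" using assms(1) by simp
    show "((\<lambda>s. x + s *\<^sub>R h) has_vector_derivative h) (at 0 within {0..<\<delta>})"
      by (auto intro!: derivative_eq_intros)
    show "(\<lambda>s. x + s *\<^sub>R h) ` {0..<\<delta>} \<subseteq> A"
    proof
      fix z assume "z \<in> (\<lambda>s. x + s *\<^sub>R h) ` {0..<\<delta>}"
      then obtain s where "z = x + s *\<^sub>R h" "s \<in> {0..<\<delta>}" by blast
      then show "z \<in> A" using assms(3)[of s] assms(4) by (cases "s = 0") auto
    qed
  qed
  then have "((\<lambda>s. F (x + s *\<^sub>R h)) has_real_derivative F' h) (at 0 within {0..<\<delta>})"
    by (simp add: has_real_derivative_iff_has_vector_derivative)
  from has_real_derivative_pos_inc_right[OF this] \<open>\<not> F' h \<le> 0\<close>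
  obtain d where d: "d > 0" "\<And>s. 0 < s \<Longrightarrow> 0 + s \<in> {0..<\<delta>} \<Longrightarrow> s < d \<Longrightarrow> F (x + 0 *\<^sub>R h) < F (x + (0 + s) *\<^sub>R h)"
    by auto
  define s where "s = min d \<delta> / 2"
  have "0 < s" "s < d" "s < \<delta>" using d(1) assms(2) by (auto simp: s_def)
  then show False using d(2)[of s] assms(3)[of s] by simp
qed

lemma derivative_zero_along_boundary_curve:
  fixes F :: "'a::real_normed_vector \<Rightarrow> real"
  assumes F: "(F has_derivative F') (at x within A)" and d: "\<delta> > 0"
    and y: "y 0 = x" "(y has_vector_derivative h) (at 0)"
    and mem: "\<And>s. \<bar>s\<bar> < \<delta> \<Longrightarrow> y s \<in> A" and max: "\<And>s. \<bar>s\<bar> < \<delta> \<Longrightarrow> F (y s) \<le> F x"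
  shows "F' h = 0"
proof -
  have o: "at 0 within ball 0 \<delta> = (at 0 :: real filter)" using d by (intro at_within_open) auto
  have "((\<lambda>s. F (y s)) has_vector_derivative F' h) (at 0 within ball 0 \<delta>)"
    by (rule vector_derivative_along_curve[where A=A and F=F and y=y])
      (use F y mem has_vector_derivative_at_within in \<open>auto simp: o\<close>)
  then have "((\<lambda>s. F (y s)) has_real_derivative F' h) (at 0)"
    unfolding o by (simp add: has_real_derivative_iff_has_vector_derivative)
  then show ?thesis by (rule DERIV_local_max[OF _ d]) (use max y in auto)
qed

text \<open>
  The three properties of the normal on which the boundary argument rests: unit length, inward rays enter
  \<open>\<Omega>\<close>, and every orthogonal direction is tangent to a curve in the frontier.
\<close>

lemma outward_normal_geometry:
  assumes "open \<Omega>" "x \<in> frontier \<Omega>" "outward_unit_normal \<Omega> x \<nu>"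
  shows "norm \<nu> = 1"
    and "\<exists>\<delta>>0. \<forall>s. 0 < s \<and> s < \<delta> \<longrightarrow> x + s *\<^sub>R (- \<nu>) \<in> \<Omega>"
    and "\<tau> \<bullet> \<nu> = 0 \<Longrightarrow> \<exists>\<delta>>0. \<exists>y. y 0 = x \<and> (\<forall>s. \<bar>s\<bar> < \<delta> \<longrightarrow> y s \<in> frontier \<Omega>) \<and> (y has_vector_derivative \<tau>) (at 0)"
proof -
  obtain r e \<gamma> where g: "graph_chart 1 \<Omega> x r e \<gamma>" "\<nu> = sgn (grad \<gamma> x - e)"
    using assms(3) unfolding outward_unit_normal_def by blast
  interpret chart \<Omega> x r e \<gamma> using assms(1) g(1) by unfold_locales
  define n where "n = grad \<gamma> x - e"
  have ne: "n \<noteq> 0" using grad_vertical[of x] e_e by (auto simp: n_def)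
  show "norm \<nu> = 1" using ne by (simp add: g(2) norm_sgn n_def)
  have n: "n = norm n *\<^sub>R \<nu>" using ne by (simp add: g(2) n_def[symmetric] sgn_div_norm)
  have "n \<bullet> (- \<nu>) < 0" using ne by (simp add: g(2) n_def[symmetric] sgn_div_norm)
  then show "\<exists>\<delta>>0. \<forall>s. 0 < s \<and> s < \<delta> \<longrightarrow> x + s *\<^sub>R (- \<nu>) \<in> \<Omega>"
    unfolding n_def by (rule inward_mem[OF assms(2)])
  assume "\<tau> \<bullet> \<nu> = 0"
  then have "n \<bullet> \<tau> = 0" by (subst n) (simp add: inner_commute)
  then show "\<exists>\<delta>>0. \<exists>y. y 0 = x \<and> (\<forall>s. \<bar>s\<bar> < \<delta> \<longrightarrow> y s \<in> frontier \<Omega>) \<and> (y has_vector_derivative \<tau>) (at 0)"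
    unfolding n_def by (rule boundary_curve[OF assms(2)])
qed

lemma dir_deriv_eq:
  fixes f :: "'a::real_normed_vector \<Rightarrow> real"
  assumes "(f has_derivative f') (at x)"
  shows "dir_deriv b f x = f' b"
proof -
  have "((\<lambda>s. f (x + s *\<^sub>R b)) has_vector_derivative f' b) (at 0)"
    by (rule has_vector_derivative_along_line) (use assms in simp)
  then show ?thesis
    unfolding dir_deriv_def by (intro DERIV_imp_deriv) (simp add: has_real_derivative_iff_has_vector_derivative)
qed

text \<open>
  The divergence form expands to the trace of the Hessian against the matrix \<open>I - Du Du\<^sup>T / v\<^sup>2\<close>.
\<close>

lemma mean_curvature_operator:
  fixes g :: "real ^ 'n \<Rightarrow> real ^ 'n"
  assumes "0 < \<eta>" "(g has_derivative U) (at x)" and sym: "\<And>h k. U h \<bullet> k = U k \<bullet> h"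
  shows "slope \<eta> (g x) * divergence (\<lambda>y. g y /\<^sub>R slope \<eta> (g y)) x
    = (\<Sum>i\<in>UNIV. U (axis i 1) \<bullet> axis i 1) - (U (g x) \<bullet> g x) * slope \<eta> (g x) powr (- 2)"
proof -
  define v where "v = slope \<eta> (g x)"
  have v: "v > 0" using slope_pos[OF assms(1)] by (simp add: v_def)
  have "dir_deriv (axis i 1) (\<lambda>y. (g y /\<^sub>R slope \<eta> (g y)) $ i) x
     = ((- 1) * v powr (- 1 - 2) * (g x \<bullet> U (axis i 1))) * (g x $ i) + v powr (- 1) * (U (axis i 1) $ i)" for i
  proof (rule trans[OF dir_deriv_eq])
    have "((\<lambda>y. slope \<eta> (g y) powr (- 1) * (g y $ i)) has_derivative
      (\<lambda>h. slope \<eta> (g x) powr (- 1) * (U h $ i) + ((- 1) * slope \<eta> (g x) powr (- 1 - 2) * (g x \<bullet> U h)) * (g x $ i))) (at x)"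
      by (intro has_derivative_mult slope_powr_has_derivative assms(1,2)
          bounded_linear.has_derivative[OF bounded_linear_vec_nth])
    moreover have "(g y /\<^sub>R slope \<eta> (g y)) $ i = slope \<eta> (g y) powr (- 1) * (g y $ i)" for y
      using slope_pos[OF assms(1), of "g y"] by (simp add: powr_minus)
    ultimately show "((\<lambda>y. (g y /\<^sub>R slope \<eta> (g y)) $ i) has_derivative
      (\<lambda>h. slope \<eta> (g x) powr (- 1) * (U h $ i) + ((- 1) * slope \<eta> (g x) powr (- 1 - 2) * (g x \<bullet> U h)) * (g x $ i))) (at x)"
      by simp
  qed (simp add: v_def)
  then have "v * divergence (\<lambda>y. g y /\<^sub>R slope \<eta> (g y)) x
    = (\<Sum>i\<in>UNIV. v * (((- 1) * v powr (- 1 - 2) * (g x \<bullet> U (axis i 1))) * (g x $ i) + v powr (- 1) * (U (axis i 1) $ i)))"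
    by (simp only: divergence_def sum_distrib_left)
  also have "\<dots> = (\<Sum>i\<in>UNIV. U (axis i 1) \<bullet> axis i 1 - v powr (- 2) * (U (g x) $ i * g x $ i))"
  proof (rule sum.cong[OF refl])
    fix i
    have 1: "v * v powr (- 1 - 2) = v powr (- 2)" using v powr_add[of v 1 "- 3"] by simp
    have 2: "v * v powr (- 1) = 1" using v by (simp add: powr_minus)
    have 3: "g x \<bullet> U (axis i 1) = U (g x) $ i"
    proof -
      have "g x \<bullet> U (axis i 1) = U (axis i 1) \<bullet> g x" by (rule inner_commute)
      also have "\<dots> = U (g x) \<bullet> axis i 1" by (rule sym)
      finally show ?thesis by (simp add: inner_axis)
    qed
    have "v * (((- 1) * v powr (- 1 - 2) * (g x \<bullet> U (axis i 1))) * (g x $ i) + v powr (- 1) * (U (axis i 1) $ i))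
      = - ((v * v powr (- 1 - 2)) * (g x \<bullet> U (axis i 1)) * (g x $ i)) + (v * v powr (- 1)) * (U (axis i 1) $ i)"
      by (simp add: algebra_simps)
    then show "v * (((- 1) * v powr (- 1 - 2) * (g x \<bullet> U (axis i 1))) * (g x $ i) + v powr (- 1) * (U (axis i 1) $ i))
      = U (axis i 1) \<bullet> axis i 1 - v powr (- 2) * (U (g x) $ i * g x $ i)"
      unfolding 1 2 3 by (simp add: inner_axis)
  qed
  also have "\<dots> = (\<Sum>i\<in>UNIV. U (axis i 1) \<bullet> axis i 1) - (U (g x) \<bullet> g x) * v powr (- 2)"
    by (simp add: sum_subtractf inner_vec_def[of "U (g x)"] sum_distrib_left mult.commute)
  finally show ?thesis unfolding v_def .
qed

text \<open>
  Powers of \<open>v\<close> with exponents \<open>q\<close> and \<open>2 q\<close> tend to infinity because \<open>q > 0\<close>.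
\<close>

lemma large_threshold:
  fixes q B :: real
  assumes "0 < q" "0 \<le> B"
  obtains V0 where "2 \<le> V0" "\<And>v. V0 \<le> v \<Longrightarrow> 2 * (1 + q) * B \<le> v powr q \<and> B\<^sup>2 \<le> min 1 q * v powr (2 * q)
    \<and> 2 * \<bar>1 - q\<bar> * B\<^sup>2 \<le> v powr (2 * q)"
proof -
  define Z where "Z = 1 + 2 * (1 + q) * B + B\<^sup>2 / min 1 q + 2 * \<bar>1 - q\<bar> * B\<^sup>2"
  have k: "0 < min 1 q" using assms by simp
  have nn: "0 \<le> 2 * (1 + q) * B" "0 \<le> B\<^sup>2 / min 1 q" "0 \<le> 2 * \<bar>1 - q\<bar> * B\<^sup>2"
    using assms k by auto
  have Z: "1 \<le> Z" "2 * (1 + q) * B \<le> Z" "B\<^sup>2 / min 1 q \<le> Z" "2 * \<bar>1 - q\<bar> * B\<^sup>2 \<le> Z"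
    using nn by (auto simp: Z_def)
  show ?thesis
  proof (rule that[of "max 2 (Z powr (1 / q))"])
    fix v assume v: "max 2 (Z powr (1 / q)) \<le> v"
    have "(Z powr (1 / q)) powr q \<le> v powr q" using v assms(1) by (intro powr_mono2) auto
    then have vq: "Z \<le> v powr q" using Z(1) assms(1) by (simp add: powr_powr)
    have "v powr (2 * q) = v powr q * v powr q" by (simp add: powr_add[symmetric])
    moreover have "1 * v powr q \<le> v powr q * v powr q" using vq Z(1) by (intro mult_right_mono) auto
    ultimately have v2q: "Z \<le> v powr (2 * q)" using vq by simp
    have "B\<^sup>2 \<le> min 1 q * v powr (2 * q)"
      using order_trans[OF Z(3) v2q] k by (simp add: field_simps)
    then show "2 * (1 + q) * B \<le> v powr q \<and> B\<^sup>2 \<le> min 1 q * v powr (2 * q) \<and> 2 * \<bar>1 - q\<bar> * B\<^sup>2 \<le> v powr (2 * q)"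
      using Z vq v2q by linarith
  qed simp
qed

text \<open>
  Everything that the gradient bound may depend on; the single constant \<open>B\<close> bounds all given functions and
  \<open>G0\<close> bounds the initial gradient. From \<open>V0\<close> on, the slope is large enough for both inequalities of the
  preceding section. Neither \<open>\<eta>\<close> nor the solution occurs, which makes the uniformity of the final bound evident.
\<close>

locale barrier_data =
  fixes \<Omega> :: "(real ^ 'n) set" and \<nu> :: "real ^ 'n \<Rightarrow> real ^ 'n" and c f :: "(real ^ 'n) \<times> real \<Rightarrow> real"
    and \<phi> :: "real ^ 'n \<Rightarrow> real" and \<phi>' \<phi>'' N N' N'' \<zeta> \<zeta>' \<zeta>'' X' X'' and B q T V0 G0 :: real
  assumes dom: "open \<Omega>" "bounded \<Omega>" "\<Omega> \<noteq> {}"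
    and normal: "\<And>x. x \<in> frontier \<Omega> \<Longrightarrow> outward_unit_normal \<Omega> x (\<nu> x)"
    and q: "0 < q" and T: "0 < T" and G0: "0 \<le> G0"
    and phi_C2: "C2_bounds \<Omega> \<phi> \<phi>' \<phi>'' B" and N_C2: "C2_bounds \<Omega> N N' N'' B"
    and X_C2: "C2_bounds \<Omega> (\<lambda>x. \<phi> x *\<^sub>R N x) X' X'' B" and zeta_C2: "C2_bounds \<Omega> \<zeta> \<zeta>' \<zeta>'' B"
    and N_frontier: "\<And>x. x \<in> frontier \<Omega> \<Longrightarrow> N x = \<nu> x"
    and zeta_frontier: "\<And>x. x \<in> frontier \<Omega> \<Longrightarrow> \<zeta> x = 0"
      "\<And>x. x \<in> frontier \<Omega> \<Longrightarrow> \<exists>m\<ge>1. \<forall>h. \<zeta>' x h = - m * (\<nu> x \<bullet> h)"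
    and c: "\<And>x z. x \<in> \<Omega> \<Longrightarrow> (c has_derivative (\<lambda>h. grad_x c (x, z) \<bullet> fst h + deriv_snd c (x, z) * snd h)) (at (x, z))"
      "\<And>x z. x \<in> \<Omega> \<Longrightarrow> \<bar>c (x, z)\<bar> \<le> B" "\<And>x z. x \<in> \<Omega> \<Longrightarrow> norm (grad_x c (x, z)) \<le> B"
      "\<And>x z. x \<in> \<Omega> \<Longrightarrow> deriv_snd c (x, z) \<le> 0"
    and f: "\<And>x z. x \<in> \<Omega> \<Longrightarrow> (f has_derivative (\<lambda>h. grad_x f (x, z) \<bullet> fst h + deriv_snd f (x, z) * snd h)) (at (x, z))"
      "\<And>x z. x \<in> \<Omega> \<Longrightarrow> norm (grad_x f (x, z)) \<le> B"
      "\<And>x z. x \<in> \<Omega> \<Longrightarrow> deriv_snd f (x, z) \<ge> 0"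
    and V0: "2 \<le> V0" "\<And>v. V0 \<le> v \<Longrightarrow> 2 * (1 + q) * B \<le> v powr q \<and> B\<^sup>2 \<le> min 1 q * v powr (2 * q)
      \<and> 2 * \<bar>1 - q\<bar> * B\<^sup>2 \<le> v powr (2 * q)"
begin

lemmas B = C2_boundsD(1)[OF phi_C2]
lemmas phi = C2_boundsD(2-4)[OF phi_C2, unfolded real_norm_def]
lemmas N = C2_boundsD(2,4)[OF N_C2] N_frontier
lemmas X = C2_boundsD(2,5,3,4,6)[OF X_C2]
lemmas zeta = C2_boundsD(2,5,3,4,6)[OF zeta_C2, unfolded real_norm_def] zeta_frontier

definition X where "X x = \<phi> x *\<^sub>R N x"

text \<open>
  The weight is \<open>exp (boundary_rate * \<zeta> - time_rate * t)\<close>. The boundary rate exceeds by one what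
  \<open>boundary_inequality\<close> allows, and the time rate exceeds by one what \<open>interior_inequality\<close> allows for the
  barrier with logarithm \<open>- boundary_rate * \<zeta>\<close>, whose derivatives are controlled by \<open>hess_rate\<close>.
  \<open>base_level\<close> dominates the weighted quantity wherever the slope is at most \<open>V0 + G0 + 1\<close>.
\<close>

definition boundary_rate where
  "boundary_rate = 1 + 2 * (1 + q) * (5 * B + 2 * \<bar>1 - q\<bar> * B\<^sup>2)"

definition hess_rate where "hess_rate = boundary_rate\<^sup>2 * B\<^sup>2 + boundary_rate * B"

definition time_rate where
  "time_rate = 1 + (CARD('n) * hess_rate + B * hess_rate
    + 2 * (1 + q) * (CARD('n) * (B + 2 * B\<^sup>2 / min 1 q) + 2 * B * (1 + B) + B\<^sup>2))"

definition base_level where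
  "base_level = ((V0 + G0 + 1) powr (1 + q) + B * (V0 + G0 + 1)) * exp (boundary_rate * B)"

definition top_level where "top_level = base_level * exp (boundary_rate * B + time_rate * T)"

definition gradient_bound where "gradient_bound = V0 + 2 * (1 + q) * top_level"

lemma frontier_closure: "x \<in> frontier \<Omega> \<Longrightarrow> x \<in> closure \<Omega>" by (simp add: frontier_def)

lemma closure_cases: "x \<in> closure \<Omega> \<Longrightarrow> x \<in> \<Omega> \<or> x \<in> frontier \<Omega>"
  using dom(1) by (auto simp: frontier_def interior_open)

lemma mem_closure: "x \<in> \<Omega> \<Longrightarrow> x \<in> closure \<Omega>" using closure_subset by blast

lemma boundary_rate_pos: "boundary_rate \<ge> 1"
  unfolding boundary_rate_def using q B by simp

lemma hess_rate_nonneg: "hess_rate \<ge> 0"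
  unfolding hess_rate_def using boundary_rate_pos B by simp

lemma time_rate_pos: "time_rate \<ge> 1"
  unfolding time_rate_def using hess_rate_nonneg q B by simp

lemma base_level_pos: "base_level > 0"
  unfolding base_level_def using V0(1) G0 B by (intro mult_pos_pos add_pos_nonneg) auto

end

text \<open>
  The assumption \<open>initial\<close> is stated for the extended gradient at time \<open>0\<close>; \<open>initial_gradient_bound\<close>
  derives it from the initial values.
\<close>

locale barrier_solution = barrier_data \<Omega> \<nu> c f \<phi> \<phi>' \<phi>'' N N' N'' \<zeta> \<zeta>' \<zeta>'' X' X'' B q T V0 G0
  for \<Omega> :: "(real ^ 'n) set" and \<nu> and c and f and \<phi> and \<phi>' and \<phi>'' and N and N' and N'' and \<zeta> and \<zeta>' and \<zeta>'' and X' and X'' and B and q and T and V0 and G0 +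
  fixes \<eta> and u :: "(real ^ 'n) \<times> real \<Rightarrow> real" and S
  assumes eta: "0 < \<eta>" "\<eta> \<le> 1"
    and reg2: "weighted_C parabolic_weight 2 (\<Omega> \<times> {0<..<T}) (closure \<Omega> \<times> {0..T}) u"
    and reg3: "weighted_C parabolic_weight 3 (\<Omega> \<times> {0<..<T}) S u" "\<Omega> \<times> {0<..<T} \<subseteq> S"
    and pde: "\<And>x t. x \<in> \<Omega> \<Longrightarrow> t \<in> {0<..<T} \<Longrightarrow>
        deriv_snd u (x, t) =
          slope \<eta> (grad_x u (x, t)) * divergence (\<lambda>y. grad_x u (y, t) /\<^sub>R slope \<eta> (grad_x u (y, t))) x
          + c (x, u (x, t)) * slope \<eta> (grad_x u (x, t)) - f (x, u (x, t))"
    and bc: "\<And>x t. x \<in> frontier \<Omega> \<Longrightarrow> t \<in> {0..<T} \<Longrightarrow>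
        ext (\<Omega> \<times> {0<..<T}) (grad_x u) (x, t) \<bullet> \<nu> x =
          \<phi> x * slope \<eta> (ext (\<Omega> \<times> {0<..<T}) (grad_x u) (x, t)) powr (1 - q)"
    and initial: "\<And>x. x \<in> closure \<Omega> \<Longrightarrow> norm (ext (\<Omega> \<times> {0<..<T}) (grad_x u) (x, 0)) \<le> G0"
begin

sublocale smooth_interior \<Omega> T S u
  using dom(1) reg3 by unfold_locales

definition G where "G = ext (\<Omega> \<times> {0<..<T}) (grad_x u)"

lemma charts: "x \<in> frontier \<Omega> \<Longrightarrow> \<exists>r e \<gamma>. graph_chart 1 \<Omega> x r e \<gamma>"
  using normal unfolding outward_unit_normal_def by blast

lemmas ext_grad = extended_gradient[OF dom(1) T charts reg2, folded G_def]

definition w where "w p = test_quantity \<eta> q (X (fst p)) (G p)"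

lemma continuous_w: "continuous_on (closure \<Omega> \<times> {0..T}) w"
proof -
  have "continuous_on (closure \<Omega>) X"
    unfolding X_def[abs_def] by (rule C2_upto_continuous) (use X_C2 in \<open>auto simp: C2_upto_def\<close>)
  then have "continuous_on (closure \<Omega> \<times> {0..T}) (\<lambda>p. X (fst p))"
    by (rule continuous_on_compose2) (auto intro!: continuous_intros)
  moreover have "continuous_on (closure \<Omega> \<times> {0..T}) (\<lambda>p. slope \<eta> (G p))"
    unfolding slope_def by (intro continuous_intros ext_grad(1))
  moreover have "slope \<eta> (G p) \<noteq> 0" for p using slope_pos[OF eta(1), of "G p"] by simp
  ultimately show ?thesis unfolding w_def test_quantity_def
    using q by (intro continuous_intros ext_grad(1)) auto
qed

lemma w_le:
  assumes "x \<in> closure \<Omega>" "slope \<eta> (G (x, t)) \<le> s"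
  shows "w (x, t) \<le> s powr (1 + q) + B * s"
proof -
  let ?v = "slope \<eta> (G (x, t))"
  have v: "?v > 0" by (rule slope_pos[OF eta(1)])
  have "?v powr (1 + q) / (1 + q) \<le> ?v powr (1 + q)"
    using q by (simp add: divide_le_eq mult_left_le_one_le algebra_simps)
  also have "\<dots> \<le> s powr (1 + q)" using v assms q by (intro powr_mono2) auto
  finally have "?v powr (1 + q) / (1 + q) \<le> s powr (1 + q)" .
  moreover have "\<bar>X x \<bullet> G (x, t)\<bar> \<le> B * s"
  proof (rule order_trans[OF Cauchy_Schwarz_ineq2], rule mult_mono)
    show "norm (X x) \<le> B" using X(3)[OF assms(1)] by (simp add: X_def)
    show "norm (G (x, t)) \<le> s" using norm_le_slope[of "G (x, t)" \<eta>] assms(2) by simp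
  qed (use B in auto)
  ultimately show ?thesis by (simp add: w_def test_quantity_def abs_le_iff)
qed

lemma large_at:
  assumes "x \<in> closure \<Omega>" "V0 \<le> slope \<eta> (G (x, t))"
  shows "slope \<eta> (G (x, t)) powr (1 + q) \<le> 2 * (1 + q) * w (x, t)" "0 < w (x, t)"
proof -
  have "norm (X x) \<le> B" using X(3)[OF assms(1)] by (simp add: X_def)
  note l = large_slope_bounds[OF eta q this refl, of "G (x, t)" "w (x, t)", OF _ _ _ refl]
  show "slope \<eta> (G (x, t)) powr (1 + q) \<le> 2 * (1 + q) * w (x, t)" "0 < w (x, t)"
    using l(1,2) V0(2)[OF assms(2)] V0(1) assms(2) by (auto simp: w_def test_quantity_def)
qed

definition \<Psi> where "\<Psi> p = w p * exp (boundary_rate * \<zeta> (fst p) - time_rate * snd p)"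

text \<open>
  At such a maximum \<open>w\<close> is touched from above by \<open>\<beta> y = w (x, t) * exp (\<rho> * (\<zeta> x - \<zeta> y))\<close> in space, so its time
  derivative is at most \<open>(time_rate - 1) * w\<close>; comparison with earlier times shows that it is at least
  \<open>time_rate * w\<close>.
\<close>

lemma weighted_max_not_interior:
  assumes x: "x \<in> \<Omega>" and t: "0 < t" "t < T" and large: "V0 \<le> slope \<eta> (G (x, t))"
    and max: "\<And>y s. y \<in> closure \<Omega> \<Longrightarrow> 0 \<le> s \<Longrightarrow> s \<le> t \<Longrightarrow> \<Psi> (y, s) \<le> \<Psi> (x, t)"
  shows False
proof -
  define \<rho> where "\<rho> = boundary_rate"
  have rho: "\<rho> \<ge> 1" using boundary_rate_pos by (simp add: \<rho>_def)
  note xc = mem_closure[OF x]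
  have tt: "t \<in> {0<..<T}" using t by simp
  have wpos: "0 < w (x, t)" by (rule large_at(2)[OF xc large])
  have GQ: "G (y, s) = grad_x u (y, s)" if "y \<in> \<Omega>" "s \<in> {0<..<T}" for y s
    using ext_grad(2)[of "(y, s)"] that by simp
  define g where "g y = grad_x u (y, t)" for y
  define \<beta> where "\<beta> y = w (x, t) * exp (\<rho> * (\<zeta> x - \<zeta> y))" for y
  define \<beta>' where "\<beta>' y h = \<beta> y * (- \<rho> * \<zeta>' y h)" for y h
  define \<beta>'' where "\<beta>'' h k = \<beta> x * (- \<rho> * \<zeta>'' x h k) + \<beta>' x k * (- \<rho> * \<zeta>' x h)" for h k
  have zd: "(\<zeta> has_derivative \<zeta>' y) (at y)" if "y \<in> \<Omega>" for y
    using zeta(1)[OF mem_closure[OF that]] at_within_closure_open[OF dom(1) that] by simp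
  have Xd: "(X has_derivative X' y) (at y)" if "y \<in> \<Omega>" for y
    using X(1)[OF mem_closure[OF that]] at_within_closure_open[OF dom(1) that] by (simp add: X_def[abs_def])
  have bd: "(\<beta> has_derivative \<beta>' y) (at y)" if "y \<in> \<Omega>" for y
    unfolding \<beta>_def[abs_def] \<beta>'_def[abs_def] by (auto intro!: derivative_eq_intros zd that simp: \<beta>_def)
  have bx: "\<beta> x = w (x, t)" by (simp add: \<beta>_def)
  have bd2: "((\<lambda>z. \<beta>' z h) has_derivative \<beta>'' h) (at x)" for h
    unfolding \<beta>'_def \<beta>''_def
    by (intro has_derivative_mult has_derivative_mult_right bd[unfolded \<beta>'_def] zeta(2) x)
  have wg: "w (y, t) = test_quantity \<eta> q (X y) (g y)" if "y \<in> \<Omega>" for y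
    using GQ[OF that tt] by (simp add: w_def g_def)
  have touch: "w (y, t) \<le> \<beta> y" if "y \<in> \<Omega>" for y
  proof -
    have "w (y, t) * exp (\<rho> * \<zeta> y - time_rate * t) \<le> w (x, t) * exp (\<rho> * \<zeta> x - time_rate * t)"
      using max[OF mem_closure[OF that], of t] t by (simp add: \<Psi>_def \<rho>_def)
    also have "\<dots> = \<beta> y * exp (\<rho> * \<zeta> y - time_rate * t)"
      unfolding \<beta>_def mult.assoc exp_add[symmetric] by (simp add: algebra_simps)
    finally show ?thesis by simp
  qed
  have Lb: "\<bar>\<beta>' x h\<bar> \<le> hess_rate * \<beta> x * norm h" for h
  proof -
    have "\<bar>\<beta>' x h\<bar> = w (x, t) * (\<rho> * \<bar>\<zeta>' x h\<bar>)" using wpos rho by (simp add: \<beta>'_def bx abs_mult)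
    also have "\<dots> \<le> w (x, t) * (\<rho> * (B * norm h))"
      using wpos rho zeta(4)[OF xc] by (intro mult_left_mono) auto
    also have "\<dots> = (\<rho> * B) * (w (x, t) * norm h)" by simp
    also have "\<dots> \<le> hess_rate * (w (x, t) * norm h)"
      using wpos by (intro mult_right_mono) (auto simp: hess_rate_def \<rho>_def)
    finally show ?thesis by (simp add: bx mult.assoc)
  qed
  have Hb: "\<beta>'' h h \<le> hess_rate * \<beta> x" if h: "norm h \<le> 1" for h
  proof -
    have z1: "\<bar>\<zeta>' x h\<bar> \<le> B" using order_trans[OF zeta(4)[OF xc, of h]] mult_left_mono[OF h B] by simp
    have "norm h * norm h \<le> 1 * 1" using h by (intro mult_mono) auto
    then have z2: "\<bar>\<zeta>'' x h h\<bar> \<le> B"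
      using order_trans[OF zeta(5)[OF x, of h h]] mult_left_mono[of "norm h * norm h" 1 B] B by (simp add: mult.assoc)
    have "(\<zeta>' x h)\<^sup>2 \<le> B\<^sup>2" using power_mono[OF z1, of 2] by simp
    then have "\<rho>\<^sup>2 * (\<zeta>' x h)\<^sup>2 \<le> \<rho>\<^sup>2 * B\<^sup>2" by (intro mult_left_mono) auto
    moreover have "- (\<rho> * \<zeta>'' x h h) \<le> \<rho> * B"
      using z2 rho mult_left_mono[of "- \<zeta>'' x h h" B \<rho>] by simp
    ultimately have "\<rho>\<^sup>2 * (\<zeta>' x h)\<^sup>2 - \<rho> * \<zeta>'' x h h \<le> hess_rate" by (simp add: hess_rate_def \<rho>_def)
    then have "(\<rho>\<^sup>2 * (\<zeta>' x h)\<^sup>2 - \<rho> * \<zeta>'' x h h) * w (x, t) \<le> hess_rate * w (x, t)"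
      using wpos by (intro mult_right_mono) auto
    then show ?thesis by (simp add: \<beta>''_def \<beta>'_def bx power2_eq_square algebra_simps)
  qed
  have eq: "deriv_snd u (y, t) = (\<Sum>i\<in>UNIV. hess_x u (y, t) (axis i 1) \<bullet> axis i 1)
      - (hess_x u (y, t) (g y) \<bullet> g y) * slope \<eta> (g y) powr (- 2) + c (y, u (y, t)) * slope \<eta> (g y) powr 1 - f (y, u (y, t))"
    if "y \<in> \<Omega>" for y
    using pde[OF that tt] mean_curvature_operator[OF eta(1), of g "hess_x u (y, t)" y]
      hess_derivative[OF that tt] hess_sym[OF that tt] slope_pos[OF eta(1), of "g y"]
    by (simp add: g_def[abs_def])
  have v: "slope \<eta> (g x) = slope \<eta> (G (x, t))" using GQ[OF x tt] by (simp add: g_def)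
  define D where "D = (slope \<eta> (g x) powr (q - 1) *\<^sub>R g x - X x) \<bullet> grad_t u (x, t)"
  have "D
    \<le> (CARD('n) * hess_rate + B * hess_rate + 2 * (1 + q) * (CARD('n) * (B + 2 * B\<^sup>2 / min 1 q) + 2 * B * (1 + B) + B\<^sup>2)) * \<beta> x"
    unfolding D_def
  proof (rule interior_inequality[where g=g and X=X and c=c and f=f and u="\<lambda>y. u (y, t)" and ut="\<lambda>y. deriv_snd u (y, t)"
        and U="\<lambda>y. hess_x u (y, t)" and W="\<lambda>y. third_x u (y, t)" and X'=X' and X''="X'' x" and \<beta>=\<beta> and \<beta>'=\<beta>' and \<beta>''=\<beta>''
        and cx="grad_x c (x, u (x, t))" and cz="deriv_snd c (x, u (x, t))"
        and fx="grad_x f (x, u (x, t))" and fz="deriv_snd f (x, u (x, t))", OF dom(1) x eta q])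
    show "(g has_derivative hess_x u (y, t)) (at y)" if "y \<in> \<Omega>" for y
      unfolding g_def[abs_def] by (rule hess_derivative[OF that tt])
    show "((\<lambda>z. hess_x u (z, t) h) has_derivative third_x u (y, t) h) (at y)" if "y \<in> \<Omega>" for y h
      by (rule third_derivative[OF that tt])
    show "linear (\<lambda>h. third_x u (x, t) h k)" for k by (rule third_linear)
    show "hess_x u (x, t) h \<bullet> k = hess_x u (x, t) k \<bullet> h" for h k by (rule hess_sym[OF x tt])
    show "third_x u (x, t) h k \<bullet> l = third_x u (x, t) k h \<bullet> l" for h k l by (rule third_sym(1)[OF x tt])
    show "third_x u (x, t) h k \<bullet> l = third_x u (x, t) l k \<bullet> h" for h k l by (rule third_sym(2)[OF x tt])
    show "((\<lambda>y. u (y, t)) has_derivative (\<lambda>h. g x \<bullet> h)) (at x)"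
      unfolding g_def by (rule grad_derivative[OF x tt])
    show "((\<lambda>y. deriv_snd u (y, t)) has_derivative (\<lambda>h. grad_t u (x, t) \<bullet> h)) (at x)"
      by (rule space_derivative_of_dt[OF x tt])
    show "norm (X x) \<le> B" "\<And>h. norm (X' x h) \<le> B * norm h" using X(3,4)[OF xc] by (auto simp: X_def)
    show "2 \<le> slope \<eta> (g x)" "2 * (1 + q) * B \<le> slope \<eta> (g x) powr q" "B\<^sup>2 \<le> min 1 q * slope \<eta> (g x) powr (2 * q)"
      unfolding v using V0(1) V0(2)[OF large] large by auto
    show "test_quantity \<eta> q (X y) (g y) \<le> \<beta> y" if "y \<in> \<Omega>" for y using touch[OF that] wg[OF that] by simp
    show "test_quantity \<eta> q (X x) (g x) = \<beta> x" using wg[OF x] bx by simp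
  qed (use eq c f X(2,5) x Xd bd bd2 Lb Hb hess_rate_nonneg in auto)
  then have upper: "D \<le> (time_rate - 1) * w (x, t)"
    by (simp add: bx time_rate_def)

  have gt: "((\<lambda>s. grad_x u (x, s)) has_derivative (\<lambda>h. h *\<^sub>R grad_t u (x, t))) (at t)"
    using time_derivative_of_grad[OF x tt] by (simp add: has_vector_derivative_def)
  \<comment> \<open>\<open>k\<close> compares \<open>w (x, s)\<close> at earlier times with the exponential that maximality of \<open>\<Psi>\<close> allows\<close>
  define k where "k s = test_quantity \<eta> q (X x) (grad_x u (x, s)) - w (x, t) * exp (time_rate * (s - t))" for s
  have "((\<lambda>s. test_quantity \<eta> q (X x) (grad_x u (x, s))) has_derivative
     (\<lambda>h. (slope \<eta> (grad_x u (x, t)) powr (q - 1) *\<^sub>R grad_x u (x, t) - X x) \<bullet> (h *\<^sub>R grad_t u (x, t)) - 0 \<bullet> grad_x u (x, t))) (at t)"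
    by (rule test_quantity_has_derivative[OF eta(1) q gt]) simp
  then have "((\<lambda>s. test_quantity \<eta> q (X x) (grad_x u (x, s))) has_real_derivative
     D) (at t)"
    by (simp add: D_def has_field_derivative_def g_def mult.commute[of _ "_ \<bullet> _"])
  then have kd: "(k has_real_derivative D - time_rate * w (x, t)) (at t)"
    unfolding k_def by (auto intro!: derivative_eq_intros)
  have kt: "k t = 0" using wg[OF x] by (simp add: k_def g_def)
  have k0: "k s \<le> 0" if "0 < s" "s \<le> t" for s
  proof -
    have "w (x, s) * exp (\<rho> * \<zeta> x - time_rate * s) \<le> w (x, t) * exp (\<rho> * \<zeta> x - time_rate * t)"
      using max[OF xc, of s] that by (simp add: \<Psi>_def \<rho>_def)
    also have "\<dots> = (w (x, t) * exp (time_rate * (s - t))) * exp (\<rho> * \<zeta> x - time_rate * s)"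
      unfolding mult.assoc exp_add[symmetric] by (simp add: algebra_simps)
    finally have "w (x, s) \<le> w (x, t) * exp (time_rate * (s - t))" by simp
    then show ?thesis using GQ[OF x, of s] that t by (simp add: k_def w_def)
  qed
  have "\<not> D - time_rate * w (x, t) < 0"
  proof
    assume "D - time_rate * w (x, t) < 0"
    from DERIV_neg_dec_left[OF kd this] obtain d where d: "d > 0" "\<And>h. 0 < h \<Longrightarrow> h < d \<Longrightarrow> k t < k (t - h)" by auto
    define h where "h = min d t / 2"
    have "0 < h" "h < d" "h < t" using d(1) t by (auto simp: h_def)
    then show False using d(2)[of h] k0[of "t - h"] kt by simp
  qed
  then have "time_rate * w (x, t) \<le> (time_rate - 1) * w (x, t)" using upper by linarith
  then show False using wpos by (simp add: algebra_simps)
qed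

text \<open>
  On the frontier \<open>\<zeta> = 0\<close>, so \<open>w\<close> itself is maximal along the frontier and its tangential derivatives
  vanish. In the inward direction the weighted quantity does not increase; as \<open>\<zeta>\<close> grows at least at unit rate
  there, the outward normal derivative of \<open>w\<close> is at least \<open>boundary_rate * w\<close>.
\<close>

lemma weighted_max_not_boundary:
  assumes x: "x \<in> frontier \<Omega>" and t: "0 < t" "t < T" and large: "V0 \<le> slope \<eta> (G (x, t))"
    and max: "\<And>y. y \<in> closure \<Omega> \<Longrightarrow> \<Psi> (y, t) \<le> \<Psi> (x, t)"
  shows False
proof -
  note xc = frontier_closure[OF x]
  have tt: "t \<in> {0<..<T}" using t by simp
  define p where "p = G (x, t)"
  define v where "v = slope \<eta> p"
  define V where "V = v powr (q - 1) *\<^sub>R p - X x"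
  note geo = outward_normal_geometry[OF dom(1) x normal[OF x]]
  have wpos: "0 < w (x, t)" by (rule large_at(2)[OF xc large])
  obtain U where U: "((\<lambda>y. G (y, t)) has_derivative U) (at x within closure \<Omega>)" "\<And>h k. U h \<bullet> k = U k \<bullet> h"
    using ext_grad(3) tt xc by metis
  have Xd: "(X has_derivative X' x) (at x within closure \<Omega>)" using X(1)[OF xc] by (simp add: X_def[abs_def])
  have wd: "((\<lambda>y. w (y, t)) has_derivative (\<lambda>h. V \<bullet> U h - X' x h \<bullet> p)) (at x within closure \<Omega>)"
    unfolding w_def V_def v_def p_def fst_conv by (rule test_quantity_has_derivative[OF eta(1) q U(1) Xd])
  obtain m where m: "m \<ge> 1" "\<And>h. \<zeta>' x h = - m * (\<nu> x \<bullet> h)" using zeta(7)[OF x] by blast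
  have z0: "\<zeta> x = 0" by (rule zeta(6)[OF x])
  have max': "w (y, t) * exp (boundary_rate * \<zeta> y) \<le> w (x, t)" if "y \<in> closure \<Omega>" for y
  proof -
    have "w (y, t) * exp (boundary_rate * \<zeta> y) * exp (- time_rate * t) \<le> w (x, t) * exp (- time_rate * t)"
      using max[OF that] z0 by (simp add: \<Psi>_def mult.assoc flip: exp_add)
    then show ?thesis by simp
  qed
  have tangential: "V \<bullet> U \<tau> - X' x \<tau> \<bullet> p = 0" if tau: "\<tau> \<bullet> \<nu> x = 0" for \<tau>
  proof -
    obtain \<delta> y where y: "\<delta> > 0" "y 0 = x" "\<And>s. \<bar>s\<bar> < \<delta> \<Longrightarrow> y s \<in> frontier \<Omega>" "(y has_vector_derivative \<tau>) (at 0)"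
      using geo(3)[OF tau] by blast
    show ?thesis
    proof (rule derivative_zero_along_boundary_curve[OF wd y(1,2,4)])
      fix s assume s: "\<bar>s\<bar> < \<delta>"
      show "y s \<in> closure \<Omega>" by (rule frontier_closure[OF y(3)[OF s]])
      then show "w (y s, t) \<le> w (x, t)" using max'[of "y s"] zeta(6)[OF y(3)[OF s]] by simp
    qed
  qed
  have nd: "((\<lambda>y. w (y, t) * exp (boundary_rate * \<zeta> y)) has_derivative
    (\<lambda>h. (V \<bullet> U h - X' x h \<bullet> p) + w (x, t) * (boundary_rate * \<zeta>' x h))) (at x within closure \<Omega>)"
    by (auto intro!: derivative_eq_intros wd zeta(1)[OF xc] simp: z0)
  obtain d where d: "d > 0" "\<And>s. 0 < s \<Longrightarrow> s < d \<Longrightarrow> x + s *\<^sub>R (- \<nu> x) \<in> \<Omega>" using geo(2) by blast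
  have "(V \<bullet> U (- \<nu> x) - X' x (- \<nu> x) \<bullet> p) + w (x, t) * (boundary_rate * \<zeta>' x (- \<nu> x)) \<le> 0"
  proof (rule derivative_nonpos_inward[OF nd d(1) _ xc])
    fix s :: real assume "0 < s" "s < d"
    then have "x + s *\<^sub>R (- \<nu> x) \<in> closure \<Omega>" using d(2) mem_closure by blast
    then show "x + s *\<^sub>R (- \<nu> x) \<in> closure \<Omega> \<and> w (x + s *\<^sub>R (- \<nu> x), t) * exp (boundary_rate * \<zeta> (x + s *\<^sub>R (- \<nu> x)))
      \<le> w (x, t) * exp (boundary_rate * \<zeta> x)" using max' z0 by simp
  qed
  moreover have "U (- \<nu> x) = - U (\<nu> x)" "X' x (- \<nu> x) = - X' x (\<nu> x)"
    using has_derivative_linear[OF U(1)] has_derivative_linear[OF Xd] by (simp_all add: linear_neg)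
  moreover have "\<zeta>' x (- \<nu> x) = m" using geo(1) by (simp add: m(2) dot_square_norm)
  ultimately have "w (x, t) * (boundary_rate * m) \<le> V \<bullet> U (\<nu> x) - X' x (\<nu> x) \<bullet> p" by simp
  moreover have "boundary_rate * w (x, t) * 1 \<le> boundary_rate * w (x, t) * m"
    using m(1) wpos boundary_rate_pos by (intro mult_left_mono) auto
  ultimately have normal': "boundary_rate * w (x, t) \<le> V \<bullet> U (\<nu> x) - X' x (\<nu> x) \<bullet> p" by (simp add: mult_ac)
  have BC: "p \<bullet> \<nu> x = \<phi> x * v powr (1 - q)"
    using bc[OF x, of t] t by (simp add: p_def v_def G_def)
  have BC': "N' x \<tau> \<bullet> p + \<nu> x \<bullet> U \<tau> = \<phi>' x \<tau> * v powr (1 - q) + \<phi> x * ((1 - q) * v powr (- 1 - q) * (p \<bullet> U \<tau>))"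
    if tau: "\<tau> \<bullet> \<nu> x = 0" for \<tau>
  proof -
    obtain \<delta> y where y: "\<delta> > 0" "y 0 = x" "\<And>s. \<bar>s\<bar> < \<delta> \<Longrightarrow> y s \<in> frontier \<Omega>" "(y has_vector_derivative \<tau>) (at 0)"
      using geo(3)[OF tau] by blast
    \<comment> \<open>the defect in the boundary condition, which vanishes along the frontier\<close>
    define F where "F y = N y \<bullet> G (y, t) - \<phi> y * slope \<eta> (G (y, t)) powr (1 - q)" for y
    define F' where "F' h = (N x \<bullet> U h + N' x h \<bullet> G (x, t)) - (\<phi> x * ((1 - q) * slope \<eta> (G (x, t)) powr (1 - q - 2) * (G (x, t) \<bullet> U h))
       + \<phi>' x h * slope \<eta> (G (x, t)) powr (1 - q))" for h
    have Fd: "(F has_derivative F') (at x within closure \<Omega>)"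
      unfolding F_def[abs_def] F'_def[abs_def]
      by (intro has_derivative_diff has_derivative_inner has_derivative_mult slope_powr_has_derivative eta(1) U(1) N(1) phi(1) xc)
    have F0: "F z = 0" if "z \<in> frontier \<Omega>" for z
      using bc[OF that, of t] t N(3)[OF that] by (simp add: F_def G_def inner_commute)
    have "F' \<tau> = 0"
      by (rule derivative_zero_along_boundary_curve[OF Fd y(1,2,4)]) (use frontier_closure y(3) F0 x in auto)
    then show ?thesis using N(3)[OF x] by (simp add: F'_def p_def v_def)
  qed
  have "boundary_rate \<le> 2 * (1 + q) * (5 * B + 2 * \<bar>1 - q\<bar> * B\<^sup>2)"
  proof (rule boundary_inequality[where p=p and \<nu>="\<nu> x" and \<phi>="\<phi> x" and X'="X' x" and N'="N' x" and \<phi>'="\<phi>' x" and U=U and w="w (x, t)",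
        OF eta q v_def _ _ _ _ V_def geo(1) _ BC])
    show "2 \<le> v" "2 * (1 + q) * B \<le> v powr q" "2 * \<bar>1 - q\<bar> * B\<^sup>2 \<le> v powr (2 * q)"
      using large V0(1) V0(2)[OF large] by (auto simp: v_def p_def)
    show "w (x, t) = v powr (1 + q) / (1 + q) - X x \<bullet> p" by (simp add: w_def test_quantity_def v_def p_def)
    show "X x = \<phi> x *\<^sub>R \<nu> x" using N(3)[OF x] by (simp add: X_def)
    show "linear U" by (rule has_derivative_linear[OF U(1)])
  qed (use phi(2,3) X(4) N(2) xc U(2) tangential BC' normal' in auto)
  then show False by (simp add: boundary_rate_def)
qed

text \<open>
  Stopping at \<open>T' < T\<close> guarantees that the equation and the boundary condition hold at the maximum point.
\<close>

lemma weighted_bound: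
  assumes "T' < T" "0 \<le> T'" "x \<in> closure \<Omega>" "0 \<le> t" "t \<le> T'"
  shows "\<Psi> (x, t) \<le> base_level"
proof -
  let ?K = "closure \<Omega> \<times> {0..T'}"
  have "compact ?K" using dom(2) by (simp add: compact_Times compact_closure)
  moreover have "?K \<noteq> {}" using dom(3) assms(2) mem_closure by auto
  moreover have "continuous_on ?K \<Psi>"
  proof -
    have "continuous_on (closure \<Omega>) \<zeta>"
      by (rule C2_upto_continuous) (use zeta_C2 in \<open>auto simp: C2_upto_def\<close>)
    then have "continuous_on ?K (\<lambda>p. \<zeta> (fst p))"
      by (rule continuous_on_compose2) (auto intro!: continuous_intros)
    moreover have "continuous_on ?K w"
      by (rule continuous_on_subset[OF continuous_w]) (use assms(1) in auto)
    ultimately show ?thesis unfolding \<Psi>_def[abs_def] by (intro continuous_intros)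
  qed
  ultimately obtain p where p: "p \<in> ?K" "\<And>y. y \<in> ?K \<Longrightarrow> \<Psi> y \<le> \<Psi> p"
    using continuous_attains_sup[of ?K \<Psi>] by blast
  obtain x0 t0 where x0: "p = (x0, t0)" "x0 \<in> closure \<Omega>" "0 \<le> t0" "t0 \<le> T'" using p(1) by (cases p) auto
  \<comment> \<open>whether the maximum is at time \<open>0\<close> or not, the slope there is bounded by the data\<close>
  have small: "slope \<eta> (G (x0, t0)) \<le> V0 + G0 + 1"
  proof (cases "t0 = 0 \<or> slope \<eta> (G (x0, t0)) \<le> V0")
    case True
    moreover have "slope \<eta> (G (x0, t0)) \<le> V0 + G0 + 1" if "t0 = 0"
    proof -
      have "slope \<eta> (G (x0, t0)) \<le> \<bar>\<eta>\<bar> + \<bar>norm (G (x0, t0))\<bar>"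
        unfolding slope_def by (rule sqrt_sum_squares_le_sum_abs)
      also have "\<dots> \<le> 1 + G0" using eta initial[OF x0(2)] that by (simp add: G_def)
      finally show ?thesis using V0(1) by simp
    qed
    ultimately show ?thesis using G0 by auto
  next
    case False
    then have t0: "0 < t0" "t0 < T" and l: "V0 \<le> slope \<eta> (G (x0, t0))" using x0 assms(1) by auto
    have mx: "\<Psi> (y, s) \<le> \<Psi> (x0, t0)" if "y \<in> closure \<Omega>" "0 \<le> s" "s \<le> t0" for y s
      using p(2)[of "(y, s)"] that x0 by auto
    show ?thesis
      using closure_cases[OF x0(2)] weighted_max_not_interior[OF _ t0 l mx]
        weighted_max_not_boundary[OF _ t0 l mx] x0(3) by auto
  qed
  let ?s = "V0 + G0 + 1"
  have s0: "?s \<ge> 0" using V0(1) G0 by simp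
  have "\<Psi> (x, t) \<le> \<Psi> (x0, t0)" using p(2)[of "(x, t)"] assms x0(1) by auto
  also have "\<dots> \<le> (?s powr (1 + q) + B * ?s) * exp (boundary_rate * \<zeta> x0 - time_rate * t0)"
    unfolding \<Psi>_def fst_conv snd_conv by (intro mult_right_mono w_le x0 small) auto
  also have "\<dots> \<le> base_level"
    unfolding base_level_def
  proof (rule mult_left_mono)
    have "boundary_rate * \<zeta> x0 \<le> boundary_rate * B"
      using zeta(3)[OF x0(2)] boundary_rate_pos by (intro mult_left_mono) auto
    moreover have "time_rate * t0 \<ge> 0" using time_rate_pos x0 by simp
    ultimately show "exp (boundary_rate * \<zeta> x0 - time_rate * t0) \<le> exp (boundary_rate * B)" by simp
  qed (use s0 B in auto)
  finally show ?thesis .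
qed

lemma norm_gradient_le:
  assumes "x \<in> closure \<Omega>" "0 \<le> t" "t < T"
  shows "norm (G (x, t)) \<le> gradient_bound"
proof (cases "V0 \<le> slope \<eta> (G (x, t))")
  case False
  have "top_level \<ge> 0" unfolding top_level_def using base_level_pos by simp
  then have "V0 \<le> gradient_bound" using q by (simp add: gradient_bound_def)
  then show ?thesis using False norm_le_slope[of "G (x, t)" \<eta>] by simp
next
  case True
  let ?v = "slope \<eta> (G (x, t))"
  have "w (x, t) * exp (boundary_rate * \<zeta> x - time_rate * t) \<le> base_level"
    using weighted_bound[OF assms(3,2,1,2)] by (simp add: \<Psi>_def)
  then have "w (x, t) * exp (boundary_rate * \<zeta> x - time_rate * t) * exp (time_rate * t - boundary_rate * \<zeta> x)
    \<le> base_level * exp (time_rate * t - boundary_rate * \<zeta> x)" by (intro mult_right_mono) auto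
  then have "w (x, t) \<le> base_level * exp (time_rate * t - boundary_rate * \<zeta> x)"
    by (simp add: mult.assoc flip: exp_add)
  also have "\<dots> \<le> top_level" unfolding top_level_def
  proof (rule mult_left_mono)
    have "boundary_rate * (- \<zeta> x) \<le> boundary_rate * B"
      using zeta(3)[OF assms(1)] boundary_rate_pos by (intro mult_left_mono) auto
    moreover have "time_rate * t \<le> time_rate * T" using assms time_rate_pos by (intro mult_left_mono) auto
    ultimately show "exp (time_rate * t - boundary_rate * \<zeta> x) \<le> exp (boundary_rate * B + time_rate * T)" by simp
  qed (use base_level_pos in simp)
  finally have wt: "w (x, t) \<le> top_level" .
  have "norm (G (x, t)) \<le> ?v powr 1" using norm_le_slope[of "G (x, t)" \<eta>] slope_pos[OF eta(1), of "G (x, t)"] by simp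
  also have "\<dots> \<le> ?v powr (1 + q)" using True V0(1) q by (intro powr_mono) auto
  also have "\<dots> \<le> 2 * (1 + q) * w (x, t)" by (rule large_at(1)[OF assms(1) True])
  also have "\<dots> \<le> 2 * (1 + q) * top_level" using wt q by (intro mult_left_mono) auto
  also have "\<dots> \<le> gradient_bound" using V0(1) by (simp add: gradient_bound_def)
  finally show ?thesis .
qed

text \<open>
  The bound at times before \<open>T\<close> extends to the closed cylinder by continuity.
\<close>

lemma Linf_gradient_le:
  "Linf_norm (closure \<Omega> \<times> {0..T}) G \<le> ereal gradient_bound"
  unfolding Linf_norm_def
proof (rule esssup_I)
  let ?S = "closure \<Omega> \<times> {0..T}"
  have "closed ?S" by (intro closed_Times) auto
  then have "?S \<in> sets lebesgue" by (simp add: borel_closed)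
  then have "(\<lambda>p. norm (G p)) \<in> borel_measurable (lebesgue_on ?S)"
    by (intro continuous_imp_measurable_on_sets_lebesgue continuous_intros ext_grad(1))
  then show "(\<lambda>p. ereal (norm (G p))) \<in> borel_measurable (lebesgue_on ?S)" by simp
  have "norm (G p) \<le> gradient_bound" if "p \<in> ?S" for p
  proof (rule continuous_on_closure_norm_le[where f=G and s="\<Omega> \<times> {0<..<T}"])
    show "continuous_on (closure (\<Omega> \<times> {0<..<T})) G" unfolding closed_cylinder[OF T] by (rule ext_grad(1))
    show "p \<in> closure (\<Omega> \<times> {0<..<T})" unfolding closed_cylinder[OF T] by (rule that)
    show "\<forall>p\<in>\<Omega> \<times> {0<..<T}. norm (G p) \<le> gradient_bound" using norm_gradient_le mem_closure by auto
  qed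
  then show "AE p in lebesgue_on ?S. ereal (norm (G p)) \<le> ereal gradient_bound"
    by (intro AE_I2) auto
qed

end

text \<open>
  The initial condition determines only the values of \<open>u (\<cdot>, 0)\<close>, so the extended gradient at time \<open>0\<close> is first
  identified with the gradient of \<open>u0\<close> in \<open>\<Omega>\<close> and then estimated on the frontier by continuity.
\<close>

lemma initial_gradient_bound:
  fixes u :: "(real ^ 'n) \<times> real \<Rightarrow> real"
  assumes "open \<Omega>" "0 < T" and charts: "\<And>x. x \<in> frontier \<Omega> \<Longrightarrow> \<exists>r e \<gamma>. graph_chart 1 \<Omega> x r e \<gamma>"
    and reg2: "weighted_C parabolic_weight 2 (\<Omega> \<times> {0<..<T}) (closure \<Omega> \<times> {0..T}) u"
    and reg3: "weighted_C parabolic_weight 3 (\<Omega> \<times> {0<..<T}) S u" "\<Omega> \<times> {0<..<T} \<subseteq> S"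
    and u0: "\<And>x. x \<in> closure \<Omega> \<Longrightarrow> u (x, 0) = u0 x"
    and u0': "\<And>x. x \<in> \<Omega> \<Longrightarrow> (u0 has_derivative u0' x) (at x)" "\<And>x h. x \<in> \<Omega> \<Longrightarrow> \<bar>u0' x h\<bar> \<le> G0 * norm h"
    and x: "x \<in> closure \<Omega>"
  shows "norm (ext (\<Omega> \<times> {0<..<T}) (grad_x u) (x, 0)) \<le> G0"
proof -
  define G where "G = ext (\<Omega> \<times> {0<..<T}) (grad_x u)"
  note G = extended_gradient[OF assms(1,2) charts reg2, folded G_def]
  interpret smooth_interior \<Omega> T S u using assms(1) reg3 by unfold_locales
  have uc: "continuous_on (closure \<Omega> \<times> {0..T}) u" using reg2 by (simp add: weighted_C_def)
  have bound: "norm (G (y, 0)) \<le> G0" if y: "y \<in> \<Omega>" for y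
  proof -
    have "((\<lambda>y. u (y, 0)) has_derivative (\<lambda>h. G (y, 0) \<bullet> h)) (at y)"
    proof (rule initial_gradient[OF assms(1,2) uc G(1) _ y])
      fix z t assume "z \<in> \<Omega>" "t \<in> {0<..<T}"
      then show "((\<lambda>y. u (y, t)) has_derivative (\<lambda>h. G (z, t) \<bullet> h)) (at z)"
        using grad_derivative[of z t] G(2)[of "(z, t)"] by simp
    qed
    then have "(u0 has_derivative (\<lambda>h. G (y, 0) \<bullet> h)) (at y)"
      by (rule has_derivative_transform_within_open[OF _ assms(1) y]) (use u0 closure_subset in auto)
    from has_derivative_unique[OF this u0'(1)[OF y]] have "G (y, 0) \<bullet> G (y, 0) = u0' y (G (y, 0))"
      by (rule fun_cong)
    then have "norm (G (y, 0)) * norm (G (y, 0)) \<le> G0 * norm (G (y, 0))"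
      using u0'(2)[OF y, of "G (y, 0)"] by (simp add: dot_square_norm power2_eq_square abs_le_iff)
    moreover have "0 \<le> G0" 
      using order_trans[OF abs_ge_zero u0'(2)[OF y, of "axis undefined 1"]] by simp
    ultimately show ?thesis by (cases "G (y, 0) = 0") auto
  qed
  have "continuous_on (closure \<Omega>) (\<lambda>y. G (y, 0))"
    by (rule continuous_on_compose2[OF G(1)]) (use assms(2) in \<open>auto intro!: continuous_intros\<close>)
  then have "norm ((\<lambda>y. G (y, 0)) x) \<le> G0"
    by (rule continuous_on_closure_norm_le) (use bound x in auto)
  then show ?thesis by (simp add: G_def)
qed

theorem proposition2p5:
  fixes \<Omega> :: "(real ^ 'n) set"
    and \<nu> :: "real ^ 'n \<Rightarrow> real ^ 'n"
    and c f :: "(real ^ 'n) \<times> real \<Rightarrow> real"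
    and \<phi> u0 :: "real ^ 'n \<Rightarrow> real"
    and \<alpha> C T q :: real
  assumes "CARD('n) \<ge> 2"
    and "open \<Omega>" and "connected \<Omega>" and "\<Omega> \<noteq> {}" and "bounded \<Omega>"
    and "C_boundary 3 \<Omega>"
    and "\<forall>x\<in>frontier \<Omega>. outward_unit_normal \<Omega> x (\<nu> x)"
    and "0 < \<alpha>" and "\<alpha> < 1"
    and "C_holder 1 \<alpha> (\<Omega> \<times> UNIV) (closure \<Omega> \<times> UNIV) c"
    and "C_holder 1 \<alpha> (\<Omega> \<times> UNIV) (closure \<Omega> \<times> UNIV) f"
    and "\<forall>x\<in>closure \<Omega>. \<forall>z.
           \<bar>c (x, z)\<bar> \<le> C \<and> norm (ext (\<Omega> \<times> UNIV) (grad_x c) (x, z)) \<le> C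
           \<and> ext (\<Omega> \<times> UNIV) (deriv_snd c) (x, z) \<le> 0"
    and "\<forall>x\<in>closure \<Omega>. \<forall>z.
           \<bar>f (x, z)\<bar> \<le> C \<and> norm (ext (\<Omega> \<times> UNIV) (grad_x f) (x, z)) \<le> C
           \<and> ext (\<Omega> \<times> UNIV) (deriv_snd f) (x, z) \<ge> 0"
    and "C_class 3 \<Omega> (closure \<Omega>) \<phi>"
    and "0 < T"
    and "C_holder 2 \<alpha> \<Omega> (closure \<Omega>) u0"
  shows "\<exists>R>1. \<forall>\<eta>.
           (\<eta> = 1 \<and> q > 0 \<or> 0 < \<eta> \<and> \<eta> \<le> 1 \<and> q = 1) \<and> boundary_compatible \<Omega> \<nu> \<phi> \<eta> q u0 \<longrightarrow>
           (\<forall>\<sigma> u. 0 < \<sigma> \<and> \<sigma> < 1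
              \<and> C_parabolic 2 \<sigma> (\<Omega> \<times> {0<..<T}) (closure \<Omega> \<times> {0..T}) u
              \<and> C_parabolic 3 \<sigma> (\<Omega> \<times> {0<..<T}) (\<Omega> \<times> {0<..T}) u
              \<and> solves_problem \<Omega> \<nu> c f \<phi> T \<eta> q u0 u \<longrightarrow>
              Linf_norm (closure \<Omega> \<times> {0..T}) (ext (\<Omega> \<times> {0<..<T}) (grad_x u)) \<le> ereal R)"
proof (cases "q > 0")
  \<comment> \<open>no pair \<open>(\<eta>, q)\<close> is admissible\<close>
  case False
  then show ?thesis by (intro exI[of _ 2]) auto
next
  case q: True
  note dom = \<open>open \<Omega>\<close> \<open>bounded \<Omega>\<close> \<open>\<Omega> \<noteq> {}\<close>
  have normal: "outward_unit_normal \<Omega> x (\<nu> x)" if "x \<in> frontier \<Omega>" for x using assms(7) that by blast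
  have charts: "\<exists>r e \<gamma>. graph_chart 1 \<Omega> x r e \<gamma>" if "x \<in> frontier \<Omega>" for x
    using normal[OF that] unfolding outward_unit_normal_def by blast
  have sub: "\<Omega> \<subseteq> closure \<Omega>" by (rule closure_subset)
  obtain N N' \<zeta> \<zeta>' where N: "C2_upto \<Omega> N N'" and z: "C2_upto \<Omega> \<zeta> \<zeta>'"
    and bdry: "\<forall>x\<in>frontier \<Omega>. N x = \<nu> x \<and> \<zeta> x = 0 \<and> (\<exists>m\<ge>1. \<forall>h. \<zeta>' x h = - m * (\<nu> x \<bullet> h))"
    using boundary_functions[OF dom(1,2) assms(6,7)] by blast
  obtain \<phi>' where p: "C2_upto \<Omega> \<phi> \<phi>'"
    using C2_upto_of_C_class[OF dom(1,2) charts C_class_mono[OF assms(14)]] by auto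
  have "C_class 2 \<Omega> (closure \<Omega>) u0" using assms(16) by (simp add: C_holder_def)
  then obtain u0' where u0: "C2_upto \<Omega> u0 u0'"
    using C2_upto_of_C_class[OF dom(1,2) charts] by blast
  define X' where "X' x h = \<phi> x *\<^sub>R N' x h + \<phi>' x h *\<^sub>R N x" for x h
  have X: "C2_upto \<Omega> (\<lambda>x. \<phi> x *\<^sub>R N x) X'"
    unfolding X'_def[abs_def] by (rule C2_upto_bilinear[OF bounded_bilinear_scaleR dom(1) p N])
  obtain \<phi>'' Bp where Bp: "C2_bounds \<Omega> \<phi> \<phi>' \<phi>'' Bp" using p unfolding C2_upto_def by blast
  obtain N'' BN where BN: "C2_bounds \<Omega> N N' N'' BN" using N unfolding C2_upto_def by blast
  obtain X'' BX where BX: "C2_bounds \<Omega> (\<lambda>x. \<phi> x *\<^sub>R N x) X' X'' BX" using X unfolding C2_upto_def by blast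
  obtain \<zeta>'' Bz where Bz: "C2_bounds \<Omega> \<zeta> \<zeta>' \<zeta>'' Bz" using z unfolding C2_upto_def by blast
  obtain u0'' G0 where "C2_bounds \<Omega> u0 u0' u0'' G0" using u0 unfolding C2_upto_def by blast
  note u0B = C2_boundsD[OF this]
  define B where "B = \<bar>C\<bar> + Bp + BN + BX + Bz"
  have B: "C \<le> B" "Bp \<le> B" "BN \<le> B" "BX \<le> B" "Bz \<le> B" "0 \<le> B"
    using C2_boundsD(1)[OF Bp] C2_boundsD(1)[OF BN] C2_boundsD(1)[OF BX] C2_boundsD(1)[OF Bz] by (auto simp: B_def)
  obtain V0 where V0: "2 \<le> V0" "\<And>v. V0 \<le> v \<Longrightarrow> 2 * (1 + q) * B \<le> v powr q \<and> B\<^sup>2 \<le> min 1 q * v powr (2 * q)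
    \<and> 2 * \<bar>1 - q\<bar> * B\<^sup>2 \<le> v powr (2 * q)"
    by (rule large_threshold[OF q B(6)]) blast
  have cc: "C_class 1 (\<Omega> \<times> UNIV) (closure \<Omega> \<times> UNIV) c" and fc: "C_class 1 (\<Omega> \<times> UNIV) (closure \<Omega> \<times> UNIV) f"
    using assms(10,11) by (simp_all add: C_holder_def)
  note cd = first_order_coefficient[OF cc dom(1)] and fd = first_order_coefficient[OF fc dom(1)]
  interpret barrier_data \<Omega> \<nu> c f \<phi> \<phi>' \<phi>'' N N' N'' \<zeta> \<zeta>' \<zeta>'' X' X'' B q T V0 G0
  proof
    fix x z assume x: "x \<in> \<Omega>"
    then have xc: "x \<in> closure \<Omega>" using sub by blast
    have ca: "\<bar>c (x, z)\<bar> \<le> C" "norm (ext (\<Omega> \<times> UNIV) (grad_x c) (x, z)) \<le> C" "ext (\<Omega> \<times> UNIV) (deriv_snd c) (x, z) \<le> 0"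
      and fa: "norm (ext (\<Omega> \<times> UNIV) (grad_x f) (x, z)) \<le> C" "ext (\<Omega> \<times> UNIV) (deriv_snd f) (x, z) \<ge> 0"
      using assms(12,13) xc by blast+
    show "\<bar>c (x, z)\<bar> \<le> B" using ca B(1) by linarith
    show "norm (grad_x c (x, z)) \<le> B" "deriv_snd c (x, z) \<le> 0" using ca cd(2,3)[OF x] B(1) by auto
    show "norm (grad_x f (x, z)) \<le> B" "deriv_snd f (x, z) \<ge> 0" using fa fd(2,3)[OF x] B(1) by auto
  qed (use dom normal q assms(15) u0B(1) bdry V0 cd(1) fd(1) C2_bounds_mono[OF Bp B(2)] C2_bounds_mono[OF BN B(3)]
      C2_bounds_mono[OF BX B(4)] C2_bounds_mono[OF Bz B(5)] in blast)+
  have "Linf_norm (closure \<Omega> \<times> {0..T}) (ext (\<Omega> \<times> {0<..<T}) (grad_x u)) \<le> ereal gradient_bound"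
    if eta: "0 < \<eta>" "\<eta> \<le> 1"
      and reg: "C_parabolic 2 \<sigma> (\<Omega> \<times> {0<..<T}) (closure \<Omega> \<times> {0..T}) u" "C_parabolic 3 \<sigma> (\<Omega> \<times> {0<..<T}) (\<Omega> \<times> {0<..T}) u"
      and sol: "solves_problem \<Omega> \<nu> c f \<phi> T \<eta> q u0 u" for \<eta> \<sigma> u
  proof -
    have reg2: "weighted_C parabolic_weight 2 (\<Omega> \<times> {0<..<T}) (closure \<Omega> \<times> {0..T}) u"
      and reg3: "weighted_C parabolic_weight 3 (\<Omega> \<times> {0<..<T}) (\<Omega> \<times> {0<..T}) u"
      using reg by (simp_all add: C_parabolic_def)
    have sub': "\<Omega> \<times> {0<..<T} \<subseteq> \<Omega> \<times> {0<..T}" by auto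
    note sol' = sol[unfolded solves_problem_def]
    have init: "norm (ext (\<Omega> \<times> {0<..<T}) (grad_x u) (x, 0)) \<le> G0" if "x \<in> closure \<Omega>" for x
    proof (rule initial_gradient_bound[OF dom(1) assms(15) charts reg2 reg3 sub' _ _ _ that])
      show "u (x, 0) = u0 x" if "x \<in> closure \<Omega>" for x using sol' that by blast
      show "(u0 has_derivative u0' x) (at x)" if "x \<in> \<Omega>" for x
        using u0B(2)[of x] at_within_closure_open[OF dom(1) that] sub that by auto
      show "\<bar>u0' x h\<bar> \<le> G0 * norm h" if "x \<in> \<Omega>" for x h
        using u0B(4)[of x h] sub that by auto
    qed
    interpret barrier_solution \<Omega> \<nu> c f \<phi> \<phi>' \<phi>'' N N' N'' \<zeta> \<zeta>' \<zeta>'' X' X'' B q T V0 G0 \<eta> u "\<Omega> \<times> {0<..T}"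
      by unfold_locales (use eta reg2 reg3 sub' sol' init in blast)+
    show ?thesis using Linf_gradient_le unfolding G_def .
  qed
  note bound = this
  show ?thesis
  proof (intro exI[of _ "max 2 gradient_bound"] conjI allI impI)
    fix \<eta> \<sigma> u
    assume "(\<eta> = 1 \<and> q > 0 \<or> 0 < \<eta> \<and> \<eta> \<le> 1 \<and> q = 1) \<and> boundary_compatible \<Omega> \<nu> \<phi> \<eta> q u0"
      and "0 < \<sigma> \<and> \<sigma> < 1
              \<and> C_parabolic 2 \<sigma> (\<Omega> \<times> {0<..<T}) (closure \<Omega> \<times> {0..T}) u
              \<and> C_parabolic 3 \<sigma> (\<Omega> \<times> {0<..<T}) (\<Omega> \<times> {0<..T}) u
              \<and> solves_problem \<Omega> \<nu> c f \<phi> T \<eta> q u0 u"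
    then have "Linf_norm (closure \<Omega> \<times> {0..T}) (ext (\<Omega> \<times> {0<..<T}) (grad_x u)) \<le> ereal gradient_bound"
      by (intro bound[of \<eta> \<sigma> u]) auto
    also have "\<dots> \<le> ereal (max 2 gradient_bound)" by simp
    finally show "Linf_norm (closure \<Omega> \<times> {0..T}) (ext (\<Omega> \<times> {0<..<T}) (grad_x u)) \<le> ereal (max 2 gradient_bound)" .
  qed simp
qed

end
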